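(* Let $(\Omega,\mathcal F)$ be a measurable space and $\mathfrak P\subset\Delta(\mathcal F)$ nonempty. Suppose there is a normed space $(\mathcal Y,TV)\subset(ba_{\mathbf c},TV)$ whose dual space is given by $(L^\infty_{\mathbf c},\|\cdot\|_{L^\infty_{\mathbf c}})$. For a convex monetary risk measure $\rho:L^\infty_{\mathbf c}\to\mathbb R$ consider the properties (F2) for all nets $(X_\alpha)_{\alpha\in I}$ and $X$ in $L^\infty_{\mathbf c}$: if $X_\alpha\to X$ in order, then $\rho(X)\le\liminf_{\alpha\in I}\rho(X_\alpha)$; (F3) there is a function $\beta: sca_{\mathbf c}\cap\Delta(\mathcal F)\to\mathbb R\cup\{\infty\}$, bounded from below, $\beta\not\equiv\infty$, with $\rho(X)=\sup_{\mathbb Q\in sca_{\mathbf c}\cap\Delta(\mathcal F)}\big(\mathbb E_{\mathbb Q}[X]-\beta(\mathbb Q)\big)$ for all $X\in L^\infty_{\mathbf c}$; (F4) there is a function $\gamma:\mathcal Y\to\mathbb R\cup\{\infty\}$, bounded from below, $\gamma\not\equiv\infty$, with $\rho(X)=\sup_{\mu\in\mathcal Y}\big(\int X\,d\mu-\gamma(\mu)\big)$ for all $X\in L^\infty_{\mathbf c}$. (1) If, for all convex monetary risk measures $\rho$ on $L^\infty_{\mathbf c}$, (F2) and (F4) are equivalent properties, then $sca_{\mathbf c}^*=L^\infty_{\mathbf c}$. (2) If $sca_{\mathbf c}^*=L^\infty_{\mathbf c}$, then (F2) and (F3) are equivalent properties of convex monetary risk measures $\rho$ on $L^\infty_{\mathbf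 c}$.
   Context: $\Delta(\mathcal F)$ is the set of probability measures on $(\Omega,\mathcal F)$; $ba$ is the Banach lattice of finitely additive real set functions on $\mathcal F$ with bounded total variation, with norm $TV$ and modulus $|\mu|$; $ca\subset ba$ consists of the countably additive ones. Put $\mathbf c(A)=\sup_{\mathbb P\in\mathfrak P}\mathbb P(A)$. $\mu\ll\mathfrak P$ means $\mathbf c(N)=0$ implies $|\mu|(N)=0$. $ba_{\mathbf c}=\{\mu\in ba\mid\mu\ll\mathfrak P\}$, $ca_{\mathbf c}=ca\cap ba_{\mathbf c}$. A property holds $\mathfrak P$-quasi surely (q.s.) if it holds outside an event $A$ with $\mathbf c(A)=0$. $L^0_{\mathbf c}$ is the vector lattice of classes, up to $\mathfrak P$-q.s. equality, of real-valued random variables, with order $X\preceq Y$ iff $f\le g$ $\mathfrak P$-q.s. for representatives. $L^\infty_{\mathbf c}=\{X\in L^0_{\mathbf c}\mid\exists m>0:\ |X|\preceq m\mathbf 1_\Omega\}$ with norm $\|X\|_{L^\infty_{\mathbf c}}=\inf\{m>0\mid|X|\preceq m\mathbf 1_\Omega\}$; $\mathbf 1_A$ is the class of the indicator of $A$. A measure $\mu$ is supported if there is $S(\mu)\in\mathcal F$ with $\mu(S(\mu)^c)=0$ such that every $N\in\mathcal F$ with $\mu(N\cap S(\mu))=0$ satisfies $\mathbf c(N\cap S(\mu))=0$; a signed $\mu\in ca_{\mathbf c}$ is supported if $|\mu|$ is; $sca_{\mathbf c}$ is the set of supported $\mu\in ca_{\mathbf c}$. Duals are norm duals with respect to $TV$,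 identified via the pairing $(X,\mu)\mapsto\int X\,d\mu$; thus $sca_{\mathbf c}^*=L^\infty_{\mathbf c}$ means that $X\mapsto(\mu\mapsto\int X\,d\mu)$ identifies $L^\infty_{\mathbf c}$ with the norm dual of $(sca_{\mathbf c},TV)$. A net $(X_\alpha)_{\alpha\in I}$ order converges to $X$ if there is a decreasing net $(Y_\alpha)_{\alpha\in I}$ with infimum $0$ and $|X_\alpha-X|\preceq Y_\alpha$ for all $\alpha$. A convex (monetary) risk measure on $L^\infty_{\mathbf c}$ is a convex function $\rho:L^\infty_{\mathbf c}\to\mathbb R$ that is monotone ($X\preceq Y$ implies $\rho(X)\le\rho(Y)$) and cash-additive ($\rho(X+m\mathbf 1_\Omega)=\rho(X)+m$ for all $X\in L^\infty_{\mathbf c}$, $m\in\mathbb R$). *)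

theory Defs
  imports "HOL-Probability.Probability"
begin

text \<open>
  Throughout, the measurable space is given by a value \<open>M :: 'a measure\<close> of which only
  \<open>space M\<close> and \<open>sets M\<close> are used, and \<open>P\<close> is a nonempty set of probability measures on it.
\<close>

definition prob_measures :: "'a measure \<Rightarrow> 'a measure set" where
  "prob_measures M = {Q. prob_space Q \<and> sets Q = sets M}"

definition capacity :: "'a measure set \<Rightarrow> 'a set \<Rightarrow> real" where
  "capacity P A = (SUP Q\<in>P. measure Q A)"

definition quasi_surely :: "'a measure \<Rightarrow> 'a measure set \<Rightarrow> ('a \<Rightarrow> bool) \<Rightarrow> bool" where
  "quasi_surely M P \<phi> \<longleftrightarrow> (\<exists>A\<in>sets M. capacity P A = 0 \<and> (\<forall>\<omega>\<in>space M - A. \<phi> \<omega>))"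


section \<open>The spaces of classes of random variables\<close>

definition qs_rel :: "'a measure \<Rightarrow> 'a measure set \<Rightarrow> (('a \<Rightarrow> real) \<times> ('a \<Rightarrow> real)) set" where
  "qs_rel M P = {(f, g). f \<in> borel_measurable M \<and> g \<in> borel_measurable M \<and>
     quasi_surely M P (\<lambda>\<omega>. f \<omega> = g \<omega>)}"

definition L0 :: "'a measure \<Rightarrow> 'a measure set \<Rightarrow> ('a \<Rightarrow> real) set set" where
  "L0 M P = borel_measurable M // qs_rel M P"

definition qs_class :: "'a measure \<Rightarrow> 'a measure set \<Rightarrow> ('a \<Rightarrow> real) \<Rightarrow> ('a \<Rightarrow> real) set" where
  "qs_class M P f = qs_rel M P `` {f}"

definition rep :: "('a \<Rightarrow> real) set \<Rightarrow> 'a \<Rightarrow> real" where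
  "rep X = (SOME f. f \<in> X)"

definition L_le :: "'a measure \<Rightarrow> 'a measure set \<Rightarrow> ('a \<Rightarrow> real) set \<Rightarrow> ('a \<Rightarrow> real) set \<Rightarrow> bool" where
  "L_le M P X Y \<longleftrightarrow> (\<exists>f\<in>X. \<exists>g\<in>Y. quasi_surely M P (\<lambda>\<omega>. f \<omega> \<le> g \<omega>))"

definition L_ind :: "'a measure \<Rightarrow> 'a measure set \<Rightarrow> 'a set \<Rightarrow> ('a \<Rightarrow> real) set" where
  "L_ind M P A = qs_class M P (indicator A)"

definition L_zero :: "'a measure \<Rightarrow> 'a measure set \<Rightarrow> ('a \<Rightarrow> real) set" where
  "L_zero M P = qs_class M P (\<lambda>_. 0)"

definition L_add :: "'a measure \<Rightarrow> 'a measure set \<Rightarrow> ('a \<Rightarrow> real) set \<Rightarrow> ('a \<Rightarrow> real) set \<Rightarrow> ('a \<Rightarrow> real) set" where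
  "L_add M P X Y = qs_class M P (\<lambda>\<omega>. rep X \<omega> + rep Y \<omega>)"

definition L_scale :: "'a measure \<Rightarrow> 'a measure set \<Rightarrow> real \<Rightarrow> ('a \<Rightarrow> real) set \<Rightarrow> ('a \<Rightarrow> real) set" where
  "L_scale M P a X = qs_class M P (\<lambda>\<omega>. a * rep X \<omega>)"

definition L_diff :: "'a measure \<Rightarrow> 'a measure set \<Rightarrow> ('a \<Rightarrow> real) set \<Rightarrow> ('a \<Rightarrow> real) set \<Rightarrow> ('a \<Rightarrow> real) set" where
  "L_diff M P X Y = qs_class M P (\<lambda>\<omega>. rep X \<omega> - rep Y \<omega>)"

definition L_abs :: "'a measure \<Rightarrow> 'a measure set \<Rightarrow> ('a \<Rightarrow> real) set \<Rightarrow> ('a \<Rightarrow> real) set" where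
  "L_abs M P X = qs_class M P (\<lambda>\<omega>. \<bar>rep X \<omega>\<bar>)"

definition L_infty :: "'a measure \<Rightarrow> 'a measure set \<Rightarrow> ('a \<Rightarrow> real) set set" where
  "L_infty M P = {X \<in> L0 M P. \<exists>m>0. L_le M P (L_abs M P X) (L_scale M P m (L_ind M P (space M)))}"

definition L_infty_norm :: "'a measure \<Rightarrow> 'a measure set \<Rightarrow> ('a \<Rightarrow> real) set \<Rightarrow> real" where
  "L_infty_norm M P X =
     Inf {m. m > 0 \<and> L_le M P (L_abs M P X) (L_scale M P m (L_ind M P (space M)))}"


section \<open>Spaces of set functions\<close>

text \<open>
  A set function on \<open>sets M\<close> is represented by its extension by \<open>0\<close> to all of \<open>'a set\<close>,
  so that equality of set functions is HOL equality and the vector space operations are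
  pointwise.  The set function of a measure \<open>Q\<close> with \<open>sets Q = sets M\<close> is then just
  \<open>measure Q\<close>, which vanishes outside \<open>sets Q\<close>.
\<close>

definition variation_sums :: "'a measure \<Rightarrow> ('a set \<Rightarrow> real) \<Rightarrow> 'a set \<Rightarrow> real set" where
  "variation_sums M \<mu> A =
     {(\<Sum>B\<in>\<A>. \<bar>\<mu> B\<bar>) | \<A>. finite \<A> \<and> \<A> \<subseteq> sets M \<and> partition_on A \<A>}"

definition modulus :: "'a measure \<Rightarrow> ('a set \<Rightarrow> real) \<Rightarrow> 'a set \<Rightarrow> real" where
  "modulus M \<mu> A = (if A \<in> sets M then Sup (variation_sums M \<mu> A) else 0)"

definition TV :: "'a measure \<Rightarrow> ('a set \<Rightarrow> real) \<Rightarrow> real" where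
  "TV M \<mu> = modulus M \<mu> (space M)"

definition ba :: "'a measure \<Rightarrow> ('a set \<Rightarrow> real) set" where
  "ba M = {\<mu>. (\<forall>A. A \<notin> sets M \<longrightarrow> \<mu> A = 0) \<and> Measure_Space.additive (sets M) \<mu> \<and>
     bdd_above (variation_sums M \<mu> (space M))}"

definition ca :: "'a measure \<Rightarrow> ('a set \<Rightarrow> real) set" where
  "ca M = {\<mu> \<in> ba M. \<forall>A::nat \<Rightarrow> 'a set. range A \<subseteq> sets M \<longrightarrow> disjoint_family A \<longrightarrow>
     (\<lambda>n. \<mu> (A n)) sums \<mu> (\<Union>n. A n)}"

definition ba_c :: "'a measure \<Rightarrow> 'a measure set \<Rightarrow> ('a set \<Rightarrow> real) set" where
  "ba_c M P = {\<mu> \<in> ba M. \<forall>N\<in>sets M. capacity P N = 0 \<longrightarrow> modulus M \<mu> N = 0}"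

definition ca_c :: "'a measure \<Rightarrow> 'a measure set \<Rightarrow> ('a set \<Rightarrow> real) set" where
  "ca_c M P = ca M \<inter> ba_c M P"

definition supported :: "'a measure \<Rightarrow> 'a measure set \<Rightarrow> ('a set \<Rightarrow> real) \<Rightarrow> bool" where
  "supported M P \<mu> \<longleftrightarrow> (\<exists>S\<in>sets M. \<mu> (space M - S) = 0 \<and>
     (\<forall>N\<in>sets M. \<mu> (N \<inter> S) = 0 \<longrightarrow> capacity P (N \<inter> S) = 0))"

definition sca_c :: "'a measure \<Rightarrow> 'a measure set \<Rightarrow> ('a set \<Rightarrow> real) set" where
  "sca_c M P = {\<mu> \<in> ca_c M P. supported M P (modulus M \<mu>)}"

definition sca_prob :: "'a measure \<Rightarrow> 'a measure set \<Rightarrow> 'a measure set" where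
  "sca_prob M P = {Q \<in> prob_measures M. measure Q \<in> sca_c M P}"


section \<open>The pairing and norm duals\<close>

definition simple_fa_integral :: "'a measure \<Rightarrow> ('a set \<Rightarrow> real) \<Rightarrow> ('a \<Rightarrow> real) \<Rightarrow> real" where
  "simple_fa_integral M \<mu> s = (\<Sum>y\<in>s ` space M. y * \<mu> (s -` {y} \<inter> space M))"

text \<open>
  For \<open>X \<in> L_infty M P\<close> and \<open>\<mu> \<in> ba_c M P\<close> the integral is the limit of the integrals of simple
  functions converging uniformly to a (necessarily bounded) representative of \<open>X\<close>; the limit
  depends neither on the representative nor on the approximating sequence.
\<close>

definition fa_integral :: "'a measure \<Rightarrow> ('a set \<Rightarrow> real) \<Rightarrow> ('a \<Rightarrow> real) set \<Rightarrow> real" where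
  "fa_integral M \<mu> X = (THE l. \<exists>f\<in>X. \<exists>s. (\<forall>n::nat. simple_function M (s n)) \<and>
     uniform_limit (space M) s f sequentially \<and> (\<lambda>n. simple_fa_integral M \<mu> (s n)) \<longlonglongrightarrow> l)"

definition linear_subspace :: "('a set \<Rightarrow> real) set \<Rightarrow> bool" where
  "linear_subspace V \<longleftrightarrow> (\<lambda>_. 0) \<in> V \<and> (\<forall>\<mu>\<in>V. \<forall>\<nu>\<in>V. (\<lambda>A. \<mu> A + \<nu> A) \<in> V) \<and>
     (\<forall>a. \<forall>\<mu>\<in>V. (\<lambda>A. a * \<mu> A) \<in> V)"

definition TV_dual :: "'a measure \<Rightarrow> ('a set \<Rightarrow> real) set \<Rightarrow> (('a set \<Rightarrow> real) \<Rightarrow> real) set" where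
  "TV_dual M V = {\<phi> \<in> extensional V.
     (\<forall>\<mu>\<in>V. \<forall>\<nu>\<in>V. \<phi> (\<lambda>A. \<mu> A + \<nu> A) = \<phi> \<mu> + \<phi> \<nu>) \<and>
     (\<forall>a. \<forall>\<mu>\<in>V. \<phi> (\<lambda>A. a * \<mu> A) = a * \<phi> \<mu>) \<and>
     (\<exists>K. \<forall>\<mu>\<in>V. \<bar>\<phi> \<mu>\<bar> \<le> K * TV M \<mu>)}"

definition TV_dual_norm :: "'a measure \<Rightarrow> ('a set \<Rightarrow> real) set \<Rightarrow> (('a set \<Rightarrow> real) \<Rightarrow> real) \<Rightarrow> real" where
  "TV_dual_norm M V \<phi> = Sup {\<bar>\<phi> \<mu>\<bar> | \<mu>. \<mu> \<in> V \<and> TV M \<mu> \<le> 1}"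

definition pairing :: "'a measure \<Rightarrow> ('a set \<Rightarrow> real) set \<Rightarrow> ('a \<Rightarrow> real) set \<Rightarrow> ('a set \<Rightarrow> real) \<Rightarrow> real" where
  "pairing M V X = (\<lambda>\<mu>\<in>V. fa_integral M \<mu> X)"

definition dual_is_L_infty :: "'a measure \<Rightarrow> 'a measure set \<Rightarrow> ('a set \<Rightarrow> real) set \<Rightarrow> bool" where
  "dual_is_L_infty M P V \<longleftrightarrow> bij_betw (pairing M V) (L_infty M P) (TV_dual M V) \<and>
     (\<forall>X\<in>L_infty M P. TV_dual_norm M V (pairing M V X) = L_infty_norm M P X)"


section \<open>Nets and order convergence in \<open>L_infty\<close>\<close>

definition directed :: "'i set \<Rightarrow> ('i \<Rightarrow> 'i \<Rightarrow> bool) \<Rightarrow> bool" where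
  "directed I le \<longleftrightarrow> I \<noteq> {} \<and> (\<forall>i\<in>I. le i i) \<and>
     (\<forall>i\<in>I. \<forall>j\<in>I. \<forall>k\<in>I. le i j \<longrightarrow> le j k \<longrightarrow> le i k) \<and>
     (\<forall>i\<in>I. \<forall>j\<in>I. \<exists>k\<in>I. le i k \<and> le j k)"

definition net_liminf :: "'i set \<Rightarrow> ('i \<Rightarrow> 'i \<Rightarrow> bool) \<Rightarrow> ('i \<Rightarrow> real) \<Rightarrow> ereal" where
  "net_liminf I le x = (SUP i\<in>I. INF j\<in>{j\<in>I. le i j}. ereal (x j))"

definition order_converges ::
  "'a measure \<Rightarrow> 'a measure set \<Rightarrow> 'i set \<Rightarrow> ('i \<Rightarrow> 'i \<Rightarrow> bool) \<Rightarrow> ('i \<Rightarrow> ('a \<Rightarrow> real) set) \<Rightarrow>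
     ('a \<Rightarrow> real) set \<Rightarrow> bool" where
  "order_converges M P I le Xs X \<longleftrightarrow> (\<exists>Ys. (\<forall>i\<in>I. Ys i \<in> L_infty M P) \<and>
     (\<forall>i\<in>I. \<forall>j\<in>I. le i j \<longrightarrow> L_le M P (Ys j) (Ys i)) \<and>
     (\<forall>i\<in>I. L_le M P (L_zero M P) (Ys i)) \<and>
     (\<forall>Z\<in>L_infty M P. (\<forall>i\<in>I. L_le M P Z (Ys i)) \<longrightarrow> L_le M P Z (L_zero M P)) \<and>
     (\<forall>i\<in>I. L_le M P (L_abs M P (L_diff M P (Xs i) X)) (Ys i)))"

definition fatou_for_nets_over ::
  "'i itself \<Rightarrow> 'a measure \<Rightarrow> 'a measure set \<Rightarrow> (('a \<Rightarrow> real) set \<Rightarrow> real) \<Rightarrow> bool" where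
  "fatou_for_nets_over _ M P \<rho> \<longleftrightarrow> (\<forall>(I :: 'i set) le Xs X.
     directed I le \<longrightarrow> (\<forall>i\<in>I. Xs i \<in> L_infty M P) \<longrightarrow> X \<in> L_infty M P \<longrightarrow>
     order_converges M P I le Xs X \<longrightarrow>
     ereal (\<rho> X) \<le> net_liminf I le (\<lambda>i. \<rho> (Xs i)))"


section \<open>Risk measures and their properties\<close>

definition convex_risk_measure ::
  "'a measure \<Rightarrow> 'a measure set \<Rightarrow> (('a \<Rightarrow> real) set \<Rightarrow> real) \<Rightarrow> bool" where
  "convex_risk_measure M P \<rho> \<longleftrightarrow>
     (\<forall>X\<in>L_infty M P. \<forall>Y\<in>L_infty M P. \<forall>t\<in>{0..1}.
        \<rho> (L_add M P (L_scale M P t X) (L_scale M P (1 - t) Y)) \<le> t * \<rho> X + (1 - t) * \<rho> Y) \<and>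
     (\<forall>X\<in>L_infty M P. \<forall>Y\<in>L_infty M P. L_le M P X Y \<longrightarrow> \<rho> X \<le> \<rho> Y) \<and>
     (\<forall>X\<in>L_infty M P. \<forall>m.
        \<rho> (L_add M P X (L_scale M P m (L_ind M P (space M)))) = \<rho> X + m)"

text \<open>
  HOL cannot quantify over all index types inside a formula, so the index sets of the nets are
  taken to be subsets of one type.  Lemma \<open>property_F2_all_nets\<close> below shows that this type is
  large enough: the property then holds for nets over index sets in any type.
\<close>

definition property_F2 ::
  "'a measure \<Rightarrow> 'a measure set \<Rightarrow> (('a \<Rightarrow> real) set \<Rightarrow> real) \<Rightarrow> bool" where
  "property_F2 M P \<rho> \<longleftrightarrow> fatou_for_nets_over TYPE(('a \<Rightarrow> real) set \<times> ('a \<Rightarrow> real) set) M P \<rho>"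

definition property_F3 ::
  "'a measure \<Rightarrow> 'a measure set \<Rightarrow> (('a \<Rightarrow> real) set \<Rightarrow> real) \<Rightarrow> bool" where
  "property_F3 M P \<rho> \<longleftrightarrow> (\<exists>\<beta> :: 'a measure \<Rightarrow> ereal.
     (\<exists>b::real. \<forall>Q\<in>sca_prob M P. ereal b \<le> \<beta> Q) \<and>
     (\<exists>Q\<in>sca_prob M P. \<beta> Q \<noteq> \<infinity>) \<and>
     (\<forall>X\<in>L_infty M P.
        ereal (\<rho> X) = (SUP Q\<in>sca_prob M P. ereal (integral\<^sup>L Q (rep X)) - \<beta> Q)))"

definition property_F4 ::
  "'a measure \<Rightarrow> 'a measure set \<Rightarrow> ('a set \<Rightarrow> real) set \<Rightarrow> (('a \<Rightarrow> real) set \<Rightarrow> real) \<Rightarrow> bool" where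
  "property_F4 M P V \<rho> \<longleftrightarrow> (\<exists>\<gamma> :: ('a set \<Rightarrow> real) \<Rightarrow> ereal.
     (\<exists>b::real. \<forall>\<mu>\<in>V. ereal b \<le> \<gamma> \<mu>) \<and>
     (\<exists>\<mu>\<in>V. \<gamma> \<mu> \<noteq> \<infinity>) \<and>
     (\<forall>X\<in>L_infty M P. ereal (\<rho> X) = (SUP \<mu>\<in>V. ereal (fa_integral M \<mu> X) - \<gamma> \<mu>)))"


lemma capacity_Un_null:
  assumes P: "P \<noteq> {}" "P \<subseteq> prob_measures M" and A: "A \<in> sets M" "B \<in> sets M"
    and c: "capacity P A = 0" "capacity P B = 0"
  shows "capacity P (A \<union> B) = 0"
proof -
  have null: "measure Q C = 0" if "Q \<in> P" "capacity P C = 0" for Q C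
  proof -
    have "bdd_above ((\<lambda>Q. measure Q C) ` P)"
      using P(2) by (intro bdd_aboveI[where M=1])
        (auto simp: prob_measures_def prob_space.prob_le_1)
    then have "measure Q C \<le> capacity P C"
      unfolding capacity_def using that(1) by (rule cSUP_upper[rotated])
    then show ?thesis using that(2) by (simp add: measure_le_0_iff)
  qed
  have "measure Q (A \<union> B) = 0" if Q: "Q \<in> P" for Q
  proof -
    interpret prob_space Q using P(2) Q by (auto simp: prob_measures_def)
    have "sets Q = sets M" using P(2) Q by (auto simp: prob_measures_def)
    then have "measure Q (A \<union> B) \<le> measure Q A + measure Q B"
      using A by (intro measure_Un_le) auto
    then show ?thesis using null[OF Q c(1)] null[OF Q c(2)] by (simp add: measure_le_0_iff)
  qed
  then show ?thesis unfolding capacity_def using P(1) by simp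
qed

lemma quasi_surely_mp2:
  assumes P: "P \<noteq> {}" "P \<subseteq> prob_measures M"
    and "quasi_surely M P \<phi>" "quasi_surely M P \<psi>"
    and "\<And>\<omega>. \<phi> \<omega> \<Longrightarrow> \<psi> \<omega> \<Longrightarrow> \<theta> \<omega>"
  shows "quasi_surely M P \<theta>"
proof -
  from assms(3,4) obtain A B where "A \<in> sets M" "capacity P A = 0" "\<forall>\<omega>\<in>space M - A. \<phi> \<omega>"
    "B \<in> sets M" "capacity P B = 0" "\<forall>\<omega>\<in>space M - B. \<psi> \<omega>"
    unfolding quasi_surely_def by blast
  then show ?thesis unfolding quasi_surely_def
    using capacity_Un_null[OF P] assms(5) by (intro bexI[of _ "A \<union> B"]) auto
qed

lemma L0_members:
  assumes P: "P \<noteq> {}" "P \<subseteq> prob_measures M" and "X \<in> L0 M P"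
  shows "X \<noteq> {}" and "\<And>f g. f \<in> X \<Longrightarrow> g \<in> X \<Longrightarrow> quasi_surely M P (\<lambda>\<omega>. f \<omega> = g \<omega>)"
proof -
  obtain h where h: "h \<in> borel_measurable M" "X = qs_rel M P `` {h}"
    using assms(3) unfolding L0_def by (rule quotientE)
  have "capacity P {} = 0" unfolding capacity_def using P(1) by simp
  then have "quasi_surely M P (\<lambda>\<omega>. h \<omega> = h \<omega>)" unfolding quasi_surely_def by auto
  then have "h \<in> X" using h by (auto simp: qs_rel_def)
  then show "X \<noteq> {}" by blast
  fix f g assume "f \<in> X" "g \<in> X"
  then have "quasi_surely M P (\<lambda>\<omega>. h \<omega> = f \<omega>)" "quasi_surely M P (\<lambda>\<omega>. h \<omega> = g \<omega>)"
    using h(2) by (auto simp: qs_rel_def)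
  then show "quasi_surely M P (\<lambda>\<omega>. f \<omega> = g \<omega>)"
    by (rule quasi_surely_mp2[OF P]) simp
qed

lemma L_le_refl:
  assumes P: "P \<noteq> {}" "P \<subseteq> prob_measures M" and X: "X \<in> L0 M P"
  shows "L_le M P X X"
proof -
  obtain f where f: "f \<in> X" using L0_members(1)[OF P X] by blast
  have "quasi_surely M P (\<lambda>\<omega>. f \<omega> \<le> f \<omega>)"
    using L0_members(2)[OF P X f f] unfolding quasi_surely_def by auto
  then show ?thesis unfolding L_le_def using f by blast
qed

lemma L_le_trans:
  assumes P: "P \<noteq> {}" "P \<subseteq> prob_measures M" and Y: "Y \<in> L0 M P"
    and XY: "L_le M P X Y" and YZ: "L_le M P Y Z"
  shows "L_le M P X Z"
proof -
  obtain f g where f: "f \<in> X" "g \<in> Y" "quasi_surely M P (\<lambda>\<omega>. f \<omega> \<le> g \<omega>)"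
    using XY unfolding L_le_def by blast
  obtain g' h where h: "g' \<in> Y" "h \<in> Z" "quasi_surely M P (\<lambda>\<omega>. g' \<omega> \<le> h \<omega>)"
    using YZ unfolding L_le_def by blast
  have "quasi_surely M P (\<lambda>\<omega>. f \<omega> \<le> g' \<omega>)"
    by (rule quasi_surely_mp2[OF P f(3) L0_members(2)[OF P Y f(2) h(1)]]) simp
  then have "quasi_surely M P (\<lambda>\<omega>. f \<omega> \<le> h \<omega>)"
    by (rule quasi_surely_mp2[OF P _ h(3)]) simp
  then show ?thesis unfolding L_le_def using f h by blast
qed

lemma property_F2_all_nets:
  assumes P: "P \<noteq> {}" "P \<subseteq> prob_measures M" and F2: "property_F2 M P \<rho>"
  shows "fatou_for_nets_over TYPE('i) M P \<rho>"
  unfolding fatou_for_nets_over_def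
proof (intro allI impI, rule ccontr)
  fix I :: "'i set" and le Xs X
  assume dir: "directed I le" and Xs: "\<forall>i\<in>I. Xs i \<in> L_infty M P" and X: "X \<in> L_infty M P"
    and conv: "order_converges M P I le Xs X"
    and neg: "\<not> ereal (\<rho> X) \<le> net_liminf I le (\<lambda>i. \<rho> (Xs i))"
  obtain Ys where Ys: "\<forall>i\<in>I. Ys i \<in> L_infty M P"
    "\<forall>i\<in>I. \<forall>j\<in>I. le i j \<longrightarrow> L_le M P (Ys j) (Ys i)"
    "\<forall>i\<in>I. L_le M P (L_zero M P) (Ys i)"
    "\<forall>Z\<in>L_infty M P. (\<forall>i\<in>I. L_le M P Z (Ys i)) \<longrightarrow> L_le M P Z (L_zero M P)"
    "\<forall>i\<in>I. L_le M P (L_abs M P (L_diff M P (Xs i) X)) (Ys i)"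
    using conv unfolding order_converges_def by (elim exE conjE)
  have Y0: "Ys i \<in> L0 M P" if "i \<in> I" for i using Ys(1) that by (auto simp: L_infty_def)
  obtain r where r: "net_liminf I le (\<lambda>i. \<rho> (Xs i)) < ereal r" "ereal r < ereal (\<rho> X)"
    using neg ereal_dense2 by (metis not_le)
  define J where "J = {j\<in>I. \<rho> (Xs j) < r}"
  have cof: "\<exists>j\<in>J. le i j" if "i \<in> I" for i
  proof -
    have "(INF j\<in>{j\<in>I. le i j}. ereal (\<rho> (Xs j))) \<le> net_liminf I le (\<lambda>i. \<rho> (Xs i))"
      unfolding net_liminf_def using that by (rule SUP_upper)
    with r(1) have "(INF j\<in>{j\<in>I. le i j}. ereal (\<rho> (Xs j))) < ereal r" by order
    then show ?thesis by (auto simp: INF_less_iff J_def)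
  qed
  define D where "D = (\<lambda>j. (Xs j, Ys j)) ` J"
  define leD where "leD = (\<lambda>(p::('a \<Rightarrow> real) set \<times> ('a \<Rightarrow> real) set)
    (q::('a \<Rightarrow> real) set \<times> ('a \<Rightarrow> real) set). L_le M P (snd q) (snd p))"
  have D0: "snd p \<in> L0 M P" if "p \<in> D" for p
    using that Y0 by (auto simp: D_def J_def)
  have tr: "le i k" if "i \<in> I" "j \<in> I" "k \<in> I" "le i j" "le j k" for i j k
    using dir that unfolding directed_def by blast
  have "directed D leD"
    unfolding directed_def
  proof (intro conjI ballI impI)
    have "I \<noteq> {}" using dir unfolding directed_def by blast
    then show "D \<noteq> {}" using cof by (auto simp: D_def)
  next
    fix p assume "p \<in> D" then show "leD p p" unfolding leD_def using D0 L_le_refl[OF P] by blast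
  next
    fix p q s assume "p \<in> D" "q \<in> D" "s \<in> D" "leD p q" "leD q s"
    then show "leD p s" unfolding leD_def using D0 L_le_trans[OF P] by blast
  next
    fix p q assume "p \<in> D" "q \<in> D"
    then obtain i j where ij: "i \<in> J" "p = (Xs i, Ys i)" "j \<in> J" "q = (Xs j, Ys j)"
      by (auto simp: D_def)
    then have I: "i \<in> I" "j \<in> I" by (auto simp: J_def)
    then obtain k where k: "k \<in> I" "le i k" "le j k" using dir unfolding directed_def by blast
    obtain l where l: "l \<in> J" "le k l" using cof[OF k(1)] by blast
    then have lI: "l \<in> I" by (auto simp: J_def)
    have "le i l" "le j l" using tr I k l(2) lI by blast+
    then have "leD p (Xs l, Ys l)" "leD q (Xs l, Ys l)"
      unfolding leD_def using ij I lI Ys(2) by auto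
    then show "\<exists>k\<in>D. leD p k \<and> leD q k" using l(1) unfolding D_def by blast
  qed
  moreover have "\<forall>p\<in>D. fst p \<in> L_infty M P" using Xs by (auto simp: D_def J_def)
  moreover have "order_converges M P D leD fst X"
    unfolding order_converges_def
  proof (intro exI[of _ snd] conjI ballI impI)
    fix Z assume Z: "Z \<in> L_infty M P" "\<forall>p\<in>D. L_le M P Z (snd p)"
    have "L_le M P Z (Ys i)" if "i \<in> I" for i
    proof -
      obtain j where j: "j \<in> J" "le i j" using cof[OF \<open>i \<in> I\<close>] by blast
      then have "j \<in> I" by (auto simp: J_def)
      moreover have "L_le M P Z (Ys j)" using Z(2) j(1) by (auto simp: D_def)
      ultimately show ?thesis using Ys(2) j(2) that Y0 L_le_trans[OF P] by blast
    qed
    then show "L_le M P Z (L_zero M P)" using Ys(4) Z(1) by blast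
  qed (use Ys in \<open>auto simp: D_def J_def leD_def\<close>)
  ultimately have "ereal (\<rho> X) \<le> net_liminf D leD (\<lambda>p. \<rho> (fst p))"
    using F2 X unfolding property_F2_def fatou_for_nets_over_def by blast
  also have "\<dots> \<le> ereal r"
    unfolding net_liminf_def
  proof (rule SUP_least)
    fix p assume p: "p \<in> D"
    have "(INF q\<in>{q\<in>D. leD p q}. ereal (\<rho> (fst q))) \<le> ereal (\<rho> (fst p))"
      using p D0 L_le_refl[OF P] by (intro INF_lower) (auto simp: leD_def)
    also have "\<dots> \<le> ereal r" using p by (auto simp: D_def J_def)
    finally show "(INF q\<in>{q\<in>D. leD p q}. ereal (\<rho> (fst q))) \<le> ereal r" .
  qed
  finally show False using r(2) by simp
qed

end

theory Submission
  imports Defs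
begin

text \<open>
  \<^emph>\<open>Part (1).\<close>  The unit ball of \<open>L_infty M P\<close> is weak* compact and bounded order intervals are
  intersections of balls, so upward directed families of events have least upper bounds that are
  weak* limits.  Hence every element of \<open>V\<close> is order continuous, and therefore countably additive and
  supported.  Conversely the expectation under a supported probability measure \<open>Q\<close> satisfies (F2); by
  (F4) it dominates a shifted element of \<open>V\<close>, which by linearity must be \<open>Q\<close>.  So \<open>V = sca_c M P\<close>.

  \<^emph>\<open>Part (2).\<close>  (F3) implies (F2) because supported probability measures are order continuous.  For
  the converse, (F2) and an \<open>L\<^sup>2\<close>-projection argument on the supports show that the norm bounded parts
  of a level set of \<open>\<rho>\<close> are weak* compact.  A Krein--Smulian iteration, whose single steps are
  applications of a minimax theorem, yields an element of \<open>sca_c M P\<close> separating the whole level set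
  from a given point; it is nonnegative since level sets are lower sets.
\<close>

section \<open>Quasi-sure classes of bounded random variables\<close>

text \<open>The obstacle is that no single measure controls the null events, while (F2) concerns
  order limits of nets, which have no pointwise meaning. Two devices help. In part (1) the duality
  speaks of norms only; it still detects the order because the interval [a, a + 1] is exactly the
  closed ball of radius 1/2 around a + 1/2. In part (2) almost sure and quasi sure statements agree
  on the support of a supported probability, and these supports form a directed family. Off the
  support a function is replaced by its lower bound -n, which by monotonicity keeps it in the level
  set. The bound n, indispensable for this and for weak* compactness, lets separation succeed at
  first only on bounded parts of the level set. The separating element could then depend on n
  without control as n grows. This is why it is corrected successively, in steps of geometrically
  decreasing total variation, so that completeness of the supported set functions gives a limit.
  Classes are handled through representatives that are bounded on the whole space.\<close>

definition bounded_rv :: "'a measure \<Rightarrow> ('a \<Rightarrow> real) set" where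
  "bounded_rv M = {f \<in> borel_measurable M. \<exists>c. \<forall>\<omega>\<in>space M. \<bar>f \<omega>\<bar> \<le> c}"

lemma bounded_rvI: "f \<in> borel_measurable M \<Longrightarrow> (\<And>\<omega>. \<omega> \<in> space M \<Longrightarrow> \<bar>f \<omega>\<bar> \<le> c) \<Longrightarrow> f \<in> bounded_rv M"
  by (auto simp: bounded_rv_def)

lemma bounded_rv_measurable: "f \<in> bounded_rv M \<Longrightarrow> f \<in> borel_measurable M"
  by (auto simp: bounded_rv_def)

lemma bounded_rv_bound:
  assumes "f \<in> bounded_rv M" shows "\<exists>c>0. \<forall>\<omega>\<in>space M. \<bar>f \<omega>\<bar> \<le> c"
proof -
  obtain c where "\<forall>\<omega>\<in>space M. \<bar>f \<omega>\<bar> \<le> c" using assms by (auto simp: bounded_rv_def)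
  then have "\<bar>f \<omega>\<bar> \<le> max c 1" if "\<omega> \<in> space M" for \<omega> using that by fastforce
  then show ?thesis by (intro exI[of _ "max c 1"]) auto
qed

lemma bounded_rv_const [simp]: "(\<lambda>_. c) \<in> bounded_rv M"
  by (rule bounded_rvI[where c="\<bar>c\<bar>"]) auto

lemma bounded_rv_indicator [simp]: "A \<in> sets M \<Longrightarrow> indicator A \<in> bounded_rv M"
  by (rule bounded_rvI[where c=1]) (auto simp: indicator_def)

lemma bounded_rv_add:
  assumes "f \<in> bounded_rv M" "g \<in> bounded_rv M" shows "(\<lambda>\<omega>. f \<omega> + g \<omega>) \<in> bounded_rv M"
proof -
  obtain c where c: "\<And>\<omega>. \<omega> \<in> space M \<Longrightarrow> \<bar>f \<omega>\<bar> \<le> c"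
    using bounded_rv_bound[OF assms(1)] by blast
  obtain d where d: "\<And>\<omega>. \<omega> \<in> space M \<Longrightarrow> \<bar>g \<omega>\<bar> \<le> d"
    using bounded_rv_bound[OF assms(2)] by blast
  note [measurable] = assms[THEN bounded_rv_measurable]
  show ?thesis
  proof (rule bounded_rvI)
    show "(\<lambda>\<omega>. f \<omega> + g \<omega>) \<in> borel_measurable M"
      by measurable
    show "\<bar>f \<omega> + g \<omega>\<bar> \<le> c + d" if "\<omega> \<in> space M" for \<omega> using c[OF that] d[OF that] by linarith
  qed
qed

lemma bounded_rv_mult:
  assumes "f \<in> bounded_rv M" "g \<in> bounded_rv M" shows "(\<lambda>\<omega>. f \<omega> * g \<omega>) \<in> bounded_rv M"
proof -
  obtain c where c: "\<And>\<omega>. \<omega> \<in> space M \<Longrightarrow> \<bar>f \<omega>\<bar> \<le> c"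
    using bounded_rv_bound[OF assms(1)] by blast
  obtain d where d: "\<And>\<omega>. \<omega> \<in> space M \<Longrightarrow> \<bar>g \<omega>\<bar> \<le> d"
    using bounded_rv_bound[OF assms(2)] by blast
  note [measurable] = assms[THEN bounded_rv_measurable]
  show ?thesis
  proof (rule bounded_rvI)
    show "(\<lambda>\<omega>. f \<omega> * g \<omega>) \<in> borel_measurable M"
      by measurable
    show "\<bar>f \<omega> * g \<omega>\<bar> \<le> c * d" if "\<omega> \<in> space M" for \<omega>
      unfolding abs_mult using c[OF that] d[OF that] by (intro mult_mono) auto
  qed
qed

lemma bounded_rv_cmult: "f \<in> bounded_rv M \<Longrightarrow> (\<lambda>\<omega>. a * f \<omega>) \<in> bounded_rv M"
  by (rule bounded_rv_mult) auto

lemma bounded_rv_diff: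
  assumes "f \<in> bounded_rv M" "g \<in> bounded_rv M" shows "(\<lambda>\<omega>. f \<omega> - g \<omega>) \<in> bounded_rv M"
  using bounded_rv_add[OF assms(1) bounded_rv_cmult[OF assms(2), of "-1"]] by simp

lemma bounded_rv_abs:
  assumes "f \<in> bounded_rv M" shows "(\<lambda>\<omega>. \<bar>f \<omega>\<bar>) \<in> bounded_rv M"
  using assms unfolding bounded_rv_def by auto

locale qs_space =
  fixes M :: "'a measure" and P :: "'a measure set"
  assumes P_prob: "P \<subseteq> prob_measures M" and P_nonempty: "P \<noteq> {}"
begin

abbreviation QS :: "('a \<Rightarrow> bool) \<Rightarrow> bool" where "QS \<equiv> quasi_surely M P"
abbreviation cls :: "('a \<Rightarrow> real) \<Rightarrow> ('a \<Rightarrow> real) set" where "cls \<equiv> qs_class M P"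
abbreviation Linf :: "('a \<Rightarrow> real) set set" where "Linf \<equiv> L_infty M P"
abbreviation Lnorm :: "('a \<Rightarrow> real) set \<Rightarrow> real" where "Lnorm \<equiv> L_infty_norm M P"

section \<open>Null events and the calculus of quasi-sure statements\<close>

definition null :: "'a set \<Rightarrow> bool" where
  "null N \<longleftrightarrow> N \<in> sets M \<and> capacity P N = 0"

lemma prior: "Q \<in> P \<Longrightarrow> prob_space Q \<and> sets Q = sets M"
  using P_prob by (auto simp: prob_measures_def)

text \<open>The capacity is a supremum of numbers in [0, 1], so it vanishes exactly when every prior
  does. Countable unions of null events are then treated prior by prior.\<close>

lemma null_iff: "null N \<longleftrightarrow> N \<in> sets M \<and> (\<forall>Q\<in>P. measure Q N = 0)"
proof -
  have bdd: "bdd_above ((\<lambda>Q. measure Q N) ` P)"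
    using P_prob by (intro bdd_aboveI[where M=1]) (auto simp: prob_measures_def prob_space.prob_le_1)
  have "(\<forall>Q\<in>P. measure Q N = 0)" if "capacity P N = 0"
  proof
    fix Q assume "Q \<in> P"
    then have "measure Q N \<le> capacity P N"
      unfolding capacity_def using bdd by (rule cSUP_upper)
    then show "measure Q N = 0" using that by (simp add: measure_le_0_iff)
  qed
  moreover have "capacity P N = 0" if "\<forall>Q\<in>P. measure Q N = 0"
    unfolding capacity_def using P_nonempty that by simp
  ultimately show ?thesis by (auto simp: null_def)
qed

lemma null_sets: "null N \<Longrightarrow> N \<in> sets M" by (simp add: null_def)

lemma null_empty [simp]: "null {}" by (simp add: null_iff)

lemma null_subset:
  assumes "null N" "A \<subseteq> N" "A \<in> sets M" shows "null A"
  unfolding null_iff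
proof (intro conjI ballI)
  fix Q assume Q: "Q \<in> P"
  then interpret prob_space Q using prior by blast
  have "sets Q = sets M" using Q prior by blast
  then have "measure Q A \<le> measure Q N" using assms by (intro finite_measure_mono) (auto simp: null_def)
  then show "measure Q A = 0" using assms(1) Q by (simp add: null_iff measure_le_0_iff)
qed fact

lemma null_UN:
  assumes "\<And>n::nat. null (N n)" shows "null (\<Union>n. N n)"
  unfolding null_iff
proof (intro conjI ballI)
  show "(\<Union>n. N n) \<in> sets M" using assms by (auto simp: null_def)
  fix Q assume Q: "Q \<in> P"
  then interpret prob_space Q using prior by blast
  have s: "sets Q = sets M" using Q prior by blast
  have "(\<Union>n. N n) \<in> null_sets Q"
  proof (rule null_sets_UN)
    fix i show "N i \<in> null_sets Q" using assms[of i] Q s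
      by (auto simp: null_iff null_sets_def emeasure_eq_measure)
  qed
  then show "measure Q (\<Union>n. N n) = 0" by (simp add: measure_def null_setsD1)
qed

lemma null_Un: "null A \<Longrightarrow> null B \<Longrightarrow> null (A \<union> B)"
  using capacity_Un_null[OF P_nonempty P_prob] by (auto simp: null_def)

lemma not_null_space: "\<not> null (space M)"
proof
  assume n: "null (space M)"
  obtain Q where Q: "Q \<in> P" using P_nonempty by blast
  then interpret prob_space Q using prior by blast
  have "space Q = space M" using Q prior sets_eq_imp_space_eq by blast
  then have "measure Q (space M) = 1" using prob_space by simp
  then show False using n Q by (auto simp: null_iff)
qed

lemma QS_iff: "QS \<phi> \<longleftrightarrow> (\<exists>N. null N \<and> (\<forall>\<omega>\<in>space M - N. \<phi> \<omega>))"
  by (auto simp: quasi_surely_def null_def)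

lemma QS_I: "null N \<Longrightarrow> (\<And>\<omega>. \<omega> \<in> space M \<Longrightarrow> \<omega> \<notin> N \<Longrightarrow> \<phi> \<omega>) \<Longrightarrow> QS \<phi>"
  unfolding QS_iff by blast

lemma QS_E:
  assumes "QS \<phi>" obtains N where "null N" "\<And>\<omega>. \<omega> \<in> space M \<Longrightarrow> \<omega> \<notin> N \<Longrightarrow> \<phi> \<omega>"
  using assms unfolding QS_iff by blast

lemma QS_always: "(\<And>\<omega>. \<omega> \<in> space M \<Longrightarrow> \<phi> \<omega>) \<Longrightarrow> QS \<phi>"
  by (rule QS_I[of "{}"]) auto

lemma QS_null: "QS \<phi> \<Longrightarrow> {\<omega>\<in>space M. \<not> \<phi> \<omega>} \<in> sets M \<Longrightarrow> null {\<omega>\<in>space M. \<not> \<phi> \<omega>}"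
  by (erule QS_E, erule null_subset) auto

lemma QS_mp: "QS \<phi> \<Longrightarrow> (\<And>\<omega>. \<omega> \<in> space M \<Longrightarrow> \<phi> \<omega> \<Longrightarrow> \<psi> \<omega>) \<Longrightarrow> QS \<psi>"
  unfolding QS_iff by blast

lemma QS_mp2: "QS \<phi> \<Longrightarrow> QS \<theta> \<Longrightarrow> (\<And>\<omega>. \<omega> \<in> space M \<Longrightarrow> \<phi> \<omega> \<Longrightarrow> \<theta> \<omega> \<Longrightarrow> \<psi> \<omega>) \<Longrightarrow> QS \<psi>"
  unfolding QS_iff using null_Un by (metis DiffE DiffI Un_iff)

lemma QS_all:
  assumes "\<And>n::nat. QS (\<phi> n)" shows "QS (\<lambda>\<omega>. \<forall>n. \<phi> n \<omega>)"
proof -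
  have "\<forall>n. \<exists>N. null N \<and> (\<forall>\<omega>\<in>space M - N. \<phi> n \<omega>)" using assms QS_iff by blast
  then obtain N where "\<And>n. null (N n)" "\<And>n \<omega>. \<omega> \<in> space M - N n \<Longrightarrow> \<phi> n \<omega>" by metis
  then show ?thesis by (intro QS_I[of "\<Union>n. N n"] null_UN) auto
qed

section \<open>Classes of random variables, their operations and their norm\<close>

lemma mem_cls: "f \<in> borel_measurable M \<Longrightarrow> g \<in> cls f \<longleftrightarrow> g \<in> borel_measurable M \<and> QS (\<lambda>\<omega>. f \<omega> = g \<omega>)"
  by (auto simp: qs_class_def qs_rel_def)

lemma cls_self: "f \<in> borel_measurable M \<Longrightarrow> f \<in> cls f"
  by (simp add: mem_cls QS_always)

lemma cls_eqI:
  assumes "f \<in> borel_measurable M" "g \<in> borel_measurable M" "QS (\<lambda>\<omega>. f \<omega> = g \<omega>)"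
  shows "cls f = cls g"
proof -
  have "h \<in> cls f \<longleftrightarrow> h \<in> cls g" for h
    unfolding mem_cls[OF assms(1)] mem_cls[OF assms(2)]
    using QS_mp2[OF assms(3), of "\<lambda>\<omega>. f \<omega> = h \<omega>" "\<lambda>\<omega>. g \<omega> = h \<omega>"]
      QS_mp2[OF assms(3), of "\<lambda>\<omega>. g \<omega> = h \<omega>" "\<lambda>\<omega>. f \<omega> = h \<omega>"] by auto
  then show ?thesis by blast
qed

lemma rep_cls:
  assumes "f \<in> borel_measurable M"
  shows "rep (cls f) \<in> borel_measurable M" "QS (\<lambda>\<omega>. rep (cls f) \<omega> = f \<omega>)"
proof -
  have "rep (cls f) \<in> cls f" unfolding rep_def by (rule someI[where P="\<lambda>g. g \<in> cls f", OF cls_self[OF assms]])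
  then show "rep (cls f) \<in> borel_measurable M" "QS (\<lambda>\<omega>. rep (cls f) \<omega> = f \<omega>)"
    using assms QS_mp[of "\<lambda>\<omega>. f \<omega> = rep (cls f) \<omega>"] by (auto simp: mem_cls)
qed

lemma cls_rep:
  assumes "X \<in> L0 M P"
  shows "rep X \<in> borel_measurable M" "cls (rep X) = X"
proof -
  obtain f where f: "f \<in> borel_measurable M" "X = cls f"
    using assms unfolding L0_def by (metis quotientE qs_class_def)
  then show "rep X \<in> borel_measurable M" using rep_cls by blast
  have "cls (rep (cls f)) = cls f" by (rule cls_eqI[OF rep_cls(1)[OF f(1)] f(1) rep_cls(2)[OF f(1)]])
  then show "cls (rep X) = X" by (simp only: f(2))
qed

lemma L_add_cls:
  assumes "f \<in> borel_measurable M" "g \<in> borel_measurable M"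
  shows "L_add M P (cls f) (cls g) = cls (\<lambda>\<omega>. f \<omega> + g \<omega>)"
  unfolding L_add_def using assms rep_cls[OF assms(1)] rep_cls[OF assms(2)]
  by (intro cls_eqI borel_measurable_add QS_mp2[OF rep_cls(2)[OF assms(1)] rep_cls(2)[OF assms(2)]]) auto

lemma L_diff_cls:
  assumes "f \<in> borel_measurable M" "g \<in> borel_measurable M"
  shows "L_diff M P (cls f) (cls g) = cls (\<lambda>\<omega>. f \<omega> - g \<omega>)"
  unfolding L_diff_def using assms rep_cls[OF assms(1)] rep_cls[OF assms(2)]
  by (intro cls_eqI borel_measurable_diff QS_mp2[OF rep_cls(2)[OF assms(1)] rep_cls(2)[OF assms(2)]]) auto

lemma L_scale_cls:
  assumes "f \<in> borel_measurable M"
  shows "L_scale M P a (cls f) = cls (\<lambda>\<omega>. a * f \<omega>)"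
  unfolding L_scale_def using assms rep_cls[OF assms(1)]
  by (intro cls_eqI borel_measurable_times borel_measurable_const QS_mp[OF rep_cls(2)[OF assms]]) auto

lemma L_abs_cls:
  assumes "f \<in> borel_measurable M"
  shows "L_abs M P (cls f) = cls (\<lambda>\<omega>. \<bar>f \<omega>\<bar>)"
  unfolding L_abs_def using assms rep_cls[OF assms(1)]
  by (intro cls_eqI borel_measurable_abs QS_mp[OF rep_cls(2)[OF assms]]) auto

lemma L_le_cls:
  assumes "f \<in> borel_measurable M" "g \<in> borel_measurable M"
  shows "L_le M P (cls f) (cls g) \<longleftrightarrow> QS (\<lambda>\<omega>. f \<omega> \<le> g \<omega>)"
proof
  assume "L_le M P (cls f) (cls g)"
  then obtain f' g' where "QS (\<lambda>\<omega>. f \<omega> = f' \<omega>)" "QS (\<lambda>\<omega>. g \<omega> = g' \<omega>)" "QS (\<lambda>\<omega>. f' \<omega> \<le> g' \<omega>)"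
    unfolding L_le_def using assms by (auto simp: mem_cls)
  then have "QS (\<lambda>\<omega>. g \<omega> = g' \<omega>)" "QS (\<lambda>\<omega>. f \<omega> \<le> g' \<omega>)"
    by (auto intro: QS_mp2[of "\<lambda>\<omega>. f \<omega> = f' \<omega>" "\<lambda>\<omega>. f' \<omega> \<le> g' \<omega>"])
  then show "QS (\<lambda>\<omega>. f \<omega> \<le> g \<omega>)" by (rule QS_mp2) simp
qed (use cls_self assms in \<open>auto simp: L_le_def\<close>)

lemma scale_one_cls: "L_scale M P m (L_ind M P (space M)) = cls (\<lambda>_. m)"
proof -
  have "cls (\<lambda>\<omega>. m * indicator (space M) \<omega>) = cls (\<lambda>_. m)"
    by (rule cls_eqI) (auto intro: QS_always)
  then show ?thesis unfolding L_ind_def by (simp add: L_scale_cls)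
qed

lemma cls_L0: "f \<in> borel_measurable M \<Longrightarrow> cls f \<in> L0 M P"
  unfolding L0_def qs_class_def by (rule quotientI)

lemma L_abs_le_iff:
  assumes "f \<in> borel_measurable M"
  shows "L_le M P (L_abs M P (cls f)) (L_scale M P m (L_ind M P (space M))) \<longleftrightarrow> QS (\<lambda>\<omega>. \<bar>f \<omega>\<bar> \<le> m)"
  unfolding L_abs_cls[OF assms] scale_one_cls using assms by (subst L_le_cls) auto

lemma cls_Linf:
  assumes "f \<in> bounded_rv M" shows "cls f \<in> Linf"
proof -
  obtain c where "c > 0" "\<And>\<omega>. \<omega> \<in> space M \<Longrightarrow> \<bar>f \<omega>\<bar> \<le> c" using bounded_rv_bound[OF assms] by blast
  then have "L_le M P (L_abs M P (cls f)) (L_scale M P c (L_ind M P (space M)))"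
    using L_abs_le_iff[OF bounded_rv_measurable[OF assms], of c] QS_always by simp
  then show ?thesis
    unfolding L_infty_def using cls_L0[OF bounded_rv_measurable[OF assms]] \<open>c > 0\<close> by blast
qed

lemma Linf_L0: "X \<in> Linf \<Longrightarrow> X \<in> L0 M P" by (simp add: L_infty_def)

lemma Lnorm_set_cls:
  assumes "f \<in> bounded_rv M"
  shows "Lnorm (cls f) = Inf {m. m > 0 \<and> QS (\<lambda>\<omega>. \<bar>f \<omega>\<bar> \<le> m)}"
  unfolding L_infty_norm_def using assms by (simp add: L_abs_le_iff bounded_rv_measurable)

lemma Lnorm_set_nonempty:
  assumes "f \<in> bounded_rv M" shows "{m. m > 0 \<and> QS (\<lambda>\<omega>. \<bar>f \<omega>\<bar> \<le> m)} \<noteq> {}"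
proof -
  obtain c where "c > 0" "\<And>\<omega>. \<omega> \<in> space M \<Longrightarrow> \<bar>f \<omega>\<bar> \<le> c" using bounded_rv_bound[OF assms] by blast
  then have "c \<in> {m. m > 0 \<and> QS (\<lambda>\<omega>. \<bar>f \<omega>\<bar> \<le> m)}" using QS_always by simp
  then show ?thesis by blast
qed

lemma Lnorm_nonneg:
  assumes "f \<in> bounded_rv M" shows "0 \<le> Lnorm (cls f)"
  unfolding Lnorm_set_cls[OF assms] by (rule cInf_greatest[OF Lnorm_set_nonempty[OF assms]]) simp

text \<open>The infimum behaves as if attained, even at 0, which the defining set omits: the
  countably many bounds c + 1/(n+1) hold simultaneously off one null event.\<close>

lemma Lnorm_le_iff:
  assumes f: "f \<in> bounded_rv M" and c: "0 \<le> c"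
  shows "Lnorm (cls f) \<le> c \<longleftrightarrow> QS (\<lambda>\<omega>. \<bar>f \<omega>\<bar> \<le> c)"
proof
  define S where "S = {m. m > 0 \<and> QS (\<lambda>\<omega>. \<bar>f \<omega>\<bar> \<le> m)}"
  have ne: "S \<noteq> {}" unfolding S_def using f by (rule Lnorm_set_nonempty)
  have bd: "bdd_below S" by (rule bdd_belowI[of _ 0]) (auto simp: S_def)
  show "Lnorm (cls f) \<le> c" if q: "QS (\<lambda>\<omega>. \<bar>f \<omega>\<bar> \<le> c)"
  proof (rule field_le_epsilon)
    fix e :: real assume "e > 0"
    then have "c + e \<in> S" using q c by (auto simp: S_def intro: QS_mp[OF q])
    then show "Lnorm (cls f) \<le> c + e"
      unfolding Lnorm_set_cls[OF f] S_def[symmetric] using bd by (rule cInf_lower)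
  qed
  assume le: "Lnorm (cls f) \<le> c"
  have "QS (\<lambda>\<omega>. \<bar>f \<omega>\<bar> \<le> c + 1 / Suc n)" for n
  proof -
    have "Inf S < c + 1 / Suc n" using le unfolding Lnorm_set_cls[OF f] S_def by (smt (verit) of_nat_0_less_iff zero_less_Suc zero_less_divide_1_iff)
    then obtain m where "m \<in> S" "m < c + 1 / Suc n" using cInf_lessD[OF ne] by blast
    then show ?thesis unfolding S_def by (auto intro: QS_mp[of "\<lambda>\<omega>. \<bar>f \<omega>\<bar> \<le> m"])
  qed
  then have "QS (\<lambda>\<omega>. \<forall>n. \<bar>f \<omega>\<bar> \<le> c + 1 / Suc n)" by (rule QS_all)
  then show "QS (\<lambda>\<omega>. \<bar>f \<omega>\<bar> \<le> c)"
  proof (rule QS_mp)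
    fix \<omega> assume *: "\<forall>n. \<bar>f \<omega>\<bar> \<le> c + 1 / Suc n"
    show "\<bar>f \<omega>\<bar> \<le> c"
    proof (rule field_le_epsilon)
      fix e :: real assume "e > 0"
      then obtain n where "1 / Suc n < e" using nat_approx_posE by blast
      then show "\<bar>f \<omega>\<bar> \<le> c + e" using *[rule_format, of n] by linarith
    qed
  qed
qed

lemma bounded_rv_truncate:
  assumes "f \<in> borel_measurable M" "0 \<le> c" shows "(\<lambda>\<omega>. max (- c) (min c (f \<omega>))) \<in> bounded_rv M"
  by (rule bounded_rvI[where c=c]) (use assms in auto)

lemma cls_truncate:
  assumes "f \<in> borel_measurable M" "0 \<le> c" "QS (\<lambda>\<omega>. \<bar>f \<omega>\<bar> \<le> c)"
  shows "cls (\<lambda>\<omega>. max (- c) (min c (f \<omega>))) = cls f"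
proof (rule cls_eqI)
  show "QS (\<lambda>\<omega>. max (- c) (min c (f \<omega>)) = f \<omega>)"
    by (rule QS_mp[OF assms(3)]) linarith
qed (use assms in auto)

text \<open>Truncation at c changes a representative on a null event only, so a quasi-sure bound
  becomes one that holds at every point. Level sets can then be described without exceptional
  events.\<close>

lemma Linf_boundedE:
  assumes "X \<in> Linf" "Lnorm X \<le> c"
  obtains f where "f \<in> bounded_rv M" "X = cls f" "\<And>\<omega>. \<bar>f \<omega>\<bar> \<le> c" "0 \<le> c"
proof -
  have r: "rep X \<in> borel_measurable M" and rX: "cls (rep X) = X" using cls_rep[OF Linf_L0[OF assms(1)]] by simp_all
  obtain m where m: "m > 0" "QS (\<lambda>\<omega>. \<bar>rep X \<omega>\<bar> \<le> m)"
  proof -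
    have "\<exists>m>0. L_le M P (L_abs M P X) (L_scale M P m (L_ind M P (space M)))"
      using assms(1) by (simp add: L_infty_def)
    then obtain m where "m > 0" "L_le M P (L_abs M P X) (L_scale M P m (L_ind M P (space M)))"
      by (elim exE conjE)
    then show ?thesis using that[of m] L_abs_le_iff[OF r, of m] by (simp only: rX)
  qed
  \<comment> \<open>The first truncation, at the m supplied by membership in \<open>L_infty\<close>,
    makes \<open>Lnorm_le_iff\<close> applicable; the second one, at c, then gives the sharp
    bound.\<close>
  define g where "g = (\<lambda>\<omega>. max (- m) (min m (rep X \<omega>)))"
  have g: "g \<in> bounded_rv M" unfolding g_def by (rule bounded_rv_truncate[OF r]) (use m(1) in simp)
  have X: "cls g = X" unfolding g_def using cls_truncate[OF r _ m(2)] m(1) rX by simp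
  have c: "0 \<le> c" using Lnorm_nonneg[OF g] assms(2) unfolding X by linarith
  have q: "QS (\<lambda>\<omega>. \<bar>g \<omega>\<bar> \<le> c)" using assms(2) unfolding X[symmetric] Lnorm_le_iff[OF g c] .
  show ?thesis
  proof (rule that)
    show "(\<lambda>\<omega>. max (- c) (min c (g \<omega>))) \<in> bounded_rv M"
      by (rule bounded_rv_truncate[OF bounded_rv_measurable[OF g] c])
    show "X = cls (\<lambda>\<omega>. max (- c) (min c (g \<omega>)))"
      using cls_truncate[OF bounded_rv_measurable[OF g] c q] X by simp
    show "\<bar>max (- c) (min c (g \<omega>))\<bar> \<le> c" for \<omega> using c by linarith
  qed (rule c)
qed

lemma LinfE:
  assumes "X \<in> Linf" obtains f where "f \<in> bounded_rv M" "X = cls f"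
proof -
  have "Lnorm X \<le> Lnorm X" by simp
  from Linf_boundedE[OF assms this] show ?thesis using that by metis
qed

end

section \<open>Finitely additive set functions and their variation\<close>

lemma ba_zero: "\<mu> \<in> ba M \<Longrightarrow> A \<notin> sets M \<Longrightarrow> \<mu> A = 0"
  by (simp add: ba_def)

lemma ba_additive:
  assumes "\<mu> \<in> ba M" "A \<in> sets M" "B \<in> sets M" "A \<inter> B = {}"
  shows "\<mu> (A \<union> B) = \<mu> A + \<mu> B"
  using assms by (auto simp: ba_def additive_def)

lemma ba_empty: "\<mu> \<in> ba M \<Longrightarrow> \<mu> {} = 0"
  using ba_additive[of \<mu> M "{}" "{}"] by simp

lemma ba_finite_union:
  assumes mu: "\<mu> \<in> ba M" and "finite I" "\<And>i. i \<in> I \<Longrightarrow> F i \<in> sets M" "disjoint_family_on F I"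
  shows "\<mu> (\<Union>i\<in>I. F i) = (\<Sum>i\<in>I. \<mu> (F i))"
  using assms(2-)
proof (induction I)
  case empty then show ?case using ba_empty[OF mu] by simp
next
  case (insert i I)
  have "F i \<inter> (\<Union>j\<in>I. F j) = {}" using insert by (auto simp: disjoint_family_on_def)
  moreover have "disjoint_family_on F I" using insert by (auto simp: disjoint_family_on_def)
  moreover have "(\<Union>j\<in>I. F j) \<in> sets M" using insert by auto
  ultimately show ?case using insert ba_additive[OF mu, of "F i" "\<Union>j\<in>I. F j"] by simp
qed

text \<open>\<open>partition_on\<close> forbids empty blocks, and a set of blocks forgets
  repetitions. After the empty members are removed, disjointness makes the family injective, and the
  removed terms are 0.\<close>

lemma variation_sumsI:
  assumes mu: "\<mu> \<in> ba M" and A: "A \<in> sets M" and I: "finite I" "\<And>i. i \<in> I \<Longrightarrow> F i \<in> sets M"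
    "disjoint_family_on F I" "(\<Union>i\<in>I. F i) = A"
  shows "(\<Sum>i\<in>I. \<bar>\<mu> (F i)\<bar>) \<in> variation_sums M \<mu> A"
proof -
  define J where "J = {i\<in>I. F i \<noteq> {}}"
  have J: "finite J" "J \<subseteq> I" using I by (auto simp: J_def)
  have inj: "inj_on F J"
    using I(3) by (auto simp: inj_on_def J_def disjoint_family_on_def)
  have "(\<Sum>i\<in>I. \<bar>\<mu> (F i)\<bar>) = (\<Sum>i\<in>J. \<bar>\<mu> (F i)\<bar>)"
    using I ba_empty[OF mu] by (intro sum.mono_neutral_right) (auto simp: J_def)
  also have "\<dots> = (\<Sum>B\<in>F ` J. \<bar>\<mu> B\<bar>)" using inj by (simp add: sum.reindex)
  finally have eq: "(\<Sum>i\<in>I. \<bar>\<mu> (F i)\<bar>) = (\<Sum>B\<in>F ` J. \<bar>\<mu> B\<bar>)" .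
  have "partition_on A (F ` J)"
    unfolding partition_on_def
  proof (intro conjI)
    show "\<Union> (F ` J) = A" using I(4) by (auto simp: J_def)
    show "{} \<notin> F ` J" by (auto simp: J_def)
    show "disjoint (F ` J)" unfolding disjoint_def
    proof (intro ballI impI)
      fix p q assume "p \<in> F ` J" "q \<in> F ` J" "p \<noteq> q"
      then obtain i j where "i \<in> I" "j \<in> I" "i \<noteq> j" "p = F i" "q = F j" using J(2) by blast
      then show "p \<inter> q = {}" using I(3) by (simp add: disjoint_family_on_def)
    qed
  qed
  then show ?thesis unfolding eq variation_sums_def using J I(2) by auto
qed

lemma variation_sumsE:
  assumes "x \<in> variation_sums M \<mu> A"
  shows "\<exists>\<A>. finite \<A> \<and> \<A> \<subseteq> sets M \<and> disjoint_family_on id \<A> \<and> \<Union>\<A> = A \<and> x = (\<Sum>B\<in>\<A>. \<bar>\<mu> B\<bar>)"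
proof -
  obtain \<A> where "finite \<A>" "\<A> \<subseteq> sets M" "partition_on A \<A>" "x = (\<Sum>B\<in>\<A>. \<bar>\<mu> B\<bar>)"
    using assms by (auto simp: variation_sums_def)
  moreover from \<open>partition_on A \<A>\<close> have "disjoint_family_on id \<A>" "\<Union>\<A> = A"
    by (auto simp: partition_on_def disjoint_def disjoint_family_on_def)
  ultimately show ?thesis by blast
qed

text \<open>A partition of A extends to one of the whole space by the block
  \<open>space M - A\<close>. The index \<open>None\<close> keeps this block separate even if it
  equals a block of the partition.\<close>

lemma variation_sums_bdd:
  assumes mu: "\<mu> \<in> ba M" and A: "A \<in> sets M" shows "bdd_above (variation_sums M \<mu> A)"
proof -
  have "bdd_above (variation_sums M \<mu> (space M))" using mu by (simp add: ba_def)
  then obtain K where K: "\<forall>x \<in> variation_sums M \<mu> (space M). x \<le> K"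
    unfolding bdd_above_def by blast
  show ?thesis
  proof (rule bdd_aboveI)
    fix x assume "x \<in> variation_sums M \<mu> A"
    from variation_sumsE[OF this] obtain \<A> where \<A>: "finite \<A>" "\<A> \<subseteq> sets M" "disjoint_family_on id \<A>" "\<Union>\<A> = A"
      and x: "x = (\<Sum>B\<in>\<A>. \<bar>\<mu> B\<bar>)"
      by (elim exE conjE)
    define F where "F i = (case i of None \<Rightarrow> space M - A | Some B \<Rightarrow> B)" for i
    have "(\<Sum>i\<in>insert None (Some ` \<A>). \<bar>\<mu> (F i)\<bar>) \<in> variation_sums M \<mu> (space M)"
    proof (rule variation_sumsI[OF mu])
      show "disjoint_family_on F (insert None (Some ` \<A>))"
        using \<A> by (auto simp: disjoint_family_on_def F_def)
      show "(\<Union>i\<in>insert None (Some ` \<A>). F i) = space M"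
        using \<A> A sets.sets_into_space by (force simp: F_def)
      show "F i \<in> sets M" if "i \<in> insert None (Some ` \<A>)" for i
        using that A \<A> by (auto simp: F_def)
    qed (use \<A> in auto)
    then have "(\<Sum>i\<in>insert None (Some ` \<A>). \<bar>\<mu> (F i)\<bar>) \<le> K" using K by blast
    moreover have "(\<Sum>i\<in>insert None (Some ` \<A>). \<bar>\<mu> (F i)\<bar>) = \<bar>\<mu> (space M - A)\<bar> + x"
      using \<A>(1) by (simp add: F_def x sum.reindex)
    ultimately show "x \<le> K" by linarith
  qed
qed

lemma variation_sums_nonempty:
  assumes "\<mu> \<in> ba M" "A \<in> sets M" shows "\<bar>\<mu> A\<bar> \<in> variation_sums M \<mu> A"
  using variation_sumsI[OF assms, of "{()}" "\<lambda>_. A"] assms by (simp add: disjoint_family_on_def)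

lemma sum_le_modulus:
  assumes mu: "\<mu> \<in> ba M" and A: "A \<in> sets M" and I: "finite I" "\<And>i. i \<in> I \<Longrightarrow> F i \<in> sets M"
    "disjoint_family_on F I" "(\<Union>i\<in>I. F i) = A"
  shows "(\<Sum>i\<in>I. \<bar>\<mu> (F i)\<bar>) \<le> modulus M \<mu> A"
  using cSup_upper[OF variation_sumsI[OF assms] variation_sums_bdd[OF mu A]] A
  by (simp add: modulus_def)

lemma modulus_least:
  assumes mu: "\<mu> \<in> ba M" and A: "A \<in> sets M"
    and le: "\<And>\<A>. finite \<A> \<Longrightarrow> \<A> \<subseteq> sets M \<Longrightarrow> disjoint_family_on id \<A> \<Longrightarrow> \<Union>\<A> = A \<Longrightarrow> (\<Sum>B\<in>\<A>. \<bar>\<mu> B\<bar>) \<le> c"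
  shows "modulus M \<mu> A \<le> c"
proof -
  have "Sup (variation_sums M \<mu> A) \<le> c"
  proof (rule cSup_least)
    show "variation_sums M \<mu> A \<noteq> {}" using variation_sums_nonempty[OF mu A] by blast
    fix x assume "x \<in> variation_sums M \<mu> A"
    from variation_sumsE[OF this] show "x \<le> c" by (elim exE conjE) (simp only: le)
  qed
  then show ?thesis using A by (simp add: modulus_def)
qed

lemma abs_le_modulus: "\<mu> \<in> ba M \<Longrightarrow> A \<in> sets M \<Longrightarrow> \<bar>\<mu> A\<bar> \<le> modulus M \<mu> A"
  using sum_le_modulus[of \<mu> M A "{()}" "\<lambda>_. A"] by (simp add: disjoint_family_on_def)

lemma modulus_nonneg:
  assumes "\<mu> \<in> ba M" shows "0 \<le> modulus M \<mu> A"
proof (cases "A \<in> sets M")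
  case True then show ?thesis using abs_le_modulus[OF assms True] by linarith
qed (simp add: modulus_def)

lemma modulus_notin: "A \<notin> sets M \<Longrightarrow> modulus M \<mu> A = 0"
  by (simp add: modulus_def)

text \<open>For \<le>, the blocks of a partition of A \<union> B are cut by A and by B. For \<ge>, a
  partition of A and one of B together partition the union, and the two suprema are taken one after
  the other.\<close>

lemma modulus_Un:
  assumes mu: "\<mu> \<in> ba M" and AB: "A \<in> sets M" "B \<in> sets M" "A \<inter> B = {}"
  shows "modulus M \<mu> (A \<union> B) = modulus M \<mu> A + modulus M \<mu> B"
proof (rule antisym)
  show "modulus M \<mu> (A \<union> B) \<le> modulus M \<mu> A + modulus M \<mu> B"
  proof (rule modulus_least[OF mu])
    fix \<A> assume \<A>: "finite \<A>" "\<A> \<subseteq> sets M" "disjoint_family_on id \<A>" "\<Union>\<A> = A \<union> B"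
    have "(\<Sum>C\<in>\<A>. \<bar>\<mu> C\<bar>) \<le> (\<Sum>C\<in>\<A>. \<bar>\<mu> (C \<inter> A)\<bar> + \<bar>\<mu> (C \<inter> B)\<bar>)"
    proof (rule sum_mono)
      fix C assume C: "C \<in> \<A>"
      then have eq: "C = (C \<inter> A) \<union> (C \<inter> B)" using \<A>(4) by blast
      have "\<mu> ((C \<inter> A) \<union> (C \<inter> B)) = \<mu> (C \<inter> A) + \<mu> (C \<inter> B)"
        using C \<A>(2) AB by (intro ba_additive[OF mu]) auto
      then show "\<bar>\<mu> C\<bar> \<le> \<bar>\<mu> (C \<inter> A)\<bar> + \<bar>\<mu> (C \<inter> B)\<bar>" using eq by simp
    qed
    also have "\<dots> = (\<Sum>C\<in>\<A>. \<bar>\<mu> (C \<inter> A)\<bar>) + (\<Sum>C\<in>\<A>. \<bar>\<mu> (C \<inter> B)\<bar>)" by (rule sum.distrib)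
    also have "\<dots> \<le> modulus M \<mu> A + modulus M \<mu> B"
      using \<A> AB by (intro add_mono sum_le_modulus[OF mu]) (auto simp: disjoint_family_on_def)
    finally show "(\<Sum>C\<in>\<A>. \<bar>\<mu> C\<bar>) \<le> modulus M \<mu> A + modulus M \<mu> B" .
  qed (use AB in auto)
  have "modulus M \<mu> A \<le> modulus M \<mu> (A \<union> B) - modulus M \<mu> B"
  proof (rule modulus_least[OF mu AB(1)])
    fix \<A> assume \<A>: "finite \<A>" "\<A> \<subseteq> sets M" "disjoint_family_on id \<A>" "\<Union>\<A> = A"
    have "modulus M \<mu> B \<le> modulus M \<mu> (A \<union> B) - (\<Sum>C\<in>\<A>. \<bar>\<mu> C\<bar>)"
    proof (rule modulus_least[OF mu AB(2)])
      fix \<B> assume \<B>: "finite \<B>" "\<B> \<subseteq> sets M" "disjoint_family_on id \<B>" "\<Union>\<B> = B"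
      \<comment> \<open>The disjoint sum of the index sets keeps the two partitions apart even if
        both contain the empty set.\<close>
      define F where "F = case_sum (\<lambda>x::'a set. x) (\<lambda>x::'a set. x)"
      have "(\<Sum>i\<in>\<A> <+> \<B>. \<bar>\<mu> (F i)\<bar>) \<le> modulus M \<mu> (A \<union> B)"
      proof (rule sum_le_modulus[OF mu])
        show "(\<Union>i\<in>\<A> <+> \<B>. F i) = A \<union> B" using \<A>(4) \<B>(4) by (force simp: F_def)
        have AB_disj: "C \<inter> D = {}" "D \<inter> C = {}" if "C \<in> \<A>" "D \<in> \<B>" for C D
          using that \<A>(4) \<B>(4) AB(3) by blast+
        have disj: "C \<inter> D = {}" if "C \<in> \<A> \<and> D \<in> \<A> \<or> C \<in> \<B> \<and> D \<in> \<B>" "C \<noteq> D" for C D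
          using that \<A>(3) \<B>(3) unfolding disjoint_family_on_def id_apply by metis
        show "disjoint_family_on F (\<A> <+> \<B>)"
          unfolding disjoint_family_on_def
        proof (intro ballI impI)
          fix i j assume "i \<in> \<A> <+> \<B>" "j \<in> \<A> <+> \<B>" "i \<noteq> j"
          then show "F i \<inter> F j = {}" by (cases i; cases j) (simp_all add: F_def AB_disj disj Plus_def image_iff)
        qed
        show "finite (\<A> <+> \<B>)" using \<A>(1) \<B>(1) by simp
        show "F i \<in> sets M" if "i \<in> \<A> <+> \<B>" for i using that \<A>(2) \<B>(2) by (auto simp: F_def)
        show "A \<union> B \<in> sets M" using AB by simp
      qed
      then show "(\<Sum>C\<in>\<B>. \<bar>\<mu> C\<bar>) \<le> modulus M \<mu> (A \<union> B) - (\<Sum>C\<in>\<A>. \<bar>\<mu> C\<bar>)"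
        using \<A>(1) \<B>(1) by (simp add: sum.Plus F_def)
    qed
    then show "(\<Sum>C\<in>\<A>. \<bar>\<mu> C\<bar>) \<le> modulus M \<mu> (A \<union> B) - modulus M \<mu> B" by linarith
  qed
  then show "modulus M \<mu> A + modulus M \<mu> B \<le> modulus M \<mu> (A \<union> B)" by linarith
qed

lemma modulus_mono:
  assumes mu: "\<mu> \<in> ba M" and AB: "A \<subseteq> B" "B \<in> sets M" shows "modulus M \<mu> A \<le> modulus M \<mu> B"
proof (cases "A \<in> sets M")
  case True
  have "A \<union> (B - A) = B" using AB by blast
  then have "modulus M \<mu> B = modulus M \<mu> A + modulus M \<mu> (B - A)"
    using modulus_Un[OF mu True, of "B - A"] AB True by auto
  then show ?thesis using modulus_nonneg[OF mu, of "B - A"] by linarith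
qed (simp add: modulus_notin modulus_nonneg[OF mu])

lemma modulus_le_TV: "\<mu> \<in> ba M \<Longrightarrow> modulus M \<mu> A \<le> TV M \<mu>"
  unfolding TV_def using modulus_mono[of \<mu> M A "space M"] modulus_notin[of A M \<mu>]
    modulus_nonneg[of \<mu> M "space M"] sets.sets_into_space[of A M] by (cases "A \<in> sets M") auto

lemma TV_nonneg: "\<mu> \<in> ba M \<Longrightarrow> 0 \<le> TV M \<mu>"
  unfolding TV_def by (rule modulus_nonneg)

lemma modulus_eq_0_iff:
  assumes "\<mu> \<in> ba M" "A \<in> sets M"
  shows "modulus M \<mu> A = 0 \<longleftrightarrow> (\<forall>B\<in>sets M. B \<subseteq> A \<longrightarrow> \<mu> B = 0)"
proof
  assume 0: "modulus M \<mu> A = 0"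
  show "\<forall>B\<in>sets M. B \<subseteq> A \<longrightarrow> \<mu> B = 0"
  proof (intro ballI impI)
    fix B assume B: "B \<in> sets M" "B \<subseteq> A"
    have "\<bar>\<mu> B\<bar> \<le> modulus M \<mu> B" by (rule abs_le_modulus[OF assms(1) B(1)])
    also have "\<dots> \<le> modulus M \<mu> A" by (rule modulus_mono[OF assms(1) B(2) assms(2)])
    finally show "\<mu> B = 0" using 0 by simp
  qed
next
  assume *: "\<forall>B\<in>sets M. B \<subseteq> A \<longrightarrow> \<mu> B = 0"
  have "modulus M \<mu> A \<le> 0"
  proof (rule modulus_least[OF assms])
    fix \<A> assume "\<A> \<subseteq> sets M" "\<Union>\<A> = A"
    then have "\<mu> B = 0" if "B \<in> \<A>" for B using * that by blast
    then show "(\<Sum>B\<in>\<A>. \<bar>\<mu> B\<bar>) \<le> 0" by simp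
  qed
  then show "modulus M \<mu> A = 0" using modulus_nonneg[OF assms(1), of A] by linarith
qed

lemma baI:
  assumes "\<And>A. A \<notin> sets M \<Longrightarrow> \<mu> A = 0"
    and "\<And>A B. A \<in> sets M \<Longrightarrow> B \<in> sets M \<Longrightarrow> A \<inter> B = {} \<Longrightarrow> \<mu> (A \<union> B) = \<mu> A + \<mu> B"
    and "\<And>\<A>. finite \<A> \<Longrightarrow> \<A> \<subseteq> sets M \<Longrightarrow> disjoint_family_on id \<A> \<Longrightarrow> \<Union>\<A> = space M \<Longrightarrow> (\<Sum>B\<in>\<A>. \<bar>\<mu> B\<bar>) \<le> c"
  shows "\<mu> \<in> ba M"
proof -
  have "bdd_above (variation_sums M \<mu> (space M))"
  proof (rule bdd_aboveI)
    fix x assume "x \<in> variation_sums M \<mu> (space M)"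
    from variation_sumsE[OF this] show "x \<le> c" by (elim exE conjE) (simp only: assms(3))
  qed
  then show ?thesis using assms(1,2) by (auto simp: ba_def additive_def)
qed

lemma ba_lincomb:
  assumes mu: "\<mu> \<in> ba M" and nu: "\<nu> \<in> ba M"
  shows "(\<lambda>A. a * \<mu> A + b * \<nu> A) \<in> ba M"
    and "modulus M (\<lambda>A. a * \<mu> A + b * \<nu> A) A \<le> \<bar>a\<bar> * modulus M \<mu> A + \<bar>b\<bar> * modulus M \<nu> A"
proof -
  have *: "(\<Sum>B\<in>\<A>. \<bar>a * \<mu> B + b * \<nu> B\<bar>) \<le> \<bar>a\<bar> * modulus M \<mu> A + \<bar>b\<bar> * modulus M \<nu> A"
    if \<A>: "finite \<A>" "\<A> \<subseteq> sets M" "disjoint_family_on id \<A>" "\<Union>\<A> = A" and A: "A \<in> sets M" for \<A> A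
  proof -
    have "(\<Sum>B\<in>\<A>. \<bar>a * \<mu> B + b * \<nu> B\<bar>) \<le> (\<Sum>B\<in>\<A>. \<bar>a\<bar> * \<bar>\<mu> B\<bar> + \<bar>b\<bar> * \<bar>\<nu> B\<bar>)"
      by (rule sum_mono) (metis abs_mult abs_triangle_ineq)
    also have "\<dots> = \<bar>a\<bar> * (\<Sum>B\<in>\<A>. \<bar>\<mu> B\<bar>) + \<bar>b\<bar> * (\<Sum>B\<in>\<A>. \<bar>\<nu> B\<bar>)"
      by (simp add: sum.distrib sum_distrib_left)
    also have "\<dots> \<le> \<bar>a\<bar> * modulus M \<mu> A + \<bar>b\<bar> * modulus M \<nu> A"
      using sum_le_modulus[OF mu A \<A>(1), of id] sum_le_modulus[OF nu A \<A>(1), of id] \<A>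
      by (intro add_mono mult_left_mono) auto
    finally show ?thesis .
  qed
  show ba: "(\<lambda>A. a * \<mu> A + b * \<nu> A) \<in> ba M"
  proof (rule baI)
    show "a * \<mu> (A \<union> B) + b * \<nu> (A \<union> B) = a * \<mu> A + b * \<nu> A + (a * \<mu> B + b * \<nu> B)"
      if "A \<in> sets M" "B \<in> sets M" "A \<inter> B = {}" for A B
      using ba_additive[OF mu that] ba_additive[OF nu that] by (simp add: algebra_simps)
    show "a * \<mu> A + b * \<nu> A = 0" if "A \<notin> sets M" for A
      using ba_zero[OF mu that] ba_zero[OF nu that] by simp
  qed (rule *[OF _ _ _ _ sets.top])
  show "modulus M (\<lambda>A. a * \<mu> A + b * \<nu> A) A \<le> \<bar>a\<bar> * modulus M \<mu> A + \<bar>b\<bar> * modulus M \<nu> A"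
  proof (cases "A \<in> sets M")
    case True show ?thesis by (rule modulus_least[OF ba True *]) (use True in auto)
  qed (simp add: modulus_notin)
qed

lemma TV_lincomb:
  "\<mu> \<in> ba M \<Longrightarrow> \<nu> \<in> ba M \<Longrightarrow> TV M (\<lambda>A. a * \<mu> A + b * \<nu> A) \<le> \<bar>a\<bar> * TV M \<mu> + \<bar>b\<bar> * TV M \<nu>"
  unfolding TV_def by (rule ba_lincomb(2))

lemma TV_add: "\<mu> \<in> ba M \<Longrightarrow> \<nu> \<in> ba M \<Longrightarrow> TV M (\<lambda>A. \<mu> A + \<nu> A) \<le> TV M \<mu> + TV M \<nu>"
  using TV_lincomb[of \<mu> M \<nu> 1 1] by simp

lemma TV_scale: "\<mu> \<in> ba M \<Longrightarrow> TV M (\<lambda>A. a * \<mu> A) \<le> \<bar>a\<bar> * TV M \<mu>"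
  using TV_lincomb[of \<mu> M \<mu> a 0] by simp

section \<open>Integration with respect to finitely additive set functions\<close>

text \<open>A change of variables: the integral may be computed on the cells of any simple h through
  which the integrand factors. With h the pair of two simple functions, their common refinement,
  linearity becomes a rule for finite sums.\<close>

lemma simple_fa_integral_comp:
  assumes mu: "\<mu> \<in> ba M" and h: "simple_function M h"
  shows "simple_fa_integral M \<mu> (\<lambda>\<omega>. \<psi> (h \<omega>)) = (\<Sum>p\<in>h ` space M. \<psi> p * \<mu> (h -` {p} \<inter> space M))"
proof -
  have fin: "finite (h ` space M)" and cell: "\<And>p. h -` {p} \<inter> space M \<in> sets M"
    using simple_functionD[OF h] by auto
  have "\<mu> ((\<lambda>\<omega>. \<psi> (h \<omega>)) -` {y} \<inter> space M) = (\<Sum>p\<in>{p. p \<in> h ` space M \<and> \<psi> p = y}. \<mu> (h -` {p} \<inter> space M))" for y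
  proof -
    have "(\<lambda>\<omega>. \<psi> (h \<omega>)) -` {y} \<inter> space M = (\<Union>p\<in>{p. p \<in> h ` space M \<and> \<psi> p = y}. h -` {p} \<inter> space M)"
      by auto
    moreover have "disjoint_family_on (\<lambda>p. h -` {p} \<inter> space M) {p. p \<in> h ` space M \<and> \<psi> p = y}"
      by (auto simp: disjoint_family_on_def)
    ultimately show ?thesis
      using ba_finite_union[OF mu, of "{p. p \<in> h ` space M \<and> \<psi> p = y}" "\<lambda>p. h -` {p} \<inter> space M"] fin cell
      by simp
  qed
  then have "simple_fa_integral M \<mu> (\<lambda>\<omega>. \<psi> (h \<omega>)) =
      (\<Sum>y\<in>\<psi> ` h ` space M. y * (\<Sum>p\<in>{p. p \<in> h ` space M \<and> \<psi> p = y}. \<mu> (h -` {p} \<inter> space M)))"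
    by (simp add: simple_fa_integral_def image_image)
  also have "\<dots> = (\<Sum>y\<in>\<psi> ` h ` space M. (\<Sum>p\<in>{p. p \<in> h ` space M \<and> \<psi> p = y}. \<psi> p * \<mu> (h -` {p} \<inter> space M)))"
    by (intro sum.cong refl) (simp add: sum_distrib_left)
  also have "\<dots> = (\<Sum>p\<in>h ` space M. \<psi> p * \<mu> (h -` {p} \<inter> space M))"
    by (rule sum.image_gen[OF fin, symmetric])
  finally show ?thesis .
qed

lemma simple_fa_integral_lincomb:
  assumes mu: "\<mu> \<in> ba M" and s: "simple_function M s" and t: "simple_function M t"
  shows "simple_fa_integral M \<mu> (\<lambda>\<omega>. a * s \<omega> + b * t \<omega>) = a * simple_fa_integral M \<mu> s + b * simple_fa_integral M \<mu> t"
proof -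
  define h where "h = (\<lambda>\<omega>. (s \<omega>, t \<omega>))"
  have h: "simple_function M h" unfolding h_def using s t by (rule simple_function_Pair)
  note c = simple_fa_integral_comp[OF mu h]
  have "simple_fa_integral M \<mu> (\<lambda>\<omega>. a * s \<omega> + b * t \<omega>) = (\<Sum>p\<in>h ` space M. (a * fst p + b * snd p) * \<mu> (h -` {p} \<inter> space M))"
    using c[of "\<lambda>p. a * fst p + b * snd p"] by (simp add: h_def)
  also have "\<dots> = a * (\<Sum>p\<in>h ` space M. fst p * \<mu> (h -` {p} \<inter> space M)) + b * (\<Sum>p\<in>h ` space M. snd p * \<mu> (h -` {p} \<inter> space M))"
    by (simp add: algebra_simps sum.distrib sum_distrib_left)
  also have "\<dots> = a * simple_fa_integral M \<mu> s + b * simple_fa_integral M \<mu> t"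
    using c[of fst] c[of snd] by (simp add: h_def)
  finally show ?thesis .
qed

lemma simple_fa_integral_indicator:
  assumes mu: "\<mu> \<in> ba M" and A: "A \<in> sets M"
  shows "simple_fa_integral M \<mu> (indicator A) = \<mu> A"
proof -
  define h where "h = (\<lambda>\<omega>. \<omega> \<in> A)"
  have h: "simple_function M h"
    unfolding simple_function_def
  proof (intro conjI ballI)
    fix x
    have "h -` {x} \<inter> space M = (if x then A else space M - A)"
      using sets.sets_into_space[OF A] by (auto simp: h_def)
    then show "h -` {x} \<inter> space M \<in> sets M" using A by simp
  qed simp
  have "simple_fa_integral M \<mu> (\<lambda>\<omega>. of_bool (h \<omega>)) = (\<Sum>p\<in>h ` space M. of_bool p * \<mu> (h -` {p} \<inter> space M))"
    by (rule simple_fa_integral_comp[OF mu h])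
  \<comment> \<open>If A is empty or the whole space, one truth value may not be attained; its cell
    is empty and contributes 0.\<close>
  also have "\<dots> = (\<Sum>p\<in>UNIV. of_bool p * \<mu> (h -` {p} \<inter> space M))"
  proof (rule sum.mono_neutral_left)
    show "\<forall>p\<in>UNIV - h ` space M. of_bool p * \<mu> (h -` {p} \<inter> space M) = 0"
    proof
      fix p assume "p \<in> UNIV - h ` space M"
      then have "h -` {p} \<inter> space M = {}" by auto
      then show "of_bool p * \<mu> (h -` {p} \<inter> space M) = 0" using ba_empty[OF mu] by simp
    qed
  qed auto
  also have "\<dots> = \<mu> A"
    using sets.sets_into_space[OF A] by (simp add: UNIV_bool h_def vimage_def Int_absorb2 flip: Collect_mem_eq)
  finally show ?thesis unfolding h_def of_bool_def indicator_def .
qed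

text \<open>Rounding down to multiples of 1/(n+1) has uniform error at most 1/(n+1), and boundedness
  leaves only finitely many values.\<close>

lemma bounded_rv_uniform_simple:
  assumes f: "f \<in> bounded_rv M"
  shows "\<exists>s. (\<forall>n::nat. simple_function M (s n)) \<and> uniform_limit (space M) s f sequentially"
proof -
  obtain c where c: "\<forall>\<omega>\<in>space M. \<bar>f \<omega>\<bar> \<le> c" using bounded_rv_bound[OF f] by blast
  note [measurable] = bounded_rv_measurable[OF f]
  define s where "s n \<omega> = real_of_int \<lfloor>f \<omega> * Suc n\<rfloor> / Suc n" for n \<omega>
  have "simple_function M (s n)" for n
  proof (rule simple_function_borel_measurable)
    show "s n \<in> borel_measurable M" unfolding s_def by measurable
    have "s n ` space M \<subseteq> (\<lambda>i. real_of_int i / Suc n) ` {\<lfloor>- c * Suc n\<rfloor> .. \<lfloor>c * Suc n\<rfloor>}"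
    proof
      fix y assume "y \<in> s n ` space M"
      then obtain \<omega> where w: "\<omega> \<in> space M" "y = s n \<omega>" by blast
      then have "f \<omega> \<le> c" "- c \<le> f \<omega>" using c by (auto simp: abs_le_iff)
      then have "f \<omega> * Suc n \<le> c * Suc n" "- c * Suc n \<le> f \<omega> * Suc n"
        by (intro mult_right_mono; simp)+
      then have "\<lfloor>f \<omega> * Suc n\<rfloor> \<in> {\<lfloor>- c * Suc n\<rfloor> .. \<lfloor>c * Suc n\<rfloor>}"
        by (simp only: atLeastAtMost_iff floor_mono)
      then show "y \<in> (\<lambda>i. real_of_int i / Suc n) ` {\<lfloor>- c * Suc n\<rfloor> .. \<lfloor>c * Suc n\<rfloor>}"
        unfolding w(2) s_def by (rule imageI)
    qed
    then show "finite (s n ` space M)" by (rule finite_subset) simp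
  qed
  moreover have "uniform_limit (space M) s f sequentially"
  proof (rule uniform_limitI)
    fix e :: real assume "e > 0"
    have bound: "dist (s n \<omega>) (f \<omega>) \<le> 1 / Suc n" for n \<omega>
    proof -
      have "s n \<omega> - f \<omega> = (real_of_int \<lfloor>f \<omega> * Suc n\<rfloor> - f \<omega> * Suc n) / Suc n"
        by (simp add: s_def field_simps)
      moreover have "\<bar>real_of_int \<lfloor>f \<omega> * Suc n\<rfloor> - f \<omega> * Suc n\<bar> \<le> 1" by linarith
      ultimately show ?thesis by (simp add: dist_real_def divide_right_mono del: of_nat_Suc)
    qed
    obtain n0 where n0: "1 / Suc n0 < e" using nat_approx_posE[OF \<open>e > 0\<close>] by blast
    have "dist (s n \<omega>) (f \<omega>) < e" if "n \<ge> n0" for n \<omega>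
    proof -
      have "1 / real (Suc n) \<le> 1 / Suc n0" using that by (simp add: frac_le)
      then show ?thesis using bound[of n \<omega>] n0 by linarith
    qed
    then show "\<forall>\<^sub>F n in sequentially. \<forall>x\<in>space M. dist (s n x) (f x) < e"
      unfolding eventually_sequentially by blast
  qed
  ultimately show ?thesis by blast
qed

context qs_space
begin

lemma ba_cD: "\<mu> \<in> ba_c M P \<Longrightarrow> \<mu> \<in> ba M"
  by (simp add: ba_c_def)

lemma ba_c_null:
  assumes "\<mu> \<in> ba_c M P" "null N" "A \<in> sets M" "A \<subseteq> N" shows "\<mu> A = 0"
proof -
  have "modulus M \<mu> N = 0" using assms(1,2) by (simp add: ba_c_def null_def)
  then show ?thesis
    using modulus_eq_0_iff[OF ba_cD[OF assms(1)] null_sets[OF assms(2)]] assms(3,4) by blast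
qed

lemma ba_cI:
  assumes "\<mu> \<in> ba M" "\<And>N. null N \<Longrightarrow> \<mu> N = 0" shows "\<mu> \<in> ba_c M P"
  unfolding ba_c_def mem_Collect_eq
proof (intro conjI ballI impI)
  fix N assume N: "N \<in> sets M" "capacity P N = 0"
  then have "null N" by (simp add: null_def)
  then show "modulus M \<mu> N = 0"
    using modulus_eq_0_iff[OF assms(1) N(1)] null_subset assms(2) by blast
qed fact

lemma ba_c_lincomb:
  assumes "\<mu> \<in> ba_c M P" "\<nu> \<in> ba_c M P" shows "(\<lambda>A. a * \<mu> A + b * \<nu> A) \<in> ba_c M P"
proof (rule ba_cI)
  show "(\<lambda>A. a * \<mu> A + b * \<nu> A) \<in> ba M" using assms by (intro ba_lincomb(1) ba_cD)
  fix N assume "null N"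
  then show "a * \<mu> N + b * \<nu> N = 0"
    using ba_c_null[OF assms(1) \<open>null N\<close> null_sets order_refl] ba_c_null[OF assms(2) \<open>null N\<close> null_sets order_refl] by simp
qed

text \<open>A value exceeding e is taken only inside N; its cell is then contained in N and has
  \<mu>-measure 0.\<close>

lemma simple_fa_integral_bound:
  assumes mu: "\<mu> \<in> ba_c M P" and s: "simple_function M s" and N: "null N"
    and le: "\<And>\<omega>. \<omega> \<in> space M \<Longrightarrow> \<omega> \<notin> N \<Longrightarrow> \<bar>s \<omega>\<bar> \<le> e" and e: "0 \<le> e"
  shows "\<bar>simple_fa_integral M \<mu> s\<bar> \<le> e * TV M \<mu>"
proof -
  have fin: "finite (s ` space M)" and cell: "\<And>p. s -` {p} \<inter> space M \<in> sets M"
    using simple_functionD[OF s] by auto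
  have "\<bar>simple_fa_integral M \<mu> s\<bar> \<le> (\<Sum>y\<in>s ` space M. \<bar>y * \<mu> (s -` {y} \<inter> space M)\<bar>)"
    unfolding simple_fa_integral_def by (rule sum_abs)
  also have "\<dots> \<le> (\<Sum>y\<in>s ` space M. e * \<bar>\<mu> (s -` {y} \<inter> space M)\<bar>)"
  proof (rule sum_mono)
    fix y
    show "\<bar>y * \<mu> (s -` {y} \<inter> space M)\<bar> \<le> e * \<bar>\<mu> (s -` {y} \<inter> space M)\<bar>"
    proof (cases "s -` {y} \<inter> space M \<subseteq> N")
      case True
      then have "\<mu> (s -` {y} \<inter> space M) = 0" using ba_c_null[OF mu N cell] by blast
      then show ?thesis by simp
    next
      case False
      then obtain \<omega> where "\<omega> \<in> space M" "\<omega> \<notin> N" "s \<omega> = y" by blast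
      then have "\<bar>y\<bar> \<le> e" using le by blast
      then show ?thesis unfolding abs_mult by (rule mult_right_mono) simp
    qed
  qed
  also have "\<dots> = e * (\<Sum>y\<in>s ` space M. \<bar>\<mu> (s -` {y} \<inter> space M)\<bar>)" by (simp add: sum_distrib_left)
  also have "\<dots> \<le> e * TV M \<mu>"
    unfolding TV_def
    using fin cell by (intro mult_left_mono[OF sum_le_modulus[OF ba_cD[OF mu]] e]) (auto simp: disjoint_family_on_def)
  finally show ?thesis .
qed

lemma simple_fa_integral_diff_bound:
  assumes mu: "\<mu> \<in> ba_c M P" and s: "simple_function M s" and t: "simple_function M t" and N: "null N"
    and le: "\<And>\<omega>. \<omega> \<in> space M \<Longrightarrow> \<omega> \<notin> N \<Longrightarrow> \<bar>s \<omega> - t \<omega>\<bar> \<le> e" and e: "0 \<le> e"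
  shows "\<bar>simple_fa_integral M \<mu> s - simple_fa_integral M \<mu> t\<bar> \<le> e * TV M \<mu>"
proof -
  have "simple_fa_integral M \<mu> s - simple_fa_integral M \<mu> t = simple_fa_integral M \<mu> (\<lambda>\<omega>. s \<omega> - t \<omega>)"
    using simple_fa_integral_lincomb[OF ba_cD[OF mu] s t, of 1 "-1"] by simp
  then show ?thesis
    using simple_fa_integral_bound[OF mu simple_function_diff[OF s t] N, of e] le e by simp
qed

text \<open>With f = g and s = t this is the Cauchy property. In general it says that the limit
  depends neither on the representative nor on the approximating sequence.\<close>

lemma simple_fa_integral_close:
  assumes mu: "\<mu> \<in> ba_c M P" and q: "QS (\<lambda>\<omega>. f \<omega> = g \<omega>)"
    and s: "\<And>n::nat. simple_function M (s n)" "uniform_limit (space M) s f sequentially"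
    and t: "\<And>n::nat. simple_function M (t n)" "uniform_limit (space M) t g sequentially"
    and e: "e > 0"
  shows "\<exists>n0. \<forall>n\<ge>n0. \<forall>m\<ge>n0. \<bar>simple_fa_integral M \<mu> (s n) - simple_fa_integral M \<mu> (t m)\<bar> \<le> e"
proof -
  have T: "0 \<le> TV M \<mu>" by (rule TV_nonneg[OF ba_cD[OF mu]])
  \<comment> \<open>The summand 1 keeps d meaningful when the total variation is 0; the factor 2
    pays for the two approximations.\<close>
  define d where "d = e / (2 * (TV M \<mu> + 1))"
  have d: "d > 0" "2 * d * TV M \<mu> \<le> e" using e T by (auto simp: d_def field_simps)
  obtain N where N: "null N" "\<And>\<omega>. \<omega> \<in> space M \<Longrightarrow> \<omega> \<notin> N \<Longrightarrow> f \<omega> = g \<omega>" using q unfolding QS_iff by blast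
  obtain n1 where n1: "\<forall>n\<ge>n1. \<forall>\<omega>\<in>space M. dist (s n \<omega>) (f \<omega>) < d"
    using uniform_limitD[OF s(2) d(1)] unfolding eventually_sequentially by blast
  obtain n2 where n2: "\<forall>n\<ge>n2. \<forall>\<omega>\<in>space M. dist (t n \<omega>) (g \<omega>) < d"
    using uniform_limitD[OF t(2) d(1)] unfolding eventually_sequentially by blast
  have "\<bar>simple_fa_integral M \<mu> (s n) - simple_fa_integral M \<mu> (t m)\<bar> \<le> e"
    if nm: "n \<ge> max n1 n2" "m \<ge> max n1 n2" for n m
  proof -
    have "\<bar>simple_fa_integral M \<mu> (s n) - simple_fa_integral M \<mu> (t m)\<bar> \<le> (2 * d) * TV M \<mu>"
    proof (rule simple_fa_integral_diff_bound[OF mu s(1) t(1) N(1)])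
      fix \<omega> assume w: "\<omega> \<in> space M" "\<omega> \<notin> N"
      have "\<bar>s n \<omega> - f \<omega>\<bar> < d" "\<bar>t m \<omega> - g \<omega>\<bar> < d"
        using n1 n2 nm w(1) by (simp_all add: dist_real_def)
      then show "\<bar>s n \<omega> - t m \<omega>\<bar> \<le> 2 * d" using N(2)[OF w] by linarith
    qed (use d in simp)
    then show ?thesis using d(2) by linarith
  qed
  then show ?thesis by blast
qed

text \<open>Discharges the definite description in \<open>fa_integral\<close>; from here on the
  integral is evaluated along whichever approximating sequence is convenient.\<close>

lemma fa_integral_lim:
  assumes mu: "\<mu> \<in> ba_c M P" and f: "f \<in> bounded_rv M"
    and s: "\<And>n::nat. simple_function M (s n)" "uniform_limit (space M) s f sequentially"
  shows "(\<lambda>n. simple_fa_integral M \<mu> (s n)) \<longlonglongrightarrow> fa_integral M \<mu> (cls f)"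
proof -
  note fm = bounded_rv_measurable[OF f]
  have "Cauchy (\<lambda>n. simple_fa_integral M \<mu> (s n))"
  proof (rule metric_CauchyI)
    fix e :: real assume "e > 0"
    then have e2: "e / 2 > 0" by simp
    have "QS (\<lambda>\<omega>. f \<omega> = f \<omega>)" by (rule QS_always) simp
    from simple_fa_integral_close[OF mu this s s e2]
    obtain n0 where "\<forall>n\<ge>n0. \<forall>m\<ge>n0. \<bar>simple_fa_integral M \<mu> (s n) - simple_fa_integral M \<mu> (s m)\<bar> \<le> e / 2"
      by (elim exE)
    then show "\<exists>n0. \<forall>m\<ge>n0. \<forall>n\<ge>n0. dist (simple_fa_integral M \<mu> (s m)) (simple_fa_integral M \<mu> (s n)) < e"
      unfolding dist_real_def using \<open>e > 0\<close> by (intro exI[of _ n0]) fastforce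
  qed
  then obtain l where l: "(\<lambda>n. simple_fa_integral M \<mu> (s n)) \<longlonglongrightarrow> l"
    using Cauchy_convergent unfolding convergent_def by blast
  have "fa_integral M \<mu> (cls f) = l"
    unfolding fa_integral_def
  proof (rule the_equality)
    show "\<exists>g\<in>cls f. \<exists>s. (\<forall>n::nat. simple_function M (s n)) \<and>
      uniform_limit (space M) s g sequentially \<and> (\<lambda>n. simple_fa_integral M \<mu> (s n)) \<longlonglongrightarrow> l"
      using s l by (intro bexI[OF _ cls_self[OF fm]] exI[of _ s] conjI allI)
    fix l' assume "\<exists>g\<in>cls f. \<exists>s. (\<forall>n::nat. simple_function M (s n)) \<and>
      uniform_limit (space M) s g sequentially \<and> (\<lambda>n. simple_fa_integral M \<mu> (s n)) \<longlonglongrightarrow> l'"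
    then obtain g t where g: "g \<in> cls f" and t0: "\<forall>n::nat. simple_function M (t n)"
      and t1: "uniform_limit (space M) t g sequentially" and l': "(\<lambda>n. simple_fa_integral M \<mu> (t n)) \<longlonglongrightarrow> l'"
      by (elim bexE exE conjE)
    note t = t0[rule_format] t1
    have q: "QS (\<lambda>\<omega>. g \<omega> = f \<omega>)"
    proof -
      have "QS (\<lambda>\<omega>. f \<omega> = g \<omega>)" using g unfolding mem_cls[OF fm] by blast
      then show ?thesis by (rule QS_mp) simp
    qed
    have "\<bar>l' - l\<bar> \<le> e" if "e > 0" for e
    proof (rule LIMSEQ_le_const2)
      show "(\<lambda>n. \<bar>simple_fa_integral M \<mu> (t n) - simple_fa_integral M \<mu> (s n)\<bar>) \<longlonglongrightarrow> \<bar>l' - l\<bar>"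
        by (intro tendsto_rabs tendsto_diff l l')
      show "\<exists>n0. \<forall>n\<ge>n0. \<bar>simple_fa_integral M \<mu> (t n) - simple_fa_integral M \<mu> (s n)\<bar> \<le> e"
      proof -
        from simple_fa_integral_close[OF mu q t s that] obtain n0
          where "\<forall>n\<ge>n0. \<forall>m\<ge>n0. \<bar>simple_fa_integral M \<mu> (t n) - simple_fa_integral M \<mu> (s m)\<bar> \<le> e" ..
        then show ?thesis by (intro exI[of _ n0]) simp
      qed
    qed
    then have "\<bar>l' - l\<bar> \<le> 0" by (rule field_le_epsilon) simp
    then show "l' = l" by simp
  qed
  then show ?thesis using l by simp
qed

lemma fa_integral_lincomb:
  assumes mu: "\<mu> \<in> ba_c M P" and f: "f \<in> bounded_rv M" and g: "g \<in> bounded_rv M"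
  shows "fa_integral M \<mu> (cls (\<lambda>\<omega>. a * f \<omega> + b * g \<omega>)) = a * fa_integral M \<mu> (cls f) + b * fa_integral M \<mu> (cls g)"
proof -
  from bounded_rv_uniform_simple[OF f] obtain s where "\<forall>n::nat. simple_function M (s n)"
    and "uniform_limit (space M) s f sequentially" by (elim exE conjE)
  note s = this(1)[rule_format] this(2)
  from bounded_rv_uniform_simple[OF g] obtain t where "\<forall>n::nat. simple_function M (t n)"
    and "uniform_limit (space M) t g sequentially" by (elim exE conjE)
  note t = this(1)[rule_format] this(2)
  have "(\<lambda>n. simple_fa_integral M \<mu> (\<lambda>\<omega>. a * s n \<omega> + b * t n \<omega>)) \<longlonglongrightarrow> fa_integral M \<mu> (cls (\<lambda>\<omega>. a * f \<omega> + b * g \<omega>))"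
  proof (rule fa_integral_lim[OF mu])
    show "(\<lambda>\<omega>. a * f \<omega> + b * g \<omega>) \<in> bounded_rv M" by (intro bounded_rv_add bounded_rv_cmult f g)
    show "simple_function M (\<lambda>\<omega>. a * s n \<omega> + b * t n \<omega>)" for n
      by (intro simple_function_add simple_function_mult simple_function_const s(1) t(1))
    show "uniform_limit (space M) (\<lambda>n \<omega>. a * s n \<omega> + b * t n \<omega>) (\<lambda>\<omega>. a * f \<omega> + b * g \<omega>) sequentially"
      by (intro uniform_limit_add bounded_linear.uniform_limit[OF bounded_linear_mult_right] s(2) t(2))
  qed
  then have "(\<lambda>n. a * simple_fa_integral M \<mu> (s n) + b * simple_fa_integral M \<mu> (t n)) \<longlonglongrightarrow> fa_integral M \<mu> (cls (\<lambda>\<omega>. a * f \<omega> + b * g \<omega>))"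
    by (simp add: simple_fa_integral_lincomb[OF ba_cD[OF mu] s(1) t(1)])
  moreover have "(\<lambda>n. a * simple_fa_integral M \<mu> (s n) + b * simple_fa_integral M \<mu> (t n)) \<longlonglongrightarrow> a * fa_integral M \<mu> (cls f) + b * fa_integral M \<mu> (cls g)"
    by (intro tendsto_add tendsto_mult tendsto_const fa_integral_lim[OF mu f s] fa_integral_lim[OF mu g t])
  ultimately show ?thesis by (rule LIMSEQ_unique)
qed

lemma fa_integral_bound:
  assumes mu: "\<mu> \<in> ba_c M P" and f: "f \<in> bounded_rv M" and q: "QS (\<lambda>\<omega>. \<bar>f \<omega>\<bar> \<le> c)" and c: "0 \<le> c"
  shows "\<bar>fa_integral M \<mu> (cls f)\<bar> \<le> c * TV M \<mu>"
proof -
  from bounded_rv_uniform_simple[OF f] obtain s where "\<forall>n::nat. simple_function M (s n)"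
    and "uniform_limit (space M) s f sequentially" by (elim exE conjE)
  note s = this(1)[rule_format] this(2)
  obtain N where N: "null N" "\<And>\<omega>. \<omega> \<in> space M \<Longrightarrow> \<omega> \<notin> N \<Longrightarrow> \<bar>f \<omega>\<bar> \<le> c" using q unfolding QS_iff by blast
  have "\<bar>fa_integral M \<mu> (cls f)\<bar> \<le> (c + e) * TV M \<mu>" if e: "e > 0" for e
  proof (rule LIMSEQ_le_const2)
    show "(\<lambda>n. \<bar>simple_fa_integral M \<mu> (s n)\<bar>) \<longlonglongrightarrow> \<bar>fa_integral M \<mu> (cls f)\<bar>"
      by (intro tendsto_rabs fa_integral_lim[OF mu f s])
    obtain n1 where n1: "\<forall>n\<ge>n1. \<forall>\<omega>\<in>space M. dist (s n \<omega>) (f \<omega>) < e"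
      using uniform_limitD[OF s(2) e] unfolding eventually_sequentially by blast
    have "\<bar>simple_fa_integral M \<mu> (s n)\<bar> \<le> (c + e) * TV M \<mu>" if n: "n \<ge> n1" for n
    proof (rule simple_fa_integral_bound[OF mu s(1) N(1)])
      fix \<omega> assume w: "\<omega> \<in> space M" "\<omega> \<notin> N"
      have "\<bar>s n \<omega> - f \<omega>\<bar> < e" using n1 n w(1) by (simp add: dist_real_def)
      then show "\<bar>s n \<omega>\<bar> \<le> c + e" using N(2)[OF w] by linarith
    qed (use c \<open>e > 0\<close> in simp)
    then show "\<exists>n0. \<forall>n\<ge>n0. \<bar>simple_fa_integral M \<mu> (s n)\<bar> \<le> (c + e) * TV M \<mu>" by blast
  qed
  \<comment> \<open>The simple approximants are bounded by c + e only. The sharp constant c, on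
    which the isometry arguments rely, comes from letting e decrease to 0.\<close>
  moreover have "((\<lambda>e. (c + e) * TV M \<mu>) \<longlongrightarrow> (c + 0) * TV M \<mu>) (at_right 0)"
    by (intro tendsto_intros)
  ultimately have "\<bar>fa_integral M \<mu> (cls f)\<bar> \<le> (c + 0) * TV M \<mu>"
    by (intro tendsto_lowerbound[where F="at_right (0::real)"])
       (auto simp: eventually_at_filter)
  then show ?thesis by simp
qed

lemma fa_integral_indicator:
  assumes mu: "\<mu> \<in> ba_c M P" and A: "A \<in> sets M"
  shows "fa_integral M \<mu> (cls (indicator A)) = \<mu> A"
proof -
  have "(\<lambda>n::nat. simple_fa_integral M \<mu> (indicator A)) \<longlonglongrightarrow> fa_integral M \<mu> (cls (indicator A))"
    by (rule fa_integral_lim[OF mu bounded_rv_indicator[OF A]])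
       (auto intro: simple_function_indicator A uniform_limit_const)
  then show ?thesis using simple_fa_integral_indicator[OF ba_cD[OF mu] A] LIMSEQ_const_iff by metis
qed

lemma fa_integral_lincomb_measure:
  assumes mu: "\<mu> \<in> ba_c M P" and nu: "\<nu> \<in> ba_c M P" and f: "f \<in> bounded_rv M"
  shows "fa_integral M (\<lambda>A. a * \<mu> A + b * \<nu> A) (cls f) = a * fa_integral M \<mu> (cls f) + b * fa_integral M \<nu> (cls f)"
proof -
  from bounded_rv_uniform_simple[OF f] obtain s where "\<forall>n::nat. simple_function M (s n)"
    and "uniform_limit (space M) s f sequentially" by (elim exE conjE)
  note s = this(1)[rule_format] this(2)
  have eq: "simple_fa_integral M (\<lambda>A. a * \<mu> A + b * \<nu> A) t = a * simple_fa_integral M \<mu> t + b * simple_fa_integral M \<nu> t" for t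
    by (simp add: simple_fa_integral_def sum.distrib sum_distrib_left algebra_simps)
  have "(\<lambda>n. a * simple_fa_integral M \<mu> (s n) + b * simple_fa_integral M \<nu> (s n)) \<longlonglongrightarrow> fa_integral M (\<lambda>A. a * \<mu> A + b * \<nu> A) (cls f)"
    using fa_integral_lim[OF ba_c_lincomb[OF mu nu] f s, of a b] unfolding eq .
  moreover have "(\<lambda>n. a * simple_fa_integral M \<mu> (s n) + b * simple_fa_integral M \<nu> (s n)) \<longlonglongrightarrow> a * fa_integral M \<mu> (cls f) + b * fa_integral M \<nu> (cls f)"
    by (intro tendsto_add tendsto_mult tendsto_const fa_integral_lim[OF mu f s] fa_integral_lim[OF nu f s])
  ultimately show ?thesis by (rule LIMSEQ_unique)
qed

text \<open>Connects the two integrals in play: (F3) uses the Lebesgue integral, whereas the pairing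
  and (F4) use \<open>fa_integral\<close>. They agree on simple functions, and both pass to uniform
  limits.\<close>

lemma fa_integral_measure:
  assumes "finite_measure N" and sN: "sets N = sets M" and N: "measure N \<in> ba_c M P" and f: "f \<in> bounded_rv M"
  shows "fa_integral M (measure N) (cls f) = integral\<^sup>L N f"
proof -
  interpret finite_measure N by fact
  have sp: "space N = space M" using sN by (rule sets_eq_imp_space_eq)
  from bounded_rv_uniform_simple[OF f] obtain s where "\<forall>n::nat. simple_function M (s n)"
    and "uniform_limit (space M) s f sequentially" by (elim exE conjE)
  note s = this(1)[rule_format] this(2)
  have simple: "simple_fa_integral M (measure N) t = integral\<^sup>L N t" if t: "simple_function M t" for t
  proof -
    have fin: "finite (t ` space M)" and cell: "\<And>p. t -` {p} \<inter> space M \<in> sets N"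
      using simple_functionD[OF t] sN by auto
    have "integral\<^sup>L N t = (\<integral>\<omega>. (\<Sum>y\<in>t ` space M. y * indicator (t -` {y} \<inter> space M) \<omega>) \<partial>N)"
    proof (rule Bochner_Integration.integral_cong[OF refl])
      fix \<omega> assume "\<omega> \<in> space N"
      then have w: "\<omega> \<in> space M" by (simp add: sp)
      have "(\<Sum>y\<in>t ` space M. y * indicator (t -` {y} \<inter> space M) \<omega>) = (\<Sum>y\<in>t ` space M. if y = t \<omega> then y else 0)"
        using w by (intro sum.cong refl) (auto simp: indicator_def)
      also have "\<dots> = t \<omega>" using fin w by simp
      finally show "t \<omega> = (\<Sum>y\<in>t ` space M. y * indicator (t -` {y} \<inter> space M) \<omega>)" by simp
    qed
    also have "\<dots> = (\<Sum>y\<in>t ` space M. (\<integral>\<omega>. y * indicator (t -` {y} \<inter> space M) \<omega> \<partial>N))"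
      by (rule Bochner_Integration.integral_sum) (auto intro!: integrable_mult_right integrable_real_indicator cell simp: less_top[symmetric])
    also have "\<dots> = simple_fa_integral M (measure N) t"
      unfolding simple_fa_integral_def using sets.sets_into_space[OF cell] by (intro sum.cong refl) (simp add: Int_absorb2)
    finally show ?thesis by simp
  qed
  have int: "integrable N g" if g: "g \<in> bounded_rv M" for g
  proof -
    obtain c where "\<forall>\<omega>\<in>space M. \<bar>g \<omega>\<bar> \<le> c" using bounded_rv_bound[OF g] by blast
    then show ?thesis
      using bounded_rv_measurable[OF g]
      by (intro integrable_const_bound[where B=c]) (auto simp: sp measurable_cong_sets[OF sN refl])
  qed
  have ints: "integrable N (s n)" for n
  proof -
    have "finite (s n ` space M)" using simple_functionD(1)[OF s(1)] .
    then obtain c where "\<forall>y\<in>s n ` space M. \<bar>y\<bar> \<le> c"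
      using bounded_real finite_imp_bounded by metis
    then show ?thesis
      using s(1)[of n] by (intro int bounded_rvI[where c=c]) (auto intro: borel_measurable_simple_function)
  qed
  have "(\<lambda>n. integral\<^sup>L N (s n)) \<longlonglongrightarrow> integral\<^sup>L N f"
  proof (rule LIMSEQ_I)
    fix r :: real assume r: "r > 0"
    define d where "d = r / (measure N (space N) + 1)"
    have m: "0 < measure N (space N) + 1" by (simp add: add_nonneg_pos)
    have d: "d > 0" "d * measure N (space N) < r"
      unfolding d_def using r m by (simp_all add: divide_simps distrib_left)
    obtain n1 where n1: "\<forall>n\<ge>n1. \<forall>\<omega>\<in>space M. dist (s n \<omega>) (f \<omega>) < d"
      using uniform_limitD[OF s(2) d(1)] unfolding eventually_sequentially by blast
    have "norm (integral\<^sup>L N (s n) - integral\<^sup>L N f) < r" if "n \<ge> n1" for n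
    proof -
      have "norm (integral\<^sup>L N (s n) - integral\<^sup>L N f) = norm (\<integral>\<omega>. s n \<omega> - f \<omega> \<partial>N)"
        using ints[of n] int[OF f] by simp
      also have "\<dots> \<le> (\<integral>\<omega>. norm (s n \<omega> - f \<omega>) \<partial>N)" by (rule integral_norm_bound)
      also have "\<dots> \<le> (\<integral>\<omega>. d \<partial>N)"
      proof (rule integral_mono)
        show "norm (s n \<omega> - f \<omega>) \<le> d" if "\<omega> \<in> space N" for \<omega>
          using n1 \<open>n \<ge> n1\<close> that unfolding sp dist_norm by (meson less_imp_le)
      qed (use ints[of n] int[OF f] in auto)
      also have "\<dots> = d * measure N (space N)" by simp
      finally show ?thesis using d(2) by linarith
    qed
    then show "\<exists>no. \<forall>n\<ge>no. norm (integral\<^sup>L N (s n) - integral\<^sup>L N f) < r" by blast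
  qed
  moreover have "(\<lambda>n. integral\<^sup>L N (s n)) \<longlonglongrightarrow> fa_integral M (measure N) (cls f)"
    using fa_integral_lim[OF N f s] unfolding simple[OF s(1)] .
  ultimately show ?thesis by (metis LIMSEQ_unique)
qed

end

section \<open>Countably additive and supported set functions\<close>

lemma caD: "\<mu> \<in> ca M \<Longrightarrow> \<mu> \<in> ba M"
  by (simp add: ca_def)

lemma ca_sums:
  fixes A :: "nat \<Rightarrow> 'a set"
  assumes "\<mu> \<in> ca M" "range A \<subseteq> sets M" "disjoint_family A"
  shows "(\<lambda>n. \<mu> (A n)) sums \<mu> (\<Union>n. A n)"
  using assms by (simp add: ca_def)

lemma caI:
  assumes "\<mu> \<in> ba M"
    and "\<And>A::nat \<Rightarrow> 'a set. range A \<subseteq> sets M \<Longrightarrow> disjoint_family A \<Longrightarrow> (\<lambda>n. \<mu> (A n)) sums \<mu> (\<Union>n. A n)"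
  shows "\<mu> \<in> ca M"
  using assms by (simp add: ca_def)

lemma ca_lincomb:
  assumes "\<mu> \<in> ca M" "\<nu> \<in> ca M" shows "(\<lambda>A. a * \<mu> A + b * \<nu> A) \<in> ca M"
proof (rule caI)
  show "(\<lambda>A. a * \<mu> A + b * \<nu> A) \<in> ba M" using assms by (intro ba_lincomb(1) caD)
  fix A :: "nat \<Rightarrow> 'a set" assume A: "range A \<subseteq> sets M" "disjoint_family A"
  show "(\<lambda>n. a * \<mu> (A n) + b * \<nu> (A n)) sums (a * \<mu> (\<Union>n. A n) + b * \<nu> (\<Union>n. A n))"
    by (intro sums_add sums_mult ca_sums[OF _ A] assms)
qed

lemma modulus_empty: "\<mu> \<in> ba M \<Longrightarrow> modulus M \<mu> {} = 0"
  using modulus_Un[of \<mu> M "{}" "{}"] by simp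

lemma modulus_finite_union:
  fixes A :: "nat \<Rightarrow> 'a set"
  assumes mu: "\<mu> \<in> ba M" and A: "range A \<subseteq> sets M" "disjoint_family A"
  shows "(\<Sum>n<k. modulus M \<mu> (A n)) = modulus M \<mu> (\<Union>n<k. A n)"
proof (induction k)
  case 0
  show ?case using modulus_empty[OF mu] by simp
next
  case (Suc k)
  have "A n \<inter> A k = {}" if "n < k" for n
    using A(2) that unfolding disjoint_family_on_def by simp
  then have "(\<Union>n<k. A n) \<inter> A k = {}" by blast
  moreover have "(\<Union>n<Suc k. A n) = (\<Union>n<k. A n) \<union> A k" by (auto simp: lessThan_Suc)
  moreover have "(\<Union>n<k. A n) \<in> sets M" "A k \<in> sets M" using A(1) by auto
  ultimately show ?case using Suc modulus_Un[OF mu, of "\<Union>n<k. A n" "A k"] by simp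
qed

text \<open>Finite additivity and monotonicity bound the series by the modulus of the union.
  Conversely, each block C of a finite partition is split as the union of the C \<inter>
  \<open>A n\<close> by countable additivity of \<mu>, and the finite sums over blocks and over n
  are exchanged.\<close>

lemma modulus_sums:
  fixes A :: "nat \<Rightarrow> 'a set"
  assumes mu: "\<mu> \<in> ca M" and A: "range A \<subseteq> sets M" "disjoint_family A"
  shows "(\<lambda>n. modulus M \<mu> (A n)) sums modulus M \<mu> (\<Union>n. A n)"
proof -
  note ba = caD[OF mu]
  have U: "(\<Union>n. A n) \<in> sets M" using A(1) by auto
  have partial: "(\<Sum>n<k. modulus M \<mu> (A n)) \<le> modulus M \<mu> (\<Union>n. A n)" for k
    unfolding modulus_finite_union[OF ba A] by (rule modulus_mono[OF ba _ U]) auto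
  have summ: "summable (\<lambda>n. modulus M \<mu> (A n))"
    by (rule summableI_nonneg_bounded[OF modulus_nonneg[OF ba] partial])
  have le: "(\<Sum>n. modulus M \<mu> (A n)) \<le> modulus M \<mu> (\<Union>n. A n)"
    by (rule suminf_le_const[OF summ partial])
  have "modulus M \<mu> (\<Union>n. A n) \<le> (\<Sum>n. modulus M \<mu> (A n))"
  proof (rule modulus_least[OF ba U])
    fix \<A> assume \<A>: "finite \<A>" "\<A> \<subseteq> sets M" "disjoint_family_on id \<A>" "\<Union>\<A> = (\<Union>n. A n)"
    have lim: "(\<lambda>k. \<Sum>n<k. \<mu> (C \<inter> A n)) \<longlonglongrightarrow> \<mu> C" if C: "C \<in> \<A>" for C
    proof -
      have "range (\<lambda>n. C \<inter> A n) \<subseteq> sets M" using C \<A>(2) A(1) by auto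
      moreover have "disjoint_family (\<lambda>n. C \<inter> A n)" using A(2) by (auto simp: disjoint_family_on_def)
      ultimately have "(\<lambda>n. \<mu> (C \<inter> A n)) sums \<mu> (\<Union>n. C \<inter> A n)" by (rule ca_sums[OF mu])
      moreover have "(\<Union>n. C \<inter> A n) = C" using C \<A>(4) by blast
      ultimately show ?thesis by (simp add: sums_def)
    qed
    have "(\<lambda>k. \<Sum>C\<in>\<A>. \<bar>\<Sum>n<k. \<mu> (C \<inter> A n)\<bar>) \<longlonglongrightarrow> (\<Sum>C\<in>\<A>. \<bar>\<mu> C\<bar>)"
      by (intro tendsto_sum tendsto_rabs lim)
    moreover have "(\<Sum>C\<in>\<A>. \<bar>\<Sum>n<k. \<mu> (C \<inter> A n)\<bar>) \<le> (\<Sum>n. modulus M \<mu> (A n))" for k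
    proof -
      have "(\<Sum>C\<in>\<A>. \<bar>\<Sum>n<k. \<mu> (C \<inter> A n)\<bar>) \<le> (\<Sum>C\<in>\<A>. \<Sum>n<k. \<bar>\<mu> (C \<inter> A n)\<bar>)"
        by (intro sum_mono sum_abs)
      also have "\<dots> = (\<Sum>n<k. \<Sum>C\<in>\<A>. \<bar>\<mu> (C \<inter> A n)\<bar>)" by (rule sum.swap)
      also have "\<dots> \<le> (\<Sum>n<k. modulus M \<mu> (A n))"
      proof (rule sum_mono)
        fix n
        have An: "A n \<in> sets M" using A(1) by auto
        show "(\<Sum>C\<in>\<A>. \<bar>\<mu> (C \<inter> A n)\<bar>) \<le> modulus M \<mu> (A n)"
        proof (rule sum_le_modulus[OF ba An \<A>(1)])
          show "C \<inter> A n \<in> sets M" if "C \<in> \<A>" for C using that \<A>(2) An by auto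
          show "disjoint_family_on (\<lambda>C. C \<inter> A n) \<A>"
            using \<A>(3) unfolding disjoint_family_on_def id_apply by blast
          show "(\<Union>C\<in>\<A>. C \<inter> A n) = A n" using \<A>(4) by blast
        qed
      qed
      also have "\<dots> \<le> (\<Sum>n. modulus M \<mu> (A n))"
        by (rule sum_le_suminf[OF summ]) (simp_all add: modulus_nonneg[OF ba])
      finally show ?thesis .
    qed
    ultimately show "(\<Sum>C\<in>\<A>. \<bar>\<mu> C\<bar>) \<le> (\<Sum>n. modulus M \<mu> (A n))"
      by (intro LIMSEQ_le_const2) auto
  qed
  then have "(\<Sum>n. modulus M \<mu> (A n)) = modulus M \<mu> (\<Union>n. A n)" using le by linarith
  then show ?thesis using summable_sums[OF summ] by simp
qed

text \<open>Turns nonnegative countably additive set functions into HOL measures, so that null sets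
  and Lebesgue integrals apply to them. Extension by 0 agrees with the value of
  \<open>measure\<close> at non-measurable sets, which gives equality of functions.\<close>

lemma ex_finite_measure:
  assumes nonneg: "\<And>A. 0 \<le> \<nu> A" and off: "\<And>A. A \<notin> sets M \<Longrightarrow> \<nu> A = 0" and empty: "\<nu> {} = 0"
    and sums: "\<And>A::nat \<Rightarrow> 'a set. range A \<subseteq> sets M \<Longrightarrow> disjoint_family A \<Longrightarrow> (\<lambda>n. \<nu> (A n)) sums \<nu> (\<Union>n. A n)"
  shows "\<exists>N. finite_measure N \<and> sets N = sets M \<and> measure N = \<nu>"
proof -
  define N where "N = measure_of (space M) (sets M) (\<lambda>A. ennreal (\<nu> A))"
  have sN: "sets N = sets M" unfolding N_def by simp
  have em: "emeasure N A = ennreal (\<nu> A)" if "A \<in> sets M" for A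
  proof (rule emeasure_measure_of[OF N_def])
    show "countably_additive (sets N) (\<lambda>A. ennreal (\<nu> A))"
      unfolding countably_additive_def sN
      by (intro allI impI suminf_ennreal_eq nonneg sums) auto
  qed (use that in \<open>auto simp: sN positive_def empty sets.space_closed\<close>)
  have m: "measure N A = \<nu> A" for A
  proof (cases "A \<in> sets M")
    case True then show ?thesis using em nonneg by (simp add: measure_def)
  next
    case False then show ?thesis using off sN by (simp add: measure_notin_sets)
  qed
  have "finite_measure N"
    using em[of "space M"] sets_eq_imp_space_eq[OF sN] by (intro finite_measureI) simp
  then show ?thesis using sN m by blast
qed

lemma finite_measure_in_ca:
  assumes "finite_measure N" and sN: "sets N = sets M"
  shows "measure N \<in> ca M" "modulus M (measure N) = measure N"
proof -
  interpret finite_measure N by fact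
  have ba: "measure N \<in> ba M"
  proof (rule baI)
    show "measure N A = 0" if "A \<notin> sets M" for A using that sN by (simp add: measure_notin_sets)
    show "measure N (A \<union> B) = measure N A + measure N B" if "A \<in> sets M" "B \<in> sets M" "A \<inter> B = {}" for A B
      using that by (intro finite_measure_Union) (auto simp: sN)
    fix \<A> assume \<A>: "finite \<A>" "\<A> \<subseteq> sets M" "disjoint_family_on id \<A>"
    have "(\<Sum>B\<in>\<A>. measure N (id B)) = measure N (\<Union>B\<in>\<A>. id B)"
      by (rule finite_measure_finite_Union[symmetric, OF \<A>(1) _ \<A>(3)]) (use \<A> sN in auto)
    then show "(\<Sum>B\<in>\<A>. \<bar>measure N B\<bar>) \<le> measure N (space N)"
      using bounded_measure[of "\<Union>\<A>"] by simp
  qed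
  show ca: "measure N \<in> ca M"
  proof (rule caI[OF ba])
    fix A :: "nat \<Rightarrow> 'a set" assume "range A \<subseteq> sets M" "disjoint_family A"
    then show "(\<lambda>n. measure N (A n)) sums measure N (\<Union>n. A n)"
      by (intro finite_measure_UNION) (auto simp: sN)
  qed
  show "modulus M (measure N) = measure N"
  proof
    fix A
    show "modulus M (measure N) A = measure N A"
    proof (cases "A \<in> sets M")
      case True
      have "modulus M (measure N) A \<le> measure N A"
      proof (rule modulus_least[OF ba True])
        fix \<A> assume \<A>: "finite \<A>" "\<A> \<subseteq> sets M" "disjoint_family_on id \<A>" "\<Union>\<A> = A"
        have "(\<Sum>B\<in>\<A>. measure N (id B)) = measure N (\<Union>B\<in>\<A>. id B)"
          by (rule finite_measure_finite_Union[symmetric, OF \<A>(1) _ \<A>(3)]) (use \<A> sN in auto)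
        then show "(\<Sum>B\<in>\<A>. \<bar>measure N B\<bar>) \<le> measure N A" using \<A>(4) by simp
      qed
      moreover have "measure N A \<le> modulus M (measure N) A"
        using abs_le_modulus[OF ba True] by simp
      ultimately show ?thesis by linarith
    next
      case False then show ?thesis using sN by (simp add: modulus_notin measure_notin_sets)
    qed
  qed
qed

lemma ex_modulus_measure:
  assumes mu: "\<mu> \<in> ca M"
  shows "\<exists>N. finite_measure N \<and> sets N = sets M \<and> measure N = modulus M \<mu>"
proof (rule ex_finite_measure)
  show "modulus M \<mu> {} = 0" by (rule modulus_empty[OF caD[OF mu]])
qed (simp_all add: modulus_nonneg[OF caD[OF mu]] modulus_notin modulus_sums[OF mu])

lemma modulus_in_ca:
  assumes mu: "\<mu> \<in> ca M" shows "modulus M \<mu> \<in> ca M" "modulus M (modulus M \<mu>) = modulus M \<mu>"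
  using ex_modulus_measure[OF mu] finite_measure_in_ca by (metis, metis)

lemma modulus_UN_null:
  assumes mu: "\<mu> \<in> ca M" and B: "\<And>n::nat. B n \<in> sets M" "\<And>n. modulus M \<mu> (B n) = 0"
  shows "modulus M \<mu> (\<Union>n. B n) = 0"
proof -
  obtain T where T: "finite_measure T" "sets T = sets M" "measure T = modulus M \<mu>"
    using ex_modulus_measure[OF mu] by blast
  interpret finite_measure T by (rule T(1))
  have "B n \<in> null_sets T" for n
    using B[of n] T(2,3) by (simp add: null_sets_def emeasure_eq_measure)
  then have "(\<Union>n. B n) \<in> null_sets T" by (rule null_sets_UN)
  then show ?thesis using T(3) by (simp add: null_sets_def measure_def flip: T(3))
qed

text \<open>An exhaustion argument: the union B of countably many |\<mu>|-null events whose
  |\<tau>|-measures approach the supremum attains it. A |\<mu>|-null event of positive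
  |\<tau>|-measure outside B would exceed the supremum.\<close>

lemma ex_maximal_null_set:
  assumes tau: "\<tau> \<in> ca M" and mu: "\<mu> \<in> ca M"
  shows "\<exists>B\<in>sets M. modulus M \<mu> B = 0 \<and> (\<forall>A\<in>sets M. modulus M \<mu> A = 0 \<longrightarrow> modulus M \<tau> (A - B) = 0)"
proof -
  define F where "F = {modulus M \<tau> A | A. A \<in> sets M \<and> modulus M \<mu> A = 0}"
  have empty: "modulus M \<mu> {} = 0" by (rule modulus_empty[OF caD[OF mu]])
  have ne: "F \<noteq> {}" using empty by (auto simp: F_def)
  have bdd: "bdd_above F"
    by (rule bdd_aboveI[of _ "TV M \<tau>"]) (auto simp: F_def modulus_le_TV[OF caD[OF tau]])
  have "\<exists>A. A \<in> sets M \<and> modulus M \<mu> A = 0 \<and> Sup F - 1 / Suc n < modulus M \<tau> A" for n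
  proof -
    have "Sup F - 1 / Suc n < Sup F" by simp
    then obtain x where "x \<in> F" "Sup F - 1 / Suc n < x" using less_cSupD[OF ne] by blast
    then show ?thesis by (auto simp: F_def)
  qed
  then obtain A where A: "\<And>n. A n \<in> sets M" "\<And>n. modulus M \<mu> (A n) = 0" "\<And>n. Sup F - 1 / Suc n < modulus M \<tau> (A n)"
    by metis
  define B where "B = (\<Union>n. A n)"
  have B: "B \<in> sets M" using A(1) by (auto simp: B_def)
  have B0: "modulus M \<mu> B = 0" unfolding B_def using modulus_UN_null[OF mu A(1,2)] .
  have sup: "Sup F \<le> modulus M \<tau> B"
  proof (rule field_le_epsilon)
    fix e :: real assume "e > 0"
    then obtain n where n: "1 / Suc n < e" using nat_approx_posE by blast
    have "modulus M \<tau> (A n) \<le> modulus M \<tau> B"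
      by (rule modulus_mono[OF caD[OF tau] _ B]) (auto simp: B_def)
    then show "Sup F \<le> modulus M \<tau> B + e" using A(3)[of n] n by linarith
  qed
  have "modulus M \<tau> (C - B) = 0" if C: "C \<in> sets M" "modulus M \<mu> C = 0" for C
  proof -
    have CB: "C - B \<in> sets M" using C B by simp
    have "modulus M \<mu> (C - B) \<le> modulus M \<mu> C" by (rule modulus_mono[OF caD[OF mu] _ C(1)]) auto
    then have "modulus M \<mu> (C - B) = 0" using C(2) modulus_nonneg[OF caD[OF mu], of "C - B"] by linarith
    then have "modulus M \<mu> (B \<union> (C - B)) = 0" using modulus_Un[OF caD[OF mu] B CB] B0 by auto
    then have "modulus M \<tau> (B \<union> (C - B)) \<in> F" unfolding F_def using sets.Un[OF B CB] by blast
    then have "modulus M \<tau> (B \<union> (C - B)) \<le> Sup F" using bdd by (rule cSup_upper)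
    moreover have "modulus M \<tau> (B \<union> (C - B)) = modulus M \<tau> B + modulus M \<tau> (C - B)"
      by (rule modulus_Un[OF caD[OF tau] B CB]) auto
    ultimately show ?thesis using sup modulus_nonneg[OF caD[OF tau], of "C - B"] by linarith
  qed
  then show ?thesis using B B0 by blast
qed

lemma modulus_null_mono:
  assumes "\<mu> \<in> ba M" "A \<subseteq> B" "B \<in> sets M" "modulus M \<mu> B = 0" shows "modulus M \<mu> A = 0"
  using modulus_mono[OF assms(1-3)] modulus_nonneg[OF assms(1), of A] assms(4) by linarith

section \<open>The space of supported set functions: domination, decomposition, densities,
  completeness\<close>

context qs_space
begin

abbreviation sca :: "('a set \<Rightarrow> real) set" where "sca \<equiv> sca_c M P"

lemma scaD:
  assumes "\<mu> \<in> sca" shows "\<mu> \<in> ca M" "\<mu> \<in> ba M" "\<mu> \<in> ba_c M P"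
  using assms by (auto simp: sca_c_def ca_c_def ca_def)

lemma sca_support:
  assumes "\<mu> \<in> sca"
  shows "\<exists>S\<in>sets M. modulus M \<mu> (space M - S) = 0 \<and>
    (\<forall>N\<in>sets M. modulus M \<mu> (N \<inter> S) = 0 \<longrightarrow> null (N \<inter> S))"
  using assms unfolding sca_c_def supported_def null_def by blast

text \<open>One criterion for linear combinations, moduli, densities and limits, the last of which
  call for a whole sequence \<tau>. A support of \<mu> arises from the supports \<open>S k\<close>
  of the \<tau> k by deleting the largest |\<mu>|-null event \<open>B k\<close> as seen by \<tau> k.
  A |\<mu>|-null part of what is left is also null for \<tau> k within \<open>S k - B k\<close>,
  hence null for every k.\<close>

lemma sca_dominated:
  fixes \<tau> :: "nat \<Rightarrow> 'a set \<Rightarrow> real"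
  assumes tau: "\<And>k. \<tau> k \<in> sca" and mu: "\<mu> \<in> ca M"
    and dom: "\<And>A. A \<in> sets M \<Longrightarrow> (\<And>k. modulus M (\<tau> k) A = 0) \<Longrightarrow> \<mu> A = 0"
  shows "\<mu> \<in> sca"
proof -
  note tba = scaD(2)[OF tau]
  have "\<mu> \<in> ba_c M P"
  proof (rule ba_cI[OF caD[OF mu]])
    fix N assume N: "null N"
    have "modulus M (\<tau> k) N = 0" for k using scaD(3)[OF tau, of k] N by (simp add: ba_c_def null_def)
    then show "\<mu> N = 0" by (rule dom[OF null_sets[OF N]])
  qed
  moreover have "supported M P (modulus M \<mu>)"
  proof -
    from sca_support[OF tau] obtain S where "\<forall>k. S k \<in> sets M \<and> modulus M (\<tau> k) (space M - S k) = 0 \<and>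
      (\<forall>N\<in>sets M. modulus M (\<tau> k) (N \<inter> S k) = 0 \<longrightarrow> null (N \<inter> S k))" by metis
    then have S: "\<And>k. S k \<in> sets M" "\<And>k. modulus M (\<tau> k) (space M - S k) = 0"
      "\<And>k N. N \<in> sets M \<Longrightarrow> modulus M (\<tau> k) (N \<inter> S k) = 0 \<Longrightarrow> null (N \<inter> S k)" by auto
    from ex_maximal_null_set[OF scaD(1)[OF tau] mu] obtain B where "\<forall>k. B k \<in> sets M \<and> modulus M \<mu> (B k) = 0 \<and>
      (\<forall>A\<in>sets M. modulus M \<mu> A = 0 \<longrightarrow> modulus M (\<tau> k) (A - B k) = 0)" by metis
    then have B: "\<And>k. B k \<in> sets M" "\<And>k. modulus M \<mu> (B k) = 0"
      "\<And>k A. A \<in> sets M \<Longrightarrow> modulus M \<mu> A = 0 \<Longrightarrow> modulus M (\<tau> k) (A - B k) = 0" by auto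
    define S' where "S' = (\<Union>k. S k - B k)"
    have S': "S' \<in> sets M" using S(1) B(1) by (auto simp: S'_def)
    \<comment> \<open>A point of D lies in no \<open>B k\<close> and in no \<open>S k - B k\<close>,
      hence in no \<open>S k\<close>. All \<tau> k therefore vanish on the events inside D, and so
      does \<mu> by domination.\<close>
    define D where "D = (space M - S') - (\<Union>k. B k)"
    have D: "D \<in> sets M" using S' B(1) by (auto simp: D_def)
    have "modulus M \<mu> D = 0"
      unfolding modulus_eq_0_iff[OF caD[OF mu] D]
    proof (intro ballI impI)
      fix C assume C: "C \<in> sets M" "C \<subseteq> D"
      have "modulus M (\<tau> k) C = 0" for k
      proof (rule modulus_null_mono[OF tba _ _ S(2)])
        show "C \<subseteq> space M - S k" using C(2) by (auto simp: D_def S'_def)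
      qed (use S(1) in auto)
      then show "\<mu> C = 0" by (rule dom[OF C(1)])
    qed
    moreover have UB: "(\<Union>k. B k) \<in> sets M" using B(1) by auto
    moreover have "modulus M \<mu> (\<Union>k. B k) = 0" by (rule modulus_UN_null[OF mu B(1,2)])
    ultimately have "modulus M \<mu> ((\<Union>k. B k) \<union> D) = 0"
      using modulus_Un[OF caD[OF mu] UB D] by (auto simp: D_def)
    then have "modulus M \<mu> (space M - S') = 0"
      by (rule modulus_null_mono[OF caD[OF mu], rotated 2]) (use sets.Un[OF UB D] in \<open>auto simp: D_def\<close>)
    moreover have "capacity P (N \<inter> S') = 0" if N: "N \<in> sets M" "modulus M \<mu> (N \<inter> S') = 0" for N
    proof -
      have "null (N \<inter> (S k - B k))" for k
      proof -
        have NS: "N \<inter> S' - B k \<in> sets M" using N(1) S' B(1) by auto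
        have "modulus M (\<tau> k) (N \<inter> S' - B k) = 0" using N S' by (intro B(3)) auto
        then have "modulus M (\<tau> k) ((N - B k) \<inter> S k) = 0"
          by (rule modulus_null_mono[OF tba _ NS, rotated]) (auto simp: S'_def)
        then have "null ((N - B k) \<inter> S k)" using N(1) B(1) by (intro S(3)) auto
        moreover have "(N - B k) \<inter> S k = N \<inter> (S k - B k)" by blast
        ultimately show ?thesis by simp
      qed
      then have "null (\<Union>k. N \<inter> (S k - B k))" by (rule null_UN)
      moreover have "(\<Union>k. N \<inter> (S k - B k)) = N \<inter> S'" by (auto simp: S'_def)
      ultimately show ?thesis by (simp add: null_def)
    qed
    ultimately show ?thesis unfolding supported_def using S' by blast
  qed
  ultimately show ?thesis using mu by (simp add: sca_c_def ca_c_def)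
qed

lemma modulus_null_le:
  assumes "\<mu> \<in> ba M" "A \<in> sets M" "modulus M \<mu> A = 0" shows "\<mu> A = 0"
  using abs_le_modulus[OF assms(1,2)] assms(3) by simp

lemma sca_dominated1:
  assumes "\<tau> \<in> sca" "\<mu> \<in> ca M" "\<And>A. A \<in> sets M \<Longrightarrow> modulus M \<tau> A = 0 \<Longrightarrow> \<mu> A = 0"
  shows "\<mu> \<in> sca"
  by (rule sca_dominated[where \<tau>="\<lambda>_. \<tau>"]) (use assms in auto)

lemma sca_lincomb:
  assumes "\<mu> \<in> sca" "\<nu> \<in> sca" shows "(\<lambda>A. a * \<mu> A + b * \<nu> A) \<in> sca"
proof (rule sca_dominated[where \<tau>="\<lambda>k. if k = 0 then \<mu> else \<nu>"])
  show "(\<lambda>A. a * \<mu> A + b * \<nu> A) \<in> ca M" using assms by (intro ca_lincomb scaD)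
  fix A assume A: "A \<in> sets M" and *: "\<And>k::nat. modulus M (if k = 0 then \<mu> else \<nu>) A = 0"
  have "\<mu> A = 0" "\<nu> A = 0"
    using *[of 0] *[of 1] modulus_null_le[OF _ A] scaD(2) assms by auto
  then show "a * \<mu> A + b * \<nu> A = 0" by simp
qed (use assms in simp)

lemma sca_zero: "(\<lambda>_. 0) \<in> sca"
proof -
  have z: "finite_measure (null_measure M)" by (rule finite_measureI) simp
  have m: "measure (null_measure M) = (\<lambda>_. 0)" by (simp add: measure_def fun_eq_iff)
  have "(\<lambda>_. 0) \<in> ca M" and mod: "modulus M (\<lambda>_. 0) = (\<lambda>_. 0)"
    using finite_measure_in_ca[OF z, of M] unfolding m by auto
  moreover have "supported M P (modulus M (\<lambda>_. 0))"
    unfolding mod supported_def using null_empty by (intro bexI[of _ "{}"]) (auto simp: null_def)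
  ultimately show ?thesis
    by (auto simp: sca_c_def ca_c_def ca_def ba_c_def)
qed

lemma sca_subspace: "linear_subspace sca"
  unfolding linear_subspace_def using sca_zero sca_lincomb[of _ _ 1 1] sca_lincomb[of _ _ _ 0]
  by simp

lemma sca_modulus:
  assumes "\<mu> \<in> sca" shows "modulus M \<mu> \<in> sca"
  by (rule sca_dominated1[OF assms modulus_in_ca(1)[OF scaD(1)[OF assms]]])

lemma ex_sca_measure:
  assumes nu: "\<nu> \<in> sca" and nonneg: "\<And>A. A \<in> sets M \<Longrightarrow> 0 \<le> \<nu> A"
  shows "\<exists>N. finite_measure N \<and> sets N = sets M \<and> measure N = \<nu>"
proof (rule ex_finite_measure)
  show z: "\<nu> A = 0" if "A \<notin> sets M" for A using ba_zero[OF scaD(2)[OF nu] that] .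
  show "0 \<le> \<nu> A" for A using nonneg[of A] z[of A] by (cases "A \<in> sets M") auto
qed (use ba_empty[OF scaD(2)[OF nu]] ca_sums[OF scaD(1)[OF nu]] in auto)

lemma sca_nonneg_zero:
  assumes nu: "\<nu> \<in> sca" "\<And>A. A \<in> sets M \<Longrightarrow> 0 \<le> \<nu> A" "\<nu> (space M) = 0" shows "\<nu> = (\<lambda>_. 0)"
proof
  fix A
  obtain N where N: "finite_measure N" "sets N = sets M" "measure N = \<nu>" using ex_sca_measure[OF nu(1,2)] by blast
  then show "\<nu> A = 0"
    using finite_measure.bounded_measure[OF N(1), of A] nu(3) sets_eq_imp_space_eq[OF N(2)]
    unfolding N(3)[symmetric] by (simp add: measure_le_0_iff)
qed

lemma ex_sca_prob:
  assumes nu: "\<nu> \<in> sca" and nonneg: "\<And>A. A \<in> sets M \<Longrightarrow> 0 \<le> \<nu> A" and pos: "\<nu> (space M) > 0"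
  shows "\<exists>Q\<in>sca_prob M P. measure Q = (\<lambda>A. \<nu> A / \<nu> (space M))"
proof -
  have sc: "(\<lambda>A. \<nu> A / \<nu> (space M)) \<in> sca" using sca_lincomb[OF nu nu, of "1 / \<nu> (space M)" 0] by simp
  have "0 \<le> \<nu> A / \<nu> (space M)" if "A \<in> sets M" for A using nonneg[OF that] pos by simp
  from ex_sca_measure[OF sc this] obtain Q where Q: "finite_measure Q" "sets Q = sets M"
    "measure Q = (\<lambda>A. \<nu> A / \<nu> (space M))" by blast
  interpret finite_measure Q by (rule Q(1))
  have "measure Q (space Q) = 1" using Q(3) sets_eq_imp_space_eq[OF Q(2)] pos by simp
  then have "prob_space Q" by (intro prob_spaceI) (simp add: emeasure_eq_measure)
  then show ?thesis using Q sc by (intro bexI[of _ Q]) (auto simp: sca_prob_def prob_measures_def)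
qed

text \<open>The parts are (|\<mu>| + \<mu>)/2 and (|\<mu>| - \<mu>)/2. They are supported because
  the modulus is, and nonnegative because the modulus dominates |\<mu> A|.\<close>

lemma sca_Jordan:
  assumes mu: "\<mu> \<in> sca"
  shows "\<exists>\<nu>1\<in>sca. \<exists>\<nu>2\<in>sca. (\<forall>A\<in>sets M. 0 \<le> \<nu>1 A \<and> 0 \<le> \<nu>2 A) \<and> \<mu> = (\<lambda>A. \<nu>1 A - \<nu>2 A)"
proof -
  define \<nu>1 where "\<nu>1 = (\<lambda>A. 1 / 2 * modulus M \<mu> A + 1 / 2 * \<mu> A)"
  define \<nu>2 where "\<nu>2 = (\<lambda>A. 1 / 2 * modulus M \<mu> A + (- 1 / 2) * \<mu> A)"
  have "\<nu>1 \<in> sca" "\<nu>2 \<in> sca"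
    unfolding \<nu>1_def \<nu>2_def by (intro sca_lincomb sca_modulus mu)+
  moreover have "\<mu> = (\<lambda>A. \<nu>1 A - \<nu>2 A)" by (auto simp: fun_eq_iff \<nu>1_def \<nu>2_def field_simps)
  moreover have "\<forall>A\<in>sets M. 0 \<le> \<nu>1 A \<and> 0 \<le> \<nu>2 A"
    using abs_le_modulus[OF scaD(2)[OF mu]] by (fastforce simp: \<nu>1_def \<nu>2_def abs_le_iff)
  ultimately show ?thesis by blast
qed

lemma sca_probD:
  assumes "Q \<in> sca_prob M P"
  shows "prob_space Q" "sets Q = sets M" "space Q = space M" "finite_measure Q" "measure Q \<in> sca"
  using assms sets_eq_imp_space_eq prob_space.axioms(1) by (auto simp: sca_prob_def prob_measures_def)

text \<open>The normalized modulus of \<mu> is a supported probability that charges every event on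
  which \<mu> does not vanish.\<close>

lemma ex_sca_prob_charging:
  assumes mu: "\<mu> \<in> sca" and G: "G \<in> sets M" "\<mu> G \<noteq> 0"
  shows "\<exists>Q\<in>sca_prob M P. measure Q G > 0"
proof -
  have pos: "modulus M \<mu> G > 0" using abs_le_modulus[OF scaD(2)[OF mu] G(1)] G(2) by linarith
  moreover have "modulus M \<mu> G \<le> modulus M \<mu> (space M)"
    using modulus_le_TV[OF scaD(2)[OF mu]] by (simp add: TV_def)
  ultimately have "modulus M \<mu> (space M) > 0" by linarith
  from ex_sca_prob[OF sca_modulus[OF mu] modulus_nonneg[OF scaD(2)[OF mu]] this]
  obtain Q where "Q \<in> sca_prob M P" "measure Q = (\<lambda>A. modulus M \<mu> A / modulus M \<mu> (space M))" by blast
  moreover from this(2) have "measure Q G > 0" using pos \<open>modulus M \<mu> (space M) > 0\<close> by simp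
  ultimately show ?thesis by blast
qed

lemma bounded_rv_integrable:
  assumes "finite_measure N" and sN: "sets N = sets M" and f: "f \<in> bounded_rv M"
  shows "integrable N f"
proof -
  interpret finite_measure N by fact
  obtain c where "\<forall>\<omega>\<in>space M. \<bar>f \<omega>\<bar> \<le> c" using bounded_rv_bound[OF f] by blast
  then show ?thesis
    using bounded_rv_measurable[OF f] sets_eq_imp_space_eq[OF sN]
    by (intro integrable_const_bound[where B=c]) (auto simp: measurable_cong_sets[OF sN refl])
qed

lemma fa_integral_prob:
  assumes Q: "Q \<in> sca_prob M P" and f: "f \<in> bounded_rv M"
  shows "fa_integral M (measure Q) (cls f) = integral\<^sup>L Q f"
  by (rule fa_integral_measure[OF sca_probD(4,2)[OF Q] scaD(3)[OF sca_probD(5)[OF Q]] f])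

text \<open>Later g is the difference between a function and its approximate projection, and this
  lemma makes it an element of the predual. Since g is signed, g + c is taken as a density and c Q
  is subtracted afterwards; measures with a density relative to Q are supported by
  domination.\<close>

lemma ex_sca_density:
  assumes Q: "Q \<in> sca_prob M P" and g: "g \<in> bounded_rv M"
  shows "\<exists>\<mu>\<in>sca. \<forall>f\<in>bounded_rv M. fa_integral M \<mu> (cls f) = (\<integral>\<omega>. g \<omega> * f \<omega> \<partial>Q)"
proof -
  note Qp = sca_probD[OF Q]
  interpret Q: prob_space Q by (rule Qp(1))
  note int = bounded_rv_integrable[OF Qp(4,2)]
  have meas: "f \<in> borel_measurable Q" if "f \<in> bounded_rv M" for f
    using bounded_rv_measurable[OF that] by (simp add: measurable_cong_sets[OF Qp(2) refl])
  obtain c where c: "c > 0" "\<forall>\<omega>\<in>space M. \<bar>g \<omega>\<bar> \<le> c" using bounded_rv_bound[OF g] by blast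
  \<comment> \<open>On \<open>space M\<close> the maximum is inactive because c bounds |g|; it makes
    h nonnegative at the remaining points of the type.\<close>
  define h where "h = (\<lambda>\<omega>. max 0 (g \<omega> + c))"
  have h: "h \<in> bounded_rv M"
  proof (rule bounded_rvI)
    show "h \<in> borel_measurable M" unfolding h_def using bounded_rv_measurable[OF g] by measurable
    show "\<bar>h \<omega>\<bar> \<le> 2 * c" if "\<omega> \<in> space M" for \<omega>
      using c that by (auto simp: h_def abs_le_iff max_def)
  qed
  have h0: "0 \<le> h \<omega>" for \<omega> by (simp add: h_def)
  have hg: "h \<omega> = g \<omega> + c" if "\<omega> \<in> space M" for \<omega> using c(2) that by (auto simp: h_def abs_le_iff)
  define N where "N = density Q (\<lambda>\<omega>. ennreal (h \<omega>))"
  have sN: "sets N = sets M" by (simp add: N_def Qp(2))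
  have fin: "finite_measure N"
  proof (rule finite_measureI)
    have "emeasure N (space N) = (\<integral>\<^sup>+\<omega>. ennreal (h \<omega>) \<partial>Q)"
      unfolding N_def using meas[OF h] by (subst emeasure_density) (auto intro!: nn_integral_cong)
    also have "\<dots> = ennreal (integral\<^sup>L Q h)" using int[OF h] h0 by (intro nn_integral_eq_integral) auto
    finally show "emeasure N (space N) \<noteq> \<infinity>" by simp
  qed
  have Nsca: "measure N \<in> sca"
  proof (rule sca_dominated1[OF Qp(5) finite_measure_in_ca(1)[OF fin sN]])
    fix A assume A: "A \<in> sets M" "modulus M (measure Q) A = 0"
    then have "emeasure Q A = 0"
      using finite_measure_in_ca(2)[OF Qp(4,2)] by (simp add: Q.emeasure_eq_measure)
    then have "A \<in> null_sets Q" using A(1) Qp(2) by (simp add: null_sets_def)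
    then have "A \<in> null_sets N"
      unfolding N_def using meas[OF h] absolutely_continuousI_density[of "\<lambda>\<omega>. ennreal (h \<omega>)" Q] by (auto simp: absolutely_continuous_def)
    then show "measure N A = 0" by (simp add: null_sets_def measure_def)
  qed
  have "fa_integral M (\<lambda>A. 1 * measure N A + (- c) * measure Q A) (cls f) = (\<integral>\<omega>. g \<omega> * f \<omega> \<partial>Q)" if f: "f \<in> bounded_rv M" for f
  proof -
    have "fa_integral M (measure N) (cls f) = integral\<^sup>L N f"
      by (rule fa_integral_measure[OF fin sN scaD(3)[OF Nsca] f])
    also have "\<dots> = (\<integral>\<omega>. h \<omega> * f \<omega> \<partial>Q)"
      unfolding N_def using meas[OF h] meas[OF f] h0 by (subst integral_density) auto
    also have "\<dots> = (\<integral>\<omega>. g \<omega> * f \<omega> + c * f \<omega> \<partial>Q)"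
      by (rule Bochner_Integration.integral_cong) (auto simp: Qp(3) hg algebra_simps)
    also have "\<dots> = (\<integral>\<omega>. g \<omega> * f \<omega> \<partial>Q) + c * integral\<^sup>L Q f"
      using int[OF bounded_rv_mult[OF g f]] int[OF f] by simp
    finally show ?thesis
      using fa_integral_lincomb_measure[OF scaD(3)[OF Nsca] scaD(3)[OF Qp(5)] f, of 1 "- c"] fa_integral_prob[OF Q f]
      by simp
  qed
  then show ?thesis using sca_lincomb[OF Nsca Qp(5), of 1 "- c"] by blast
qed

text \<open>The candidate y is the limit on each event. For fixed k the partition sums of
  \<open>x j\<close> - \<open>x k\<close> obey the bound \<epsilon> k before j tends to infinity, so
  the limit obeys it uniformly over partitions. Countable additivity follows by uniform
  approximation, and y is supported because the sequence x itself dominates it.\<close>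

lemma sca_complete:
  assumes x: "\<And>k::nat. x k \<in> sca" and close: "\<And>j k. k \<le> j \<Longrightarrow> TV M (\<lambda>A. x j A - x k A) \<le> \<epsilon> k"
    and eps: "\<epsilon> \<longlonglongrightarrow> 0"
  shows "\<exists>y\<in>sca. \<forall>k. TV M (\<lambda>A. y A - x k A) \<le> \<epsilon> k"
proof -
  note xba = scaD(2)[OF x]
  have dba: "(\<lambda>A. x j A - x k A) \<in> ba M" for j k using ba_lincomb(1)[OF xba xba, of 1 j "-1" k] by simp
  have close': "\<bar>x j A - x k A\<bar> \<le> \<epsilon> k" if "k \<le> j" for j k A
  proof (cases "A \<in> sets M")
    case True
    have "\<bar>x j A - x k A\<bar> \<le> modulus M (\<lambda>A. x j A - x k A) A" using abs_le_modulus[OF dba True] .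
    also have "\<dots> \<le> TV M (\<lambda>A. x j A - x k A)" by (rule modulus_le_TV[OF dba])
    finally show ?thesis using close[OF that] by linarith
  next
    case False
    then show ?thesis using ba_zero[OF xba False] TV_nonneg[OF dba, of j k] close[OF that] by simp
  qed
  have "Cauchy (\<lambda>k. x k A)" for A
  proof (rule metric_CauchyI)
    fix e :: real assume "e > 0"
    then obtain n0 where n0: "\<epsilon> n0 < e / 2" using order_tendstoD(2)[OF eps, of "e / 2"] by (auto simp: eventually_sequentially)
    have "dist (x m A) (x n A) < e" if "m \<ge> n0" "n \<ge> n0" for m n
      using close'[OF that(1), of A] close'[OF that(2), of A] n0 unfolding dist_real_def by linarith
    then show "\<exists>n0. \<forall>m\<ge>n0. \<forall>n\<ge>n0. dist (x m A) (x n A) < e" by blast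
  qed
  then have "\<forall>A. \<exists>l. (\<lambda>k. x k A) \<longlonglongrightarrow> l" using Cauchy_convergent unfolding convergent_def by blast
  then obtain y where y: "\<And>A. (\<lambda>k. x k A) \<longlonglongrightarrow> y A" by metis
  have diff: "(\<Sum>B\<in>\<A>. \<bar>y B - x k B\<bar>) \<le> \<epsilon> k"
    if \<A>: "finite \<A>" "\<A> \<subseteq> sets M" "disjoint_family_on id \<A>" "\<Union>\<A> = space M" for k \<A>
  proof (rule LIMSEQ_le_const2)
    show "(\<lambda>j. \<Sum>B\<in>\<A>. \<bar>x j B - x k B\<bar>) \<longlonglongrightarrow> (\<Sum>B\<in>\<A>. \<bar>y B - x k B\<bar>)"
      by (intro tendsto_sum tendsto_rabs tendsto_diff y tendsto_const)
    have "(\<Sum>B\<in>\<A>. \<bar>x j B - x k B\<bar>) \<le> \<epsilon> k" if "j \<ge> k" for j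
      using sum_le_modulus[OF dba sets.top \<A>(1), of id j k] \<A>(3,4) subsetD[OF \<A>(2)] close[OF that]
      by (simp add: TV_def)
    then show "\<exists>n0. \<forall>j\<ge>n0. (\<Sum>B\<in>\<A>. \<bar>x j B - x k B\<bar>) \<le> \<epsilon> k" by blast
  qed
  have yba: "y \<in> ba M"
  proof (rule baI)
    show "y A = 0" if "A \<notin> sets M" for A
      using y[of A] ba_zero[OF xba that] by (simp add: LIMSEQ_const_iff)
    show "y (A \<union> B) = y A + y B" if "A \<in> sets M" "B \<in> sets M" "A \<inter> B = {}" for A B
      using tendsto_add[OF y[of A] y[of B]] y[of "A \<union> B"] unfolding ba_additive[OF xba that] by (metis LIMSEQ_unique)
    fix \<A> assume \<A>: "finite \<A>" "\<A> \<subseteq> sets M" "disjoint_family_on id \<A>" "\<Union>\<A> = space M"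
    have "(\<Sum>B\<in>\<A>. \<bar>y B\<bar>) \<le> (\<Sum>B\<in>\<A>. \<bar>y B - x 0 B\<bar> + \<bar>x 0 B\<bar>)" by (intro sum_mono) linarith
    also have "\<dots> = (\<Sum>B\<in>\<A>. \<bar>y B - x 0 B\<bar>) + (\<Sum>B\<in>\<A>. \<bar>x 0 B\<bar>)" by (rule sum.distrib)
    also have "\<dots> \<le> \<epsilon> 0 + TV M (x 0)"
      using diff[OF \<A>, of 0] sum_le_modulus[OF xba sets.top \<A>(1), of id 0] \<A>(3,4) subsetD[OF \<A>(2)]
      by (simp add: TV_def)
    finally show "(\<Sum>B\<in>\<A>. \<bar>y B\<bar>) \<le> \<epsilon> 0 + TV M (x 0)" .
  qed
  have yx: "(\<lambda>A. y A - x k A) \<in> ba M" for k using ba_lincomb(1)[OF yba xba, of 1 "-1" k] by simp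
  have TVy: "TV M (\<lambda>A. y A - x k A) \<le> \<epsilon> k" for k
    unfolding TV_def by (rule modulus_least[OF yx sets.top diff])
  have "y \<in> ca M"
  proof (rule caI[OF yba])
    fix A :: "nat \<Rightarrow> 'a set" assume A: "range A \<subseteq> sets M" "disjoint_family A"
    have Am: "A n \<in> sets M" for n using A(1) by auto
    have fin: "(\<Sum>n<m. \<nu> (A n)) = \<nu> (\<Union>n<m. A n)" if "\<nu> \<in> ba M" for \<nu> m
      using ba_finite_union[OF that, of "{..<m}" A] A by (auto simp: disjoint_family_on_def)
    have yle: "\<bar>y B - x k B\<bar> \<le> \<epsilon> k" if "B \<in> sets M" for B k
      using abs_le_modulus[OF yx that, of k] modulus_le_TV[OF yx, of k B] TVy[of k] by linarith
    show "(\<lambda>n. y (A n)) sums y (\<Union>n. A n)"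
      unfolding sums_def
    proof (rule LIMSEQ_I)
      fix e :: real assume e: "e > 0"
      then obtain k where k: "\<epsilon> k < e / 3" using order_tendstoD(2)[OF eps, of "e / 3"] by (auto simp: eventually_sequentially)
      have "(\<lambda>m. \<Sum>n<m. x k (A n)) \<longlonglongrightarrow> x k (\<Union>n. A n)"
        using ca_sums[OF scaD(1)[OF x] A] by (simp add: sums_def)
      moreover have "e / 3 > 0" using e by simp
      ultimately obtain m0 where m0: "\<forall>m\<ge>m0. norm ((\<Sum>n<m. x k (A n)) - x k (\<Union>n. A n)) < e / 3"
        using LIMSEQ_D by blast
      have "norm ((\<Sum>n<m. y (A n)) - y (\<Union>n. A n)) < e" if "m \<ge> m0" for m
      proof -
        have 1: "\<bar>x k (\<Union>n<m. A n) - x k (\<Union>n. A n)\<bar> < e / 3"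
          using m0 that unfolding fin[OF xba] real_norm_def by blast
        have 2: "\<bar>y (\<Union>n<m. A n) - x k (\<Union>n<m. A n)\<bar> \<le> \<epsilon> k" "\<bar>y (\<Union>n. A n) - x k (\<Union>n. A n)\<bar> \<le> \<epsilon> k"
          using Am by (intro yle; auto)+
        show ?thesis unfolding fin[OF yba] real_norm_def using 1 2 k by linarith
      qed
      then show "\<exists>m0. \<forall>m\<ge>m0. norm ((\<Sum>n<m. y (A n)) - y (\<Union>n. A n)) < e" by blast
    qed
  qed
  then have "y \<in> sca"
  proof (rule sca_dominated[OF x])
    fix A assume A: "A \<in> sets M" "\<And>k. modulus M (x k) A = 0"
    have "x k A = 0" for k by (rule modulus_null_le[OF xba A])
    then show "y A = 0" using y[of A] by (simp add: LIMSEQ_const_iff)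
  qed
  then show ?thesis using TVy by blast
qed

section \<open>Order continuity of supported probability measures\<close>

lemma QS_AE:
  assumes Q: "Q \<in> sca_prob M P" and q: "QS \<phi>" shows "AE \<omega> in Q. \<phi> \<omega>"
proof -
  note Qp = sca_probD[OF Q]
  interpret Q: prob_space Q by (rule Qp(1))
  obtain N where N: "null N" "\<forall>\<omega>\<in>space M - N. \<phi> \<omega>" using q unfolding QS_iff by blast
  have "measure Q N = 0" using ba_c_null[OF scaD(3)[OF Qp(5)] N(1) null_sets[OF N(1)] order_refl] .
  then have "N \<in> null_sets Q"
    using null_sets[OF N(1)] Qp(2) by (simp add: null_sets_def Q.emeasure_eq_measure)
  then show ?thesis by (rule AE_I') (use N(2) Qp(3) in auto)
qed

lemma meas_prob: "Q \<in> sca_prob M P \<Longrightarrow> f \<in> borel_measurable M \<Longrightarrow> f \<in> borel_measurable Q"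
  using sca_probD(2) measurable_cong_sets by blast

lemma integrable_prob: "Q \<in> sca_prob M P \<Longrightarrow> f \<in> bounded_rv M \<Longrightarrow> integrable Q f"
  by (rule bounded_rv_integrable[OF sca_probD(4,2)])

lemma integral_rep:
  assumes Q: "Q \<in> sca_prob M P" and f: "f \<in> bounded_rv M"
  shows "integral\<^sup>L Q (rep (cls f)) = integral\<^sup>L Q f"
  using rep_cls[OF bounded_rv_measurable[OF f]] meas_prob[OF Q] bounded_rv_measurable[OF f]
  by (intro integral_cong_AE QS_AE[OF Q]) auto

lemma integral_mono_QS:
  assumes Q: "Q \<in> sca_prob M P" and f: "f \<in> bounded_rv M" and g: "g \<in> bounded_rv M" and q: "QS (\<lambda>\<omega>. f \<omega> \<le> g \<omega>)"
  shows "integral\<^sup>L Q f \<le> integral\<^sup>L Q g"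
  by (intro integral_mono_AE integrable_prob[OF Q] f g QS_AE[OF Q q])

lemma sca_prob_support:
  assumes "Q \<in> sca_prob M P"
  shows "\<exists>S\<in>sets M. measure Q (space M - S) = 0 \<and> (\<forall>N\<in>sets M. measure Q (N \<inter> S) = 0 \<longrightarrow> null (N \<inter> S))"
  using sca_support[OF sca_probD(5)[OF assms]]
  unfolding finite_measure_in_ca(2)[OF sca_probD(4,2)[OF assms]] .

lemma AE_support:
  assumes Q: "Q \<in> sca_prob M P" and S: "S \<in> sets M" "measure Q (space M - S) = 0"
  shows "AE \<omega> in Q. \<omega> \<in> S"
proof (rule AE_I')
  interpret prob_space Q using sca_probD(1)[OF Q] .
  show "space M - S \<in> null_sets Q"
    using S sca_probD(2)[OF Q] by (simp add: null_sets_def emeasure_eq_measure)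
qed (use sca_probD(3)[OF Q] in auto)

text \<open>The converse of \<open>QS_AE\<close>, valid on a support: an exceptional Q-null event
  meets S in a Q-null event, which is null by the choice of S.\<close>

lemma AE_QS_support:
  assumes Q: "Q \<in> sca_prob M P" and S: "\<And>N. N \<in> sets M \<Longrightarrow> measure Q (N \<inter> S) = 0 \<Longrightarrow> null (N \<inter> S)" "S \<in> sets M"
    and ae: "AE \<omega> in Q. \<phi> \<omega>"
  shows "QS (\<lambda>\<omega>. \<omega> \<in> S \<longrightarrow> \<phi> \<omega>)"
proof -
  note Qp = sca_probD[OF Q]
  interpret Q: prob_space Q by (rule Qp(1))
  from ae obtain N where N: "{\<omega>\<in>space Q. \<not> \<phi> \<omega>} \<subseteq> N" "emeasure Q N = 0" "N \<in> sets Q"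
    by (rule AE_E)
  have "measure Q (N \<inter> S) \<le> measure Q N"
    using N(3) by (intro Q.finite_measure_mono) auto
  moreover have "measure Q N = 0" using N(2) by (simp add: measure_def)
  ultimately have "measure Q (N \<inter> S) = 0" by (simp add: measure_le_0_iff)
  then have "null (N \<inter> S)" using N(3) Qp(2) by (intro S(1)) auto
  then show ?thesis by (rule QS_I) (use N(1) Qp(3) in auto)
qed

lemma L_zero_cls: "L_zero M P = cls (\<lambda>_. 0)"
  by (simp add: L_zero_def)

lemma nonneg_representative:
  assumes Y: "Y \<in> Linf" "L_le M P (L_zero M P) Y"
  shows "\<exists>y\<in>bounded_rv M. Y = cls y \<and> (\<forall>\<omega>. 0 \<le> y \<omega>)"
proof -
  from Y(1) obtain f where f: "f \<in> bounded_rv M" "Y = cls f" by (rule LinfE)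
  have q: "QS (\<lambda>\<omega>. 0 \<le> f \<omega>)"
    using Y(2) bounded_rv_measurable[OF f(1)] unfolding f(2) L_zero_cls by (simp add: L_le_cls)
  obtain c where c: "c > 0" "\<forall>\<omega>\<in>space M. \<bar>f \<omega>\<bar> \<le> c" using bounded_rv_bound[OF f(1)] by blast
  have g: "(\<lambda>\<omega>. max 0 (f \<omega>)) \<in> bounded_rv M"
  proof (rule bounded_rvI[where c=c])
    show "(\<lambda>\<omega>. max 0 (f \<omega>)) \<in> borel_measurable M" using bounded_rv_measurable[OF f(1)] by measurable
    show "\<bar>max 0 (f \<omega>)\<bar> \<le> c" if "\<omega> \<in> space M" for \<omega> using c that by fastforce
  qed
  have "cls (\<lambda>\<omega>. max 0 (f \<omega>)) = cls f"
    by (rule cls_eqI[OF bounded_rv_measurable[OF g] bounded_rv_measurable[OF f(1)]]) (rule QS_mp[OF q], simp)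
  then show ?thesis using f(2) g by (intro bexI[OF _ g]) simp
qed

text \<open>The infimum of a net is not available pointwise.  A sequence of the net that minimizes the
  \<open>Q\<close>-expectations has a pointwise infimum, which lies below every member of the net \<open>Q\<close>-almost
  surely, hence quasi surely on the support of \<open>Q\<close>.\<close>

lemma supported_prob_order_continuous:
  assumes Q: "Q \<in> sca_prob M P" and dir: "directed I le"
    and Ys: "\<And>i. i \<in> I \<Longrightarrow> Ys i \<in> Linf" "\<And>i j. i \<in> I \<Longrightarrow> j \<in> I \<Longrightarrow> le i j \<Longrightarrow> L_le M P (Ys j) (Ys i)"
      "\<And>i. i \<in> I \<Longrightarrow> L_le M P (L_zero M P) (Ys i)"
    and inf0: "\<And>Z. Z \<in> Linf \<Longrightarrow> (\<And>i. i \<in> I \<Longrightarrow> L_le M P Z (Ys i)) \<Longrightarrow> L_le M P Z (L_zero M P)"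
    and e: "e > 0"
  shows "\<exists>i\<in>I. integral\<^sup>L Q (rep (Ys i)) < e"
proof (rule ccontr)
  assume neg: "\<not> (\<exists>i\<in>I. integral\<^sup>L Q (rep (Ys i)) < e)"
  note Qp = sca_probD[OF Q]
  interpret Q: prob_space Q by (rule Qp(1))
  have "\<forall>i\<in>I. \<exists>y. y \<in> bounded_rv M \<and> Ys i = cls y \<and> (\<forall>\<omega>. 0 \<le> y \<omega>)"
    using nonneg_representative[OF Ys(1) Ys(3)] by blast
  then obtain y where y': "\<forall>i\<in>I. y i \<in> bounded_rv M \<and> Ys i = cls (y i) \<and> (\<forall>\<omega>. 0 \<le> y i \<omega>)"
    by (rule bchoice[THEN exE])
  then have y: "\<And>i. i \<in> I \<Longrightarrow> y i \<in> bounded_rv M" "\<And>i. i \<in> I \<Longrightarrow> Ys i = cls (y i)" "\<And>i \<omega>. i \<in> I \<Longrightarrow> 0 \<le> y i \<omega>"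
    by simp_all
  note ym = bounded_rv_measurable[OF y(1)]
  define E where "E i = integral\<^sup>L Q (y i)" for i
  have Ege: "e \<le> E i" if "i \<in> I" for i
  proof -
    have "\<not> integral\<^sup>L Q (rep (Ys i)) < e" using neg that by blast
    then show ?thesis using integral_rep[OF Q y(1)[OF that]] unfolding E_def y(2)[OF that] by linarith
  qed
  have ymono: "QS (\<lambda>\<omega>. y j \<omega> \<le> y i \<omega>)" if "i \<in> I" "j \<in> I" "le i j" for i j
    using Ys(2)[OF that] that ym unfolding y(2)[OF that(1)] y(2)[OF that(2)] by (simp add: L_le_cls)
  have Emono: "E j \<le> E i" if "i \<in> I" "j \<in> I" "le i j" for i j
    unfolding E_def using that by (intro integral_mono_QS[OF Q] y ymono)
  define l where "l = Inf (E ` I)"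
  have I: "I \<noteq> {}" using dir by (simp add: directed_def)
  have ub: "\<exists>k\<in>I. le i k \<and> le j k" if "i \<in> I" "j \<in> I" for i j
    using dir that unfolding directed_def by blast
  have bdd: "bdd_below (E ` I)" by (rule bdd_belowI2[where m=e]) (rule Ege)
  have l_le: "l \<le> E i" if "i \<in> I" for i unfolding l_def using bdd that by (intro cInf_lower) auto
  have l_e: "e \<le> l" unfolding l_def using I Ege by (intro cInf_greatest) auto
  have near: "\<exists>i\<in>I. E i < l + d" if "d > 0" for d
    using cInf_lessD[of "E ` I" "l + d"] I that unfolding l_def by auto
  \<comment> \<open>The chosen indices climb in the net while their expectations approach the
    infimum l. Climbing makes the representatives decrease almost surely, so that the expectations
    converge to that of Z.\<close>
  have "\<exists>k. \<forall>n. (k n \<in> I \<and> E (k n) < l + 1 / Suc n) \<and> le (k n) (k (Suc n))"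
  proof (rule dependent_nat_choice)
    show "\<exists>x. x \<in> I \<and> E x < l + 1 / Suc 0" using near[of 1] by auto
    fix x n assume x: "x \<in> I \<and> E x < l + 1 / Suc n"
    obtain i where i: "i \<in> I" "E i < l + 1 / Suc (Suc n)" using near[of "1 / Suc (Suc n)"] by auto
    obtain j where j: "j \<in> I" "le x j" "le i j" using ub x i(1) by blast
    have "E j < l + 1 / Suc (Suc n)" using Emono[OF i(1) j(1) j(3)] i(2) by linarith
    then show "\<exists>y. (y \<in> I \<and> E y < l + 1 / Suc (Suc n)) \<and> le x y" using j by blast
  qed
  then obtain k where "\<forall>n. (k n \<in> I \<and> E (k n) < l + 1 / Suc n) \<and> le (k n) (k (Suc n))" ..
  then have k: "\<And>n. k n \<in> I" "\<And>n. E (k n) < l + 1 / Suc n" "\<And>n. le (k n) (k (Suc n))" by simp_all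
  define Z where "Z = (\<lambda>\<omega>. INF n. y (k n) \<omega>)"
  have bd: "bdd_below (range (\<lambda>n. y (k n) \<omega>))" for \<omega> by (rule bdd_belowI2[where m=0]) (rule y(3)[OF k(1)])
  have Zle: "Z \<omega> \<le> y (k n) \<omega>" for \<omega> n unfolding Z_def by (rule cINF_lower[OF bd]) simp
  have Z0: "0 \<le> Z \<omega>" for \<omega> unfolding Z_def by (rule cINF_greatest) (simp_all add: y(3)[OF k(1)])
  obtain c where c: "\<forall>\<omega>\<in>space M. \<bar>y (k 0) \<omega>\<bar> \<le> c" using bounded_rv_bound[OF y(1)[OF k(1)]] by blast
  have Zb: "Z \<in> bounded_rv M"
  proof (rule bounded_rvI[where c=c])
    show "Z \<in> borel_measurable M" unfolding Z_def
      by (rule borel_measurable_cINF) (auto intro: ym k(1) bd)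
    show "\<bar>Z \<omega>\<bar> \<le> c" if "\<omega> \<in> space M" for \<omega> using c that Z0[of \<omega>] Zle[of \<omega> 0] by fastforce
  qed
  have minb: "(\<lambda>\<omega>. min (f \<omega>) (g \<omega>)) \<in> bounded_rv M" if "f \<in> bounded_rv M" "g \<in> bounded_rv M" for f g
  proof -
    have "(\<lambda>\<omega>. (f \<omega> + g \<omega> + (- 1) * \<bar>f \<omega> - g \<omega>\<bar>) * (1 / 2)) \<in> bounded_rv M"
      by (intro bounded_rv_mult bounded_rv_add bounded_rv_abs bounded_rv_diff bounded_rv_const that)
    moreover have "(\<lambda>\<omega>. (f \<omega> + g \<omega> + (- 1) * \<bar>f \<omega> - g \<omega>\<bar>) * (1 / 2)) = (\<lambda>\<omega>. min (f \<omega>) (g \<omega>))"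
      by (auto simp: min_def fun_eq_iff)
    ultimately show ?thesis by simp
  qed
  have ZQ: "AE \<omega> in Q. Z \<omega> \<le> y i \<omega>" if i: "i \<in> I" for i
  proof -
    \<comment> \<open>For j above both \<open>k n\<close> and i, y j lies quasi surely below the
      minimum of y (k n) and y i, so this minimum still has expectation at least l. As E (k n) < l +
      1/(n+1), the excess over y i has mean at most 1/(n+1).\<close>
    have small: "(\<integral>\<omega>. Z \<omega> - min (Z \<omega>) (y i \<omega>) \<partial>Q) \<le> 1 / Suc n" for n
    proof -
      obtain j where j: "j \<in> I" "le (k n) j" "le i j" using ub[OF k(1) i] by blast
      have "QS (\<lambda>\<omega>. y j \<omega> \<le> min (y (k n) \<omega>) (y i \<omega>))"
        by (rule QS_mp2[OF ymono[OF k(1) j(1,2)] ymono[OF i j(1,3)]]) simp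
      then have "E j \<le> (\<integral>\<omega>. min (y (k n) \<omega>) (y i \<omega>) \<partial>Q)"
        unfolding E_def by (intro integral_mono_QS[OF Q] minb y j(1) k(1) i)
      then have le: "l \<le> (\<integral>\<omega>. min (y (k n) \<omega>) (y i \<omega>) \<partial>Q)" using l_le[OF j(1)] by linarith
      have "(\<integral>\<omega>. Z \<omega> - min (Z \<omega>) (y i \<omega>) \<partial>Q) \<le> (\<integral>\<omega>. y (k n) \<omega> - min (y (k n) \<omega>) (y i \<omega>) \<partial>Q)"
      proof (rule integral_mono)
        show "Z \<omega> - min (Z \<omega>) (y i \<omega>) \<le> y (k n) \<omega> - min (y (k n) \<omega>) (y i \<omega>)" for \<omega>
          using Zle[of \<omega> n] by linarith
      qed (intro integrable_prob[OF Q] bounded_rv_diff minb Zb y i k(1))+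
      also have "\<dots> = E (k n) - (\<integral>\<omega>. min (y (k n) \<omega>) (y i \<omega>) \<partial>Q)"
        unfolding E_def by (intro Bochner_Integration.integral_diff integrable_prob[OF Q] minb y i k(1))
      also have "\<dots> \<le> 1 / Suc n" using le k(2)[of n] by linarith
      finally show ?thesis .
    qed
    have int: "integrable Q (\<lambda>\<omega>. Z \<omega> - min (Z \<omega>) (y i \<omega>))"
      by (intro integrable_prob[OF Q] bounded_rv_diff minb Zb y i)
    have nn: "AE \<omega> in Q. 0 \<le> Z \<omega> - min (Z \<omega>) (y i \<omega>)" by simp
    have "(\<integral>\<omega>. Z \<omega> - min (Z \<omega>) (y i \<omega>) \<partial>Q) \<le> 0"
    proof (rule field_le_epsilon)
      fix d :: real assume "d > 0"
      then obtain n where "1 / Suc n < d" using nat_approx_posE by blast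
      then show "(\<integral>\<omega>. Z \<omega> - min (Z \<omega>) (y i \<omega>) \<partial>Q) \<le> 0 + d" using small[of n] by linarith
    qed
    moreover have "0 \<le> (\<integral>\<omega>. Z \<omega> - min (Z \<omega>) (y i \<omega>) \<partial>Q)" by (rule integral_nonneg_AE[OF nn])
    ultimately have "(\<integral>\<omega>. Z \<omega> - min (Z \<omega>) (y i \<omega>) \<partial>Q) = 0" by linarith
    then have "AE \<omega> in Q. Z \<omega> - min (Z \<omega>) (y i \<omega>) = 0"
      using integral_nonneg_eq_0_iff_AE[OF int nn] by blast
    then show ?thesis by (rule AE_mp) (intro AE_I2 impI, linarith)
  qed
  obtain S where S: "S \<in> sets M" "measure Q (space M - S) = 0" "\<forall>N\<in>sets M. measure Q (N \<inter> S) = 0 \<longrightarrow> null (N \<inter> S)"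
    using sca_prob_support[OF Q] by blast
  \<comment> \<open>Off the support the almost sure comparison has no quasi-sure content; there 0 is
    taken, a lower bound of the net. This makes W a quasi-sure lower bound to which
    \<open>inf0\<close> applies.\<close>
  define W where "W = (\<lambda>\<omega>. Z \<omega> * indicator S \<omega>)"
  have Wb: "W \<in> bounded_rv M" unfolding W_def by (intro bounded_rv_mult Zb bounded_rv_indicator S(1))
  have "L_le M P (cls W) (Ys i)" if i: "i \<in> I" for i
  proof -
    have "QS (\<lambda>\<omega>. \<omega> \<in> S \<longrightarrow> Z \<omega> \<le> y i \<omega>)"
      by (rule AE_QS_support[OF Q _ S(1) ZQ[OF i]]) (use S(3) in blast)
    then have "QS (\<lambda>\<omega>. W \<omega> \<le> y i \<omega>)"
      by (rule QS_mp) (auto simp: W_def indicator_def y(3)[OF i])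
    then show ?thesis
      using L_le_cls[OF bounded_rv_measurable[OF Wb] ym[OF i]] y(2)[OF i] by simp
  qed
  then have "L_le M P (cls W) (L_zero M P)" by (rule inf0[OF cls_Linf[OF Wb]])
  then have "QS (\<lambda>\<omega>. W \<omega> \<le> 0)"
    unfolding L_zero_cls using L_le_cls[OF bounded_rv_measurable[OF Wb]] by simp
  from QS_AE[OF Q this] AE_support[OF Q S(1,2)] have "AE \<omega> in Q. Z \<omega> \<le> 0"
    by eventually_elim (simp add: W_def)
  then have "integral\<^sup>L Q Z \<le> integral\<^sup>L Q (\<lambda>_. 0)"
    by (intro integral_mono_AE integrable_prob[OF Q] Zb bounded_rv_const)
  moreover have "(\<lambda>n. E (k n)) \<longlonglongrightarrow> integral\<^sup>L Q Z"
    unfolding E_def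
  proof (rule integral_dominated_convergence[where w="y (k 0)"])
    have "AE \<omega> in Q. \<forall>n. y (k (Suc n)) \<omega> \<le> y (k n) \<omega>"
      unfolding AE_all_countable by (intro allI QS_AE[OF Q] ymono k)
    then have dec: "AE \<omega> in Q. decseq (\<lambda>n. y (k n) \<omega>)" by (simp add: decseq_Suc_iff)
    from dec show "AE \<omega> in Q. (\<lambda>n. y (k n) \<omega>) \<longlonglongrightarrow> Z \<omega>"
      unfolding Z_def by eventually_elim (rule LIMSEQ_decseq_INF[OF bd])
    from dec show "AE \<omega> in Q. norm (y (k n) \<omega>) \<le> y (k 0) \<omega>" for n
      by eventually_elim (use y(3)[OF k(1)] in \<open>auto dest: decseqD[of _ 0 n]\<close>)
  qed (use integrable_prob[OF Q] meas_prob[OF Q] ym[OF k(1)] y(1)[OF k(1)] bounded_rv_measurable[OF Zb] in auto)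
  moreover have "l \<le> E (k n)" for n by (rule l_le[OF k(1)])
  ultimately have "l \<le> 0" using LIMSEQ_le_const[of "\<lambda>n. E (k n)" "integral\<^sup>L Q Z" l] by auto
  then show False using l_e e by linarith
qed

text \<open>The Fatou property passes to suprema of functionals, so a single Q with finite \<beta> Q
  suffices. For it, the loss along the net is at most the expectation of the dominating decreasing
  net, which becomes arbitrarily small. The index type is left arbitrary.\<close>

lemma F3_imp_fatou:
  assumes F3: "property_F3 M P \<rho>"
  shows "fatou_for_nets_over TYPE('i) M P \<rho>"
  unfolding fatou_for_nets_over_def
proof (intro allI impI)
  fix I :: "'i set" and le Xs X
  assume dir: "directed I le" and Xs: "\<forall>i\<in>I. Xs i \<in> Linf" and X: "X \<in> Linf"
    and conv: "order_converges M P I le Xs X"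
  obtain Ys where Ys: "\<forall>i\<in>I. Ys i \<in> L_infty M P"
    "\<forall>i\<in>I. \<forall>j\<in>I. le i j \<longrightarrow> L_le M P (Ys j) (Ys i)"
    "\<forall>i\<in>I. L_le M P (L_zero M P) (Ys i)"
    "\<forall>Z\<in>L_infty M P. (\<forall>i\<in>I. L_le M P Z (Ys i)) \<longrightarrow> L_le M P Z (L_zero M P)"
    "\<forall>i\<in>I. L_le M P (L_abs M P (L_diff M P (Xs i) X)) (Ys i)"
    using conv unfolding order_converges_def by (elim exE conjE)
  from F3 obtain \<beta> b where b: "\<forall>Q\<in>sca_prob M P. ereal b \<le> \<beta> Q"
    and rho: "\<forall>X\<in>Linf. ereal (\<rho> X) = (SUP Q\<in>sca_prob M P. ereal (integral\<^sup>L Q (rep X)) - \<beta> Q)"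
    unfolding property_F3_def by (elim exE conjE)
  show "ereal (\<rho> X) \<le> net_liminf I le (\<lambda>i. \<rho> (Xs i))"
    unfolding rho[rule_format, OF X]
  proof (rule SUP_least)
    fix Q assume Q: "Q \<in> sca_prob M P"
    show "ereal (integral\<^sup>L Q (rep X)) - \<beta> Q \<le> net_liminf I le (\<lambda>i. \<rho> (Xs i))"
    proof (cases "\<beta> Q")
      case PInf then show ?thesis by simp
    next
      case MInf then show ?thesis using b Q by force
    next
      case (real c)
      show ?thesis
      proof (rule ereal_le_epsilon2)
        fix e :: real assume e: "e > 0"
        obtain i where i: "i \<in> I" "integral\<^sup>L Q (rep (Ys i)) < e"
          using supported_prob_order_continuous[OF Q dir, of Ys e] Ys(1-4) e by blast
        have "ereal (integral\<^sup>L Q (rep X) - c - e) \<le> (INF j\<in>{j\<in>I. le i j}. ereal (\<rho> (Xs j)))"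
        proof (rule INF_greatest)
          fix j assume "j \<in> {j\<in>I. le i j}"
          then have j: "j \<in> I" "le i j" by auto
          from X obtain g where g: "g \<in> bounded_rv M" "X = cls g" by (rule LinfE)
          from Xs[rule_format, OF j(1)] obtain f where f: "f \<in> bounded_rv M" "Xs j = cls f" by (rule LinfE)
          from Ys(1)[rule_format, OF j(1)] obtain h where h: "h \<in> bounded_rv M" "Ys j = cls h" by (rule LinfE)
          from Ys(1)[rule_format, OF i(1)] obtain h' where h': "h' \<in> bounded_rv M" "Ys i = cls h'" by (rule LinfE)
          note m = bounded_rv_measurable[OF f(1)] bounded_rv_measurable[OF g(1)] bounded_rv_measurable[OF h(1)] bounded_rv_measurable[OF h'(1)]
          have "L_le M P (cls (\<lambda>\<omega>. \<bar>f \<omega> - g \<omega>\<bar>)) (cls h)"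
            using Ys(5)[rule_format, OF j(1)] m unfolding f(2) g(2) h(2) by (simp add: L_diff_cls L_abs_cls)
          then have "QS (\<lambda>\<omega>. \<bar>f \<omega> - g \<omega>\<bar> \<le> h \<omega>)" using m by (subst (asm) L_le_cls) auto
          moreover have "QS (\<lambda>\<omega>. h \<omega> \<le> h' \<omega>)"
            using Ys(2)[rule_format, OF i(1) j] m unfolding h(2) h'(2) by (simp add: L_le_cls)
          ultimately have "QS (\<lambda>\<omega>. g \<omega> - f \<omega> \<le> h' \<omega>)" by (rule QS_mp2) linarith
          then have "integral\<^sup>L Q (\<lambda>\<omega>. g \<omega> - f \<omega>) \<le> integral\<^sup>L Q h'"
            by (intro integral_mono_QS[OF Q] bounded_rv_diff f g h')
          then have "integral\<^sup>L Q g - integral\<^sup>L Q f < e"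
            using i(2) integral_rep[OF Q h'(1)] integrable_prob[OF Q f(1)] integrable_prob[OF Q g(1)]
            unfolding h'(2) by simp
          then have "integral\<^sup>L Q (rep X) - c - e \<le> integral\<^sup>L Q (rep (Xs j)) - c"
            using integral_rep[OF Q f(1)] integral_rep[OF Q g(1)] unfolding f(2) g(2) by simp
          also have "ereal (integral\<^sup>L Q (rep (Xs j)) - c) \<le> ereal (\<rho> (Xs j))"
            using rho[rule_format, OF Xs[rule_format, OF j(1)]] real
            by (auto intro: SUP_upper2[OF Q])
          finally show "ereal (integral\<^sup>L Q (rep X) - c - e) \<le> ereal (\<rho> (Xs j))" by simp
        qed
        also have "\<dots> \<le> net_liminf I le (\<lambda>i. \<rho> (Xs i))"
          unfolding net_liminf_def using i(1) by (rule SUP_upper)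
        finally have *: "ereal (integral\<^sup>L Q (rep X) - c - e) \<le> net_liminf I le (\<lambda>i. \<rho> (Xs i))" .
        have "ereal (integral\<^sup>L Q (rep X)) - \<beta> Q = ereal (integral\<^sup>L Q (rep X) - c - e) + ereal e"
          using real by simp
        also have "\<dots> \<le> net_liminf I le (\<lambda>i. \<rho> (Xs i)) + ereal e" by (rule add_right_mono[OF *])
        finally show "ereal (integral\<^sup>L Q (rep X)) - \<beta> Q \<le> net_liminf I le (\<lambda>i. \<rho> (Xs i)) + ereal e" .
      qed
    qed
  qed
qed

section \<open>Expectations under supported probabilities as test risk measures\<close>

lemma expectation_risk_measure:
  assumes Q: "Q \<in> sca_prob M P"
  shows "convex_risk_measure M P (\<lambda>X. integral\<^sup>L Q (rep X))"
  unfolding convex_risk_measure_def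
proof (intro conjI ballI impI allI)
  note Qp = sca_probD[OF Q]
  interpret Q: prob_space Q by (rule Qp(1))
  fix X assume "X \<in> Linf"
  then obtain f where f: "f \<in> bounded_rv M" "X = cls f" by (rule LinfE)
  note fm = bounded_rv_measurable[OF f(1)]
  show "integral\<^sup>L Q (rep (L_add M P X (L_scale M P m (L_ind M P (space M))))) = integral\<^sup>L Q (rep X) + m" for m
  proof -
    have "L_add M P X (L_scale M P m (L_ind M P (space M))) = cls (\<lambda>\<omega>. f \<omega> + m)"
      unfolding f(2) scale_one_cls using fm by (simp add: L_add_cls)
    then show ?thesis
      using integral_rep[OF Q bounded_rv_add[OF f(1) bounded_rv_const]] integral_rep[OF Q f(1)] integrable_prob[OF Q f(1)]
      by (simp add: f(2) Q.prob_space)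
  qed
  fix Y assume "Y \<in> Linf"
  then obtain g where g: "g \<in> bounded_rv M" "Y = cls g" by (rule LinfE)
  note gm = bounded_rv_measurable[OF g(1)]
  show "integral\<^sup>L Q (rep X) \<le> integral\<^sup>L Q (rep Y)" if "L_le M P X Y"
    using that L_le_cls[OF fm gm] integral_mono_QS[OF Q f(1) g(1)] integral_rep[OF Q f(1)] integral_rep[OF Q g(1)]
    unfolding f(2) g(2) by simp
  show "integral\<^sup>L Q (rep (L_add M P (L_scale M P t X) (L_scale M P (1 - t) Y))) \<le> t * integral\<^sup>L Q (rep X) + (1 - t) * integral\<^sup>L Q (rep Y)" for t
  proof -
    have "L_add M P (L_scale M P t X) (L_scale M P (1 - t) Y) = cls (\<lambda>\<omega>. t * f \<omega> + (1 - t) * g \<omega>)"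
      unfolding f(2) g(2) using fm gm by (simp add: L_add_cls L_scale_cls)
    moreover have "(\<lambda>\<omega>. t * f \<omega> + (1 - t) * g \<omega>) \<in> bounded_rv M"
      by (intro bounded_rv_add bounded_rv_cmult f g)
    ultimately show ?thesis
      using integral_rep[OF Q f(1)] integral_rep[OF Q g(1)] integrable_prob[OF Q f(1)] integrable_prob[OF Q g(1)]
      by (simp add: integral_rep[OF Q] f(2) g(2))
  qed
qed

lemma expectation_F3:
  assumes Q: "Q \<in> sca_prob M P" shows "property_F3 M P (\<lambda>X. integral\<^sup>L Q (rep X))"
  unfolding property_F3_def
proof (intro exI[of _ "\<lambda>R. if R = Q then 0 else \<infinity>"] conjI ballI)
  show "\<exists>b. \<forall>R\<in>sca_prob M P. ereal b \<le> (if R = Q then 0 else \<infinity>)" by (intro exI[of _ 0]) auto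
  show "\<exists>R\<in>sca_prob M P. (if R = Q then 0 else \<infinity>) \<noteq> (\<infinity> :: ereal)" using Q by (intro bexI[of _ Q]) auto
  fix X
  show "ereal (integral\<^sup>L Q (rep X)) = (SUP R\<in>sca_prob M P. ereal (integral\<^sup>L R (rep X)) - (if R = Q then 0 else \<infinity>))"
    by (rule antisym) (auto intro!: SUP_upper2[OF Q] SUP_least)
qed

text \<open>A linear functional can only dominate a shifted linear functional if the two agree.\<close>

lemma expectation_F4_imp_mem:
  assumes Q: "Q \<in> sca_prob M P" and V: "V \<subseteq> ba_c M P" and F4: "property_F4 M P V (\<lambda>X. integral\<^sup>L Q (rep X))"
  shows "measure Q \<in> V"
proof -
  from F4 obtain \<gamma> b \<mu> where b: "\<forall>\<mu>\<in>V. ereal b \<le> \<gamma> \<mu>" and mu: "\<mu> \<in> V" "\<gamma> \<mu> \<noteq> \<infinity>"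
    and rho: "\<forall>X\<in>Linf. ereal (integral\<^sup>L Q (rep X)) = (SUP \<mu>\<in>V. ereal (fa_integral M \<mu> X) - \<gamma> \<mu>)"
    unfolding property_F4_def by (elim exE conjE bexE)
  note muba = subsetD[OF V mu(1)]
  obtain c where c: "\<gamma> \<mu> = ereal c" using b mu by (cases "\<gamma> \<mu>") force+
  have le: "fa_integral M \<mu> (cls f) - c \<le> integral\<^sup>L Q f" if f: "f \<in> bounded_rv M" for f
  proof -
    have "ereal (fa_integral M \<mu> (cls f)) - \<gamma> \<mu> \<le> ereal (integral\<^sup>L Q (rep (cls f)))"
      unfolding rho[rule_format, OF cls_Linf[OF f]] by (rule SUP_upper[OF mu(1)])
    then show ?thesis using integral_rep[OF Q f] by (simp add: c)
  qed
  have "\<mu> A = measure Q A" for A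
  proof (cases "A \<in> sets M")
    case True
    define d where "d = \<mu> A - measure Q A"
    have "t * d \<le> c" for t
    proof -
      have "fa_integral M \<mu> (cls (\<lambda>\<omega>. t * indicator A \<omega>)) = t * \<mu> A"
        using fa_integral_lincomb[OF muba bounded_rv_indicator[OF True] bounded_rv_indicator[OF True], of t 0]
          fa_integral_indicator[OF muba True] by simp
      moreover have "integral\<^sup>L Q (\<lambda>\<omega>. t * indicator A \<omega>) = t * measure Q A"
        using True sca_probD(2,3)[OF Q] sets.Int_space_eq2[OF True] by simp
      moreover note le[OF bounded_rv_cmult[OF bounded_rv_indicator[OF True]], of t]
      ultimately have "t * \<mu> A - c \<le> t * measure Q A" by (simp only:)
      then show ?thesis by (simp add: d_def algebra_simps)
    qed
    \<comment> \<open>For nonzero d this choice of t would give |c| + 1 \<le> c.\<close>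
    from this[of "(\<bar>c\<bar> + 1) / d"] have "d = 0" by (cases "d = 0") auto
    then show ?thesis by (simp add: d_def)
  next
    case False
    then show ?thesis using ba_zero[OF ba_cD[OF muba] False] sca_probD(2)[OF Q] by (simp add: measure_notin_sets)
  qed
  then have "\<mu> = measure Q" by (rule ext)
  then show ?thesis using mu(1) by simp
qed

end

section \<open>Weak* compactness and preduals\<close>

text \<open>Tychonoff's theorem, moved from the abstract product topology to the topology that the
  function type carries.\<close>

lemma compact_function_box:
  fixes S :: "'v \<Rightarrow> real set"
  assumes "\<And>v. compact (S v)" shows "compact {\<phi>. \<forall>v. \<phi> v \<in> S v}"
proof -
  have "compactin (product_topology (\<lambda>_. euclidean) UNIV) (PiE UNIV S)"
    unfolding compactin_PiE using assms by simp
  moreover have "PiE UNIV S = {\<phi>. \<forall>v. \<phi> v \<in> S v}" by (auto simp: PiE_def Pi_def)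
  ultimately show ?thesis by (simp add: euclidean_product_topology)
qed

lemma closed_eval:
  fixes T :: "real set" assumes "closed T" shows "closed {\<phi> :: 'v \<Rightarrow> real. \<phi> v \<in> T}"
  using closed_vimage[OF assms continuous_on_product_coordinates[of v]] by (simp add: vimage_def)

lemma continuous_on_eval [continuous_intros]: "continuous_on A (\<lambda>\<phi> :: 'v \<Rightarrow> real. \<phi> v)"
  by (rule continuous_on_subset[OF continuous_on_product_coordinates]) simp

text \<open>Instantiated twice: with the given predual V for part (1), and with
  \<open>sca_c M P\<close> itself for part (2), where the duality is the assumption.\<close>

locale qs_predual = qs_space M P for M :: "'a measure" and P :: "'a measure set" +
  fixes V :: "('a set \<Rightarrow> real) set"
  assumes V_subset: "V \<subseteq> ba_c M P" and V_subspace: "linear_subspace V"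
    and V_dual: "dual_is_L_infty M P V"
begin

lemma V_zero: "(\<lambda>_. 0) \<in> V" using V_subspace by (simp add: linear_subspace_def)
lemma V_add: "\<mu> \<in> V \<Longrightarrow> \<nu> \<in> V \<Longrightarrow> (\<lambda>A. \<mu> A + \<nu> A) \<in> V" using V_subspace by (simp add: linear_subspace_def)
lemma V_scale: "\<mu> \<in> V \<Longrightarrow> (\<lambda>A. a * \<mu> A) \<in> V" using V_subspace by (simp add: linear_subspace_def)
lemma V_lincomb: "\<mu> \<in> V \<Longrightarrow> \<nu> \<in> V \<Longrightarrow> (\<lambda>A. a * \<mu> A + b * \<nu> A) \<in> V" by (intro V_add V_scale)
lemmas V_ba_c = subsetD[OF V_subset]
lemmas V_ba = ba_cD[OF V_ba_c]

abbreviation pr :: "('a \<Rightarrow> real) set \<Rightarrow> ('a set \<Rightarrow> real) \<Rightarrow> real" where "pr \<equiv> pairing M V"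

lemma pr_apply: "\<mu> \<in> V \<Longrightarrow> pr X \<mu> = fa_integral M \<mu> X" by (simp add: pairing_def)

lemma pr_lincomb:
  assumes "f \<in> bounded_rv M" "g \<in> bounded_rv M" "\<mu> \<in> V"
  shows "pr (cls (\<lambda>\<omega>. a * f \<omega> + b * g \<omega>)) \<mu> = a * pr (cls f) \<mu> + b * pr (cls g) \<mu>"
  using fa_integral_lincomb[OF V_ba_c[OF assms(3)] assms(1,2)] assms(3) by (simp add: pr_apply)

lemma pr_diff:
  assumes "f \<in> bounded_rv M" "g \<in> bounded_rv M" "\<mu> \<in> V"
  shows "pr (cls (\<lambda>\<omega>. f \<omega> - g \<omega>)) \<mu> = pr (cls f) \<mu> - pr (cls g) \<mu>"
  using pr_lincomb[OF assms, of 1 "-1"] by simp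

lemma pr_bound:
  assumes "f \<in> bounded_rv M" "\<mu> \<in> V" shows "\<bar>pr (cls f) \<mu>\<bar> \<le> Lnorm (cls f) * TV M \<mu>"
proof -
  have "QS (\<lambda>\<omega>. \<bar>f \<omega>\<bar> \<le> Lnorm (cls f))" using Lnorm_le_iff[OF assms(1) Lnorm_nonneg[OF assms(1)]] by simp
  from fa_integral_bound[OF V_ba_c[OF assms(2)] assms(1) this Lnorm_nonneg[OF assms(1)]]
  show ?thesis using assms(2) by (simp add: pr_apply)
qed

lemma pr_TV_dual: "X \<in> Linf \<Longrightarrow> pr X \<in> TV_dual M V"
  using V_dual bij_betwE by (auto simp: dual_is_L_infty_def)

lemma pr_norm: "X \<in> Linf \<Longrightarrow> Sup {\<bar>pr X \<mu>\<bar> | \<mu>. \<mu> \<in> V \<and> TV M \<mu> \<le> 1} = Lnorm X"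
  using V_dual by (simp add: dual_is_L_infty_def TV_dual_norm_def)

lemma TV_zero: "TV M (\<lambda>_. 0) = 0"
  using TV_scale[OF V_ba[OF V_zero], of 0] TV_nonneg[OF V_ba[OF V_zero]] by simp

lemma pr_norm_nonempty: "{\<bar>pr X \<mu>\<bar> | \<mu>. \<mu> \<in> V \<and> TV M \<mu> \<le> 1} \<noteq> {}"
proof -
  have "\<bar>pr X (\<lambda>_. 0)\<bar> \<in> {\<bar>pr X \<mu>\<bar> | \<mu>. \<mu> \<in> V \<and> TV M \<mu> \<le> 1}"
    by (intro CollectI exI[of _ "\<lambda>_. 0"] conjI refl V_zero) (simp add: TV_zero)
  then show ?thesis by blast
qed

lemma Lnorm_le_pr:
  assumes X: "X \<in> Linf" and le: "\<And>\<mu>. \<mu> \<in> V \<Longrightarrow> \<bar>pr X \<mu>\<bar> \<le> c * TV M \<mu>" and c: "0 \<le> c"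
  shows "Lnorm X \<le> c"
  unfolding pr_norm[OF X, symmetric]
proof (rule cSup_least[OF pr_norm_nonempty])
  fix x assume "x \<in> {\<bar>pr X \<mu>\<bar> | \<mu>. \<mu> \<in> V \<and> TV M \<mu> \<le> 1}"
  then obtain \<mu> where mu: "x = \<bar>pr X \<mu>\<bar>" "\<mu> \<in> V" "TV M \<mu> \<le> 1" by blast
  have "c * TV M \<mu> \<le> c * 1" using mu(3) c by (rule mult_left_mono)
  then show "x \<le> c" using le[OF mu(2)] mu(1) by linarith
qed

text \<open>The unit ball of V is symmetric, so the dual norm is a supremum of pairings without
  absolute values. This supplies the directions used later to correct separating elements.\<close>

lemma norming:
  assumes X: "X \<in> Linf" and r: "r < Lnorm X"
  shows "\<exists>z\<in>V. TV M z \<le> 1 \<and> r < pr X z"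
proof -
  from less_cSupD[OF pr_norm_nonempty r[folded pr_norm[OF X]]]
  obtain z where z: "z \<in> V" "TV M z \<le> 1" "r < \<bar>pr X z\<bar>" by blast
  show ?thesis
  proof (cases "pr X z \<ge> 0")
    case True then show ?thesis using z by auto
  next
    case False
    have "pr X (\<lambda>A. (- 1) * z A) = (- 1) * pr X z"
      using pr_TV_dual[OF X] z(1) unfolding TV_dual_def by blast
    moreover have "TV M (\<lambda>A. (- 1) * z A) \<le> 1" using TV_scale[OF V_ba[OF z(1)], of "-1"] z(2) by simp
    ultimately show ?thesis using V_scale[OF z(1), of "-1"] z(3) False by force
  qed
qed

lemma ex_separating:
  assumes "f \<in> bounded_rv M" "\<not> QS (\<lambda>\<omega>. f \<omega> = 0)" shows "\<exists>z\<in>V. pr (cls f) z \<noteq> 0"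
proof -
  have "\<not> Lnorm (cls f) \<le> 0" using Lnorm_le_iff[OF assms(1), of 0] assms(2) by simp
  then show ?thesis using norming[OF cls_Linf[OF assms(1)], of 0] by force
qed

definition dual_ball :: "real \<Rightarrow> (('a set \<Rightarrow> real) \<Rightarrow> real) set" where
  "dual_ball c = pr ` {X \<in> Linf. Lnorm X \<le> c}"

text \<open>Because the pairing is onto the dual and isometric, the image of a ball is cut out by
  conditions on single values: linearity, and a box. The box is {\<open>undefined\<close>} outside
  V, so membership in \<open>extensional\<close> is a closed condition too.\<close>

lemma dual_ball_eq:
  assumes c: "0 \<le> c"
  shows "dual_ball c = {\<phi>. (\<forall>\<mu>\<in>V. \<forall>\<nu>\<in>V. \<phi> (\<lambda>A. \<mu> A + \<nu> A) = \<phi> \<mu> + \<phi> \<nu>) \<and>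
     (\<forall>a. \<forall>\<mu>\<in>V. \<phi> (\<lambda>A. a * \<mu> A) = a * \<phi> \<mu>) \<and>
     (\<forall>\<mu>. \<phi> \<mu> \<in> (if \<mu> \<in> V then {- (c * TV M \<mu>)..c * TV M \<mu>} else {undefined}))}"
  (is "_ = ?R")
proof (intro equalityI subsetI)
  fix \<phi> assume "\<phi> \<in> dual_ball c"
  then obtain X where X: "X \<in> Linf" "Lnorm X \<le> c" "\<phi> = pr X" by (auto simp: dual_ball_def)
  from X(1) obtain f where f: "f \<in> bounded_rv M" "X = cls f" by (rule LinfE)
  have "\<phi> \<mu> \<in> (if \<mu> \<in> V then {- (c * TV M \<mu>)..c * TV M \<mu>} else {undefined})" for \<mu>
  proof (cases "\<mu> \<in> V")
    case True
    have "\<bar>pr X \<mu>\<bar> \<le> Lnorm X * TV M \<mu>" using pr_bound[OF f(1) True] f(2) by simp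
    also have "\<dots> \<le> c * TV M \<mu>" by (rule mult_right_mono[OF X(2) TV_nonneg[OF V_ba[OF True]]])
    finally show ?thesis using True X(3) by (simp add: abs_le_iff)
  qed (simp add: X(3) pairing_def)
  then show "\<phi> \<in> ?R" using pr_TV_dual[OF X(1)] unfolding X(3) TV_dual_def by blast
next
  fix \<phi> assume R: "\<phi> \<in> ?R"
  then have bd: "\<And>\<mu>. \<phi> \<mu> \<in> (if \<mu> \<in> V then {- (c * TV M \<mu>)..c * TV M \<mu>} else {undefined})" by blast
  have le: "\<bar>\<phi> \<mu>\<bar> \<le> c * TV M \<mu>" if "\<mu> \<in> V" for \<mu> using bd[of \<mu>] that by (simp add: abs_le_iff)
  have "\<phi> \<mu> = undefined" if "\<mu> \<notin> V" for \<mu> using bd[of \<mu>] that by simp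
  then have "\<phi> \<in> extensional V" unfolding extensional_def by blast
  then have "\<phi> \<in> TV_dual M V" using R le unfolding TV_dual_def by blast
  moreover have "pr ` Linf = TV_dual M V" using V_dual by (simp add: dual_is_L_infty_def bij_betw_def)
  ultimately obtain X where X: "X \<in> Linf" "\<phi> = pr X" by blast
  have "Lnorm X \<le> c" by (rule Lnorm_le_pr[OF X(1) _ c]) (use le X(2) in simp)
  then show "\<phi> \<in> dual_ball c" using X by (auto simp: dual_ball_def)
qed

text \<open>Banach--Alaoglu: the topology of pointwise convergence on functionals is the weak* topology.\<close>

lemma dual_ball_compact:
  assumes c: "0 \<le> c" shows "compact (dual_ball c)"
proof -
  define B where "B = {\<phi> :: ('a set \<Rightarrow> real) \<Rightarrow> real. \<forall>\<mu>. \<phi> \<mu> \<in> (if \<mu> \<in> V then {- (c * TV M \<mu>)..c * TV M \<mu>} else {undefined})}"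
  define C1 where "C1 \<mu> \<nu> = {\<phi> :: ('a set \<Rightarrow> real) \<Rightarrow> real. \<phi> (\<lambda>A. \<mu> A + \<nu> A) = \<phi> \<mu> + \<phi> \<nu>}" for \<mu> \<nu>
  define C2 where "C2 a \<mu> = {\<phi> :: ('a set \<Rightarrow> real) \<Rightarrow> real. \<phi> (\<lambda>A. a * \<mu> A) = a * \<phi> \<mu>}" for a \<mu>
  have "compact B" unfolding B_def by (rule compact_function_box) auto
  moreover have "closed (C1 \<mu> \<nu>)" for \<mu> \<nu>
    unfolding C1_def by (intro closed_Collect_eq continuous_intros)
  moreover have "closed (C2 a \<mu>)" for a \<mu>
    unfolding C2_def by (intro closed_Collect_eq continuous_intros)
  ultimately have "compact (B \<inter> ((\<Inter>\<mu>\<in>V. \<Inter>\<nu>\<in>V. C1 \<mu> \<nu>) \<inter> (\<Inter>a. \<Inter>\<mu>\<in>V. C2 a \<mu>)))"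
    by (intro compact_Int_closed closed_Int closed_INT ballI)
  moreover have "B \<inter> ((\<Inter>\<mu>\<in>V. \<Inter>\<nu>\<in>V. C1 \<mu> \<nu>) \<inter> (\<Inter>a. \<Inter>\<mu>\<in>V. C2 a \<mu>)) = dual_ball c"
    unfolding dual_ball_eq[OF c] B_def C1_def C2_def by blast
  ultimately show ?thesis by simp
qed

text \<open>Order intervals of length one are balls of radius one half, hence weak* closed.  This is how
  weak* compactness produces order suprema.\<close>

definition half_ball :: "('a \<Rightarrow> real) \<Rightarrow> (('a set \<Rightarrow> real) \<Rightarrow> real) set" where
  "half_ball g = {\<phi>. \<forall>\<nu>\<in>V. \<bar>\<phi> \<nu> - pr (cls g) \<nu>\<bar> \<le> 1 / 2 * TV M \<nu>}"

lemma half_ball_closed: "closed (half_ball g)"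
proof -
  have "half_ball g = (\<Inter>\<nu>\<in>V. {\<phi>. \<bar>\<phi> \<nu> - pr (cls g) \<nu>\<bar> \<le> 1 / 2 * TV M \<nu>})" by (auto simp: half_ball_def)
  moreover have "closed {\<phi> :: ('a set \<Rightarrow> real) \<Rightarrow> real. \<bar>\<phi> \<nu> - pr (cls g) \<nu>\<bar> \<le> 1 / 2 * TV M \<nu>}" for \<nu>
    by (intro closed_Collect_le continuous_intros)
  ultimately show ?thesis by (simp add: closed_INT)
qed

text \<open>Isometry in both directions: the bound against all elements of V is the norm bound on f
  - g, which is a quasi-sure bound.\<close>

lemma half_ball_iff:
  assumes f: "f \<in> bounded_rv M" and g: "g \<in> bounded_rv M"
  shows "pr (cls f) \<in> half_ball g \<longleftrightarrow> QS (\<lambda>\<omega>. \<bar>f \<omega> - g \<omega>\<bar> \<le> 1 / 2)"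
proof -
  note fg = bounded_rv_diff[OF f g]
  have eq: "pr (cls f) \<in> half_ball g \<longleftrightarrow> (\<forall>\<nu>\<in>V. \<bar>pr (cls (\<lambda>\<omega>. f \<omega> - g \<omega>)) \<nu>\<bar> \<le> 1 / 2 * TV M \<nu>)"
    using pr_diff[OF f g] by (simp add: half_ball_def)
  have "QS (\<lambda>\<omega>. \<bar>f \<omega> - g \<omega>\<bar> \<le> 1 / 2) \<longleftrightarrow> Lnorm (cls (\<lambda>\<omega>. f \<omega> - g \<omega>)) \<le> 1 / 2"
    using Lnorm_le_iff[OF fg, of "1 / 2"] by simp
  also have "\<dots> \<longleftrightarrow> (\<forall>\<nu>\<in>V. \<bar>pr (cls (\<lambda>\<omega>. f \<omega> - g \<omega>)) \<nu>\<bar> \<le> 1 / 2 * TV M \<nu>)"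
  proof
    assume L: "Lnorm (cls (\<lambda>\<omega>. f \<omega> - g \<omega>)) \<le> 1 / 2"
    show "\<forall>\<nu>\<in>V. \<bar>pr (cls (\<lambda>\<omega>. f \<omega> - g \<omega>)) \<nu>\<bar> \<le> 1 / 2 * TV M \<nu>"
    proof
      fix \<nu> assume nu: "\<nu> \<in> V"
      have "\<bar>pr (cls (\<lambda>\<omega>. f \<omega> - g \<omega>)) \<nu>\<bar> \<le> Lnorm (cls (\<lambda>\<omega>. f \<omega> - g \<omega>)) * TV M \<nu>"
        by (rule pr_bound[OF fg nu])
      also have "\<dots> \<le> 1 / 2 * TV M \<nu>" by (rule mult_right_mono[OF L TV_nonneg[OF V_ba[OF nu]]])
      finally show "\<bar>pr (cls (\<lambda>\<omega>. f \<omega> - g \<omega>)) \<nu>\<bar> \<le> 1 / 2 * TV M \<nu>" .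
    qed
  next
    assume *: "\<forall>\<nu>\<in>V. \<bar>pr (cls (\<lambda>\<omega>. f \<omega> - g \<omega>)) \<nu>\<bar> \<le> 1 / 2 * TV M \<nu>"
    show "Lnorm (cls (\<lambda>\<omega>. f \<omega> - g \<omega>)) \<le> 1 / 2"
      by (rule Lnorm_le_pr[OF cls_Linf[OF fg]]) (use * in auto)
  qed
  finally show ?thesis using eq by blast
qed

text \<open>Any finitely many members lie in some member C, whose indicator is above their
  indicators, below those of all upper bounds B', and pairs with \<mu> into T. All these conditions
  are weak* closed, so compactness gives one class f satisfying them all. The set T carries a closed
  condition on \<mu> from the family to its least upper bound.\<close>

lemma ex_lub_event:
  assumes A: "\<A> \<subseteq> sets M" "\<A> \<noteq> {}" and dir: "\<And>A B. A \<in> \<A> \<Longrightarrow> B \<in> \<A> \<Longrightarrow> \<exists>C\<in>\<A>. A \<union> B \<subseteq> C"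
    and T: "closed T" and mu: "\<mu> \<in> V" "\<And>A. A \<in> \<A> \<Longrightarrow> \<mu> A \<in> T"
  shows "\<exists>B\<in>sets M. (\<forall>A\<in>\<A>. null (A - B)) \<and>
    (\<forall>B'\<in>sets M. (\<forall>A\<in>\<A>. null (A - B')) \<longrightarrow> null (B - B')) \<and> \<mu> B \<in> T"
proof -
  define U where "U = {B'\<in>sets M. \<forall>A\<in>\<A>. null (A - B')}"
  \<comment> \<open>These are the centers of the intervals [1_A, 1_A + 1] and, for
    \<open>g'\<close>, [1_B' - 1, 1_B']. One end of each is the desired inequality; the other holds
    for every indicator function.\<close>
  define g where "g A = (\<lambda>\<omega>. indicator A \<omega> + 1 / 2 :: real)" for A :: "'a set"
  define g' where "g' A = (\<lambda>\<omega>. indicator A \<omega> - 1 / 2 :: real)" for A :: "'a set"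
  have gb: "g A \<in> bounded_rv M" "g' A \<in> bounded_rv M" if "A \<in> sets M" for A
    unfolding g_def g'_def by (intro bounded_rv_add bounded_rv_diff bounded_rv_indicator that bounded_rv_const)+
  define F where "F A = half_ball (g A) \<inter> ((\<Inter>B'\<in>U. half_ball (g' B')) \<inter> {\<phi>. \<phi> \<mu> \<in> T})" for A
  have Am: "A \<in> sets M" if "A \<in> \<A>" for A using that A(1) by blast
  have "dual_ball 1 \<inter> (\<Inter>A\<in>\<A>. F A) \<noteq> {}"
  proof (rule compact_imp_fip_image)
    show "compact (dual_ball 1)" by (rule dual_ball_compact) simp
    show "closed (F A)" for A unfolding F_def by (intro closed_Int closed_INT ballI half_ball_closed closed_eval T)
    fix I' assume fin: "finite I'" and sub: "I' \<subseteq> \<A>"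
    have "\<exists>C\<in>\<A>. \<forall>A\<in>I'. A \<subseteq> C" using fin sub
    proof (induction I')
      case empty then show ?case using A(2) by blast
    next
      case (insert A I')
      then obtain C where "C \<in> \<A>" "\<forall>A\<in>I'. A \<subseteq> C" by blast
      moreover from this insert.prems obtain D where "D \<in> \<A>" "A \<union> C \<subseteq> D" using dir by (meson insert_subset)
      ultimately show ?case by blast
    qed
    then obtain C where C: "C \<in> \<A>" "\<And>A. A \<in> I' \<Longrightarrow> A \<subseteq> C" by blast
    note Ci = bounded_rv_indicator[OF Am[OF C(1)]]
    have "pr (cls (indicator C)) \<in> dual_ball 1"
      unfolding dual_ball_def using Lnorm_le_iff[OF Ci, of 1] cls_Linf[OF Ci]
      by (intro imageI CollectI conjI) (auto intro: QS_always)
    moreover have "pr (cls (indicator C)) \<in> F A" if "A \<in> I'" for A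
    proof -
      have "pr (cls (indicator C)) \<in> half_ball (g A)"
        unfolding half_ball_iff[OF Ci gb(1)[OF Am[OF subsetD[OF sub that]]]]
        by (rule QS_always) (use C(2)[OF that] in \<open>auto simp: g_def indicator_def\<close>)
      moreover have "pr (cls (indicator C)) \<in> half_ball (g' B')" if "B' \<in> U" for B'
      proof -
        have B': "B' \<in> sets M" "null (C - B')" using that C(1) by (auto simp: U_def)
        show ?thesis unfolding half_ball_iff[OF Ci gb(2)[OF B'(1)]]
          by (rule QS_I[OF B'(2)]) (auto simp: g'_def indicator_def)
      qed
      moreover have "pr (cls (indicator C)) \<mu> \<in> T"
        using fa_integral_indicator[OF V_ba_c[OF mu(1)] Am[OF C(1)]] mu C(1) by (simp add: pr_apply)
      ultimately show ?thesis unfolding F_def by blast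
    qed
    ultimately show "dual_ball 1 \<inter> (\<Inter>A\<in>I'. F A) \<noteq> {}" by blast
  qed
  then obtain \<phi> where phi: "\<phi> \<in> dual_ball 1" "\<And>A. A \<in> \<A> \<Longrightarrow> \<phi> \<in> F A" by blast
  then obtain X where X: "X \<in> Linf" "\<phi> = pr X" by (auto simp: dual_ball_def)
  from X(1) obtain f where f: "f \<in> bounded_rv M" "X = cls f" by (rule LinfE)
  note fm [measurable] = bounded_rv_measurable[OF f(1)]
  have lower: "QS (\<lambda>\<omega>. indicator A \<omega> \<le> f \<omega>)" if "A \<in> \<A>" for A
  proof -
    have "pr (cls f) \<in> half_ball (g A)" using phi(2)[OF that] X(2) f(2) by (simp add: F_def)
    then have "QS (\<lambda>\<omega>. \<bar>f \<omega> - g A \<omega>\<bar> \<le> 1 / 2)" using half_ball_iff[OF f(1) gb(1)[OF Am[OF that]]] by simp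
    then show ?thesis
    proof (rule QS_mp)
      fix \<omega> assume "\<bar>f \<omega> - g A \<omega>\<bar> \<le> 1 / 2"
      then have "- (1 / 2) \<le> f \<omega> - g A \<omega>" by (rule abs_le_D2[THEN minus_le_iff[THEN iffD1]])
      then show "indicator A \<omega> \<le> f \<omega>" by (simp add: g_def)
    qed
  qed
  obtain A0 where A0: "A0 \<in> \<A>" using A(2) by blast
  have upper: "QS (\<lambda>\<omega>. f \<omega> \<le> indicator B' \<omega>)" if "B' \<in> sets M" "\<forall>A\<in>\<A>. null (A - B')" for B'
  proof -
    have "pr (cls f) \<in> half_ball (g' B')" using phi(2)[OF A0] X(2) f(2) that by (simp add: F_def U_def)
    then have "QS (\<lambda>\<omega>. \<bar>f \<omega> - g' B' \<omega>\<bar> \<le> 1 / 2)" using half_ball_iff[OF f(1) gb(2)[OF that(1)]] by simp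
    then show ?thesis
    proof (rule QS_mp)
      fix \<omega> assume "\<bar>f \<omega> - g' B' \<omega>\<bar> \<le> 1 / 2"
      then have "f \<omega> - g' B' \<omega> \<le> 1 / 2" by (rule abs_le_D1)
      then show "f \<omega> \<le> indicator B' \<omega>" by (simp add: g'_def)
    qed
  qed
  \<comment> \<open>This B is itself an upper bound of the family, because f is at least 1 quasi
    surely on each member. Hence \<open>upper\<close> applies to B and squeezes f to the indicator
    of B.\<close>
  define B where "B = {\<omega>\<in>space M. 1 \<le> f \<omega>}"
  have B: "B \<in> sets M" unfolding B_def by measurable
  have AB: "null (A - B)" if "A \<in> \<A>" for A
  proof -
    note [measurable] = Am[OF that]
    have "null {\<omega>\<in>space M. \<not> indicator A \<omega> \<le> f \<omega>}" by (rule QS_null[OF lower[OF that]]) measurable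
    then show ?thesis
      by (rule null_subset) (use sets.sets_into_space[OF Am[OF that]] Am[OF that] B in \<open>auto simp: B_def\<close>)
  qed
  have least: "null (B - B')" if "B' \<in> sets M" "\<forall>A\<in>\<A>. null (A - B')" for B'
  proof -
    note [measurable] = that(1)
    have "null {\<omega>\<in>space M. \<not> f \<omega> \<le> indicator B' \<omega>}" by (rule QS_null[OF upper[OF that]]) measurable
    then show ?thesis by (rule null_subset) (use that B in \<open>auto simp: B_def\<close>)
  qed
  have "QS (\<lambda>\<omega>. f \<omega> \<le> indicator B \<omega>)" using upper[OF B] AB by blast
  then have "QS (\<lambda>\<omega>. indicator B \<omega> = f \<omega>)"
  proof (rule QS_mp2[OF _ lower[OF A0]])
    fix \<omega> assume w: "\<omega> \<in> space M" "f \<omega> \<le> indicator B \<omega>" "indicator A0 \<omega> \<le> f \<omega>"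
    have "0 \<le> f \<omega>" using w(3) indicator_pos_le[of A0 \<omega>] by (meson order_trans)
    then show "indicator B \<omega> = f \<omega>" using w(1,2) by (cases "\<omega> \<in> B") (auto simp: B_def)
  qed
  then have "cls (indicator B) = cls f"
    using bounded_rv_measurable[OF bounded_rv_indicator[OF B]] fm by (intro cls_eqI)
  then have "pr (cls f) \<mu> = \<mu> B" using fa_integral_indicator[OF V_ba_c[OF mu(1)] B] mu(1) by (simp add: pr_apply)
  moreover have "\<phi> \<mu> \<in> T" using phi(2)[OF A0] by (simp add: F_def)
  ultimately have "\<mu> B \<in> T" using X(2) f(2) by simp
  then show ?thesis using B AB least by blast
qed

lemma V_null_diff:
  assumes mu: "\<mu> \<in> V" and AB: "A \<in> sets M" "B \<in> sets M" "null (A - B)" "null (B - A)"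
  shows "\<mu> A = \<mu> B"
proof -
  have "\<mu> ((A \<inter> B) \<union> (A - B)) = \<mu> (A \<inter> B) + \<mu> (A - B)"
    using AB by (intro ba_additive[OF V_ba[OF mu]]) auto
  moreover have "\<mu> ((A \<inter> B) \<union> (B - A)) = \<mu> (A \<inter> B) + \<mu> (B - A)"
    using AB by (intro ba_additive[OF V_ba[OF mu]]) auto
  moreover have "\<mu> (A - B) = 0" "\<mu> (B - A) = 0"
    using ba_c_null[OF V_ba_c[OF mu] AB(3) null_sets[OF AB(3)] order_refl]
      ba_c_null[OF V_ba_c[OF mu] AB(4) null_sets[OF AB(4)] order_refl] by auto
  moreover have "(A \<inter> B) \<union> (A - B) = A" "(A \<inter> B) \<union> (B - A) = B" by blast+
  ultimately show ?thesis by simp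
qed

text \<open>If \<mu> (B n) failed to converge to \<mu> U, infinitely many B n would keep distance e
  from it. These B n are still directed with least upper bound U up to null events, and the closed
  condition of distance at least e would pass to \<mu> U itself.\<close>

lemma V_subset_ca:
  assumes mu: "\<mu> \<in> V" shows "\<mu> \<in> ca M"
proof (rule caI[OF V_ba[OF mu]])
  fix A :: "nat \<Rightarrow> 'a set" assume A: "range A \<subseteq> sets M" "disjoint_family A"
  define B where "B n = (\<Union>i<n. A i)" for n
  have Bm: "B n \<in> sets M" for n using A(1) by (auto simp: B_def)
  have Bmono: "B m \<subseteq> B n" if "m \<le> n" for m n using that by (force simp: B_def)
  define U where "U = (\<Union>n. A n)"
  have U: "U \<in> sets M" using A(1) by (auto simp: U_def)
  have UB: "U = (\<Union>n. B n)" by (auto simp: U_def B_def)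
  have "(\<lambda>n. \<mu> (B n)) \<longlonglongrightarrow> \<mu> U"
  proof (rule ccontr)
    assume "\<not> (\<lambda>n. \<mu> (B n)) \<longlonglongrightarrow> \<mu> U"
    then obtain e where e: "e > 0" "\<forall>N. \<exists>n\<ge>N. \<not> norm (\<mu> (B n) - \<mu> U) < e"
      unfolding LIMSEQ_iff by blast
    define J where "J = {n. e \<le> \<bar>\<mu> (B n) - \<mu> U\<bar>}"
    have J: "\<exists>n\<in>J. N \<le> n" for N using e(2)[rule_format, of N] by (auto simp: J_def not_less)
    have "\<exists>C\<in>sets M. (\<forall>A\<in>B ` J. null (A - C)) \<and>
      (\<forall>B'\<in>sets M. (\<forall>A\<in>B ` J. null (A - B')) \<longrightarrow> null (C - B')) \<and> \<mu> C \<in> {t. e \<le> \<bar>t - \<mu> U\<bar>}"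
    proof (rule ex_lub_event)
      show "B ` J \<subseteq> sets M" using Bm by blast
      show "B ` J \<noteq> {}" using J by blast
      show "\<exists>C\<in>B ` J. A \<union> A' \<subseteq> C" if AA: "A \<in> B ` J" "A' \<in> B ` J" for A A'
      proof -
        obtain m n where mn: "A = B m" "A' = B n" using AA by blast
        obtain k where "k \<in> J" "max m n \<le> k" using J by blast
        then show ?thesis using Bmono[of m k] Bmono[of n k] mn by auto
      qed
      show "closed {t. e \<le> \<bar>t - \<mu> U\<bar>}" by (intro closed_Collect_le continuous_intros)
      show "\<mu> A \<in> {t. e \<le> \<bar>t - \<mu> U\<bar>}" if "A \<in> B ` J" for A using that by (auto simp: J_def)
    qed (rule mu)
    then obtain C where C: "C \<in> sets M" "\<forall>A\<in>B ` J. null (A - C)"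
      "\<forall>B'\<in>sets M. (\<forall>A\<in>B ` J. null (A - B')) \<longrightarrow> null (C - B')" "\<mu> C \<in> {t. e \<le> \<bar>t - \<mu> U\<bar>}"
      by (elim bexE conjE)
    have CU: "null (C - U)"
    proof (rule C(3)[rule_format, OF U])
      fix A assume "A \<in> B ` J"
      then have "A - U = {}" using UB by blast
      then show "null (A - U)" by (simp only: null_empty)
    qed
    have "null (\<Union>n. if n \<in> J then B n - C else {})" by (rule null_UN) (use C(2) in auto)
    moreover have "U - C \<subseteq> (\<Union>n. if n \<in> J then B n - C else {})"
    proof
      fix \<omega> assume w: "\<omega> \<in> U - C"
      then obtain m where "\<omega> \<in> B m" using UB by blast
      moreover obtain k where "k \<in> J" "m \<le> k" using J by blast
      ultimately show "\<omega> \<in> (\<Union>n. if n \<in> J then B n - C else {})" using Bmono[of m k] w by (intro UN_I[of k]) auto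
    qed
    ultimately have "null (U - C)" by (rule null_subset) (use U C(1) in auto)
    then have "\<mu> C = \<mu> U" by (intro V_null_diff[OF mu C(1) U CU])
    then show False using C(4) e(1) by simp
  qed
  moreover have "\<mu> (B n) = (\<Sum>i<n. \<mu> (A i))" for n
    unfolding B_def using A by (intro ba_finite_union[OF V_ba[OF mu]]) (auto simp: disjoint_family_on_def)
  ultimately show "(\<lambda>n. \<mu> (A n)) sums \<mu> (\<Union>n. A n)" by (simp add: sums_def U_def)
qed

text \<open>The support is the complement of the least upper bound \<open>B\<close> of the \<open>|\<mu>|\<close>-null events.  That
  \<open>B\<close> itself is \<open>|\<mu>|\<close>-null follows by comparing \<open>C \<subseteq> B\<close> with the least upper bound of the
  null events contained in \<open>C\<close>.\<close>

lemma V_subset_sca: "V \<subseteq> sca"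
proof
  fix \<mu> assume mu: "\<mu> \<in> V"
  note ba = V_ba[OF mu]
  define \<N> where "\<N> = {A\<in>sets M. modulus M \<mu> A = 0}"
  have NUn: "A \<union> A' \<in> \<N>" if "A \<in> \<N>" "A' \<in> \<N>" for A A'
  proof -
    have "A \<union> A' = A \<union> (A' - A)" by blast
    moreover have "modulus M \<mu> (A \<union> (A' - A)) = modulus M \<mu> A + modulus M \<mu> (A' - A)"
      using that by (intro modulus_Un[OF ba]) (auto simp: \<N>_def)
    moreover have "modulus M \<mu> (A' - A) = 0"
      by (rule modulus_null_mono[OF ba]) (use that in \<open>auto simp: \<N>_def\<close>)
    ultimately show ?thesis using that by (auto simp: \<N>_def)
  qed
  have Nempty: "{} \<in> \<N>" using modulus_empty[OF ba] by (simp add: \<N>_def)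
  \<comment> \<open>Applied below to the whole space and to an arbitrary C inside B. The closed set
    {0} carries \<mu> = 0 from the traces of |\<mu>|-null events on C to their least upper
    bound.\<close>
  have lub: "\<exists>B\<in>sets M. (\<forall>A\<in>\<N>. null ((A \<inter> C) - B)) \<and>
    (\<forall>B'\<in>sets M. (\<forall>A\<in>\<N>. null ((A \<inter> C) - B')) \<longrightarrow> null (B - B')) \<and> \<mu> B = 0" if C: "C \<in> sets M" for C
  proof -
    have "\<exists>B\<in>sets M. (\<forall>A\<in>(\<lambda>A. A \<inter> C) ` \<N>. null (A - B)) \<and>
      (\<forall>B'\<in>sets M. (\<forall>A\<in>(\<lambda>A. A \<inter> C) ` \<N>. null (A - B')) \<longrightarrow> null (B - B')) \<and> \<mu> B \<in> {0}"
    proof (rule ex_lub_event)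
      show "(\<lambda>A. A \<inter> C) ` \<N> \<subseteq> sets M" using C by (auto simp: \<N>_def)
      show "(\<lambda>A. A \<inter> C) ` \<N> \<noteq> {}" using Nempty by blast
      show "\<exists>D\<in>(\<lambda>A. A \<inter> C) ` \<N>. A \<union> A' \<subseteq> D"
        if AA: "A \<in> (\<lambda>A. A \<inter> C) ` \<N>" "A' \<in> (\<lambda>A. A \<inter> C) ` \<N>" for A A'
      proof -
        obtain E E' where E: "E \<in> \<N>" "E' \<in> \<N>" "A = E \<inter> C" "A' = E' \<inter> C" using AA by blast
        show ?thesis using E by (intro bexI[OF _ imageI[OF NUn[OF E(1,2)]]]) blast
      qed
      show "\<mu> A \<in> {0}" if A: "A \<in> (\<lambda>A. A \<inter> C) ` \<N>" for A
      proof -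
        obtain E where E: "E \<in> sets M" "modulus M \<mu> E = 0" "A = E \<inter> C" using A unfolding \<N>_def by blast
        then show ?thesis using modulus_eq_0_iff[OF ba E(1)] C by blast
      qed
    qed (use mu in auto)
    then show ?thesis by simp
  qed
  from lub[OF sets.top] obtain B where B: "B \<in> sets M" "\<forall>A\<in>\<N>. null ((A \<inter> space M) - B)"
    "\<forall>B'\<in>sets M. (\<forall>A\<in>\<N>. null ((A \<inter> space M) - B')) \<longrightarrow> null (B - B')"
    by (elim bexE conjE)
  have "modulus M \<mu> B = 0"
    unfolding modulus_eq_0_iff[OF ba B(1)]
  proof (intro ballI impI)
    fix C assume C: "C \<in> sets M" "C \<subseteq> B"
    from lub[OF C(1)] obtain D where D: "D \<in> sets M" "\<forall>A\<in>\<N>. null ((A \<inter> C) - D)"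
      "\<forall>B'\<in>sets M. (\<forall>A\<in>\<N>. null ((A \<inter> C) - B')) \<longrightarrow> null (D - B')" "\<mu> D = 0"
      by (elim bexE conjE)
    have DC: "null (D - C)"
    proof (rule D(3)[rule_format, OF C(1)])
      fix A
      have "(A \<inter> C) - C = {}" by blast
      then show "null ((A \<inter> C) - C)" by (simp only: null_empty)
    qed
    \<comment> \<open>D bounds the traces of the |\<mu>|-null events on C, so together with the
      complement of C it bounds these events themselves. Minimality of B applies, and inside C it
      says that C - D is null.\<close>
    have "null (B - (D \<union> (space M - C)))"
    proof (rule B(3)[rule_format])
      fix A assume "A \<in> \<N>"
      then have "null ((A \<inter> C) - D)" using D(2) by blast
      moreover have "(A \<inter> space M) - (D \<union> (space M - C)) = (A \<inter> C) - D"
        using sets.sets_into_space[OF C(1)] by blast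
      ultimately show "null ((A \<inter> space M) - (D \<union> (space M - C)))" by simp
    qed (use D(1) C(1) in auto)
    moreover have "B - (D \<union> (space M - C)) = C - D"
      using C(2) sets.sets_into_space[OF B(1)] by blast
    ultimately have "null (C - D)" by simp
    then show "\<mu> C = 0" using V_null_diff[OF mu C(1) D(1) _ DC] D(4) by simp
  qed
  moreover have "space M - (space M - B) = B" using sets.sets_into_space[OF B(1)] by blast
  moreover have "capacity P (N \<inter> (space M - B)) = 0"
    if N: "N \<in> sets M" "modulus M \<mu> (N \<inter> (space M - B)) = 0" for N
  proof -
    have "N \<inter> (space M - B) \<in> \<N>" using N B(1) by (auto simp: \<N>_def)
    then have "null ((N \<inter> (space M - B) \<inter> space M) - B)" using B(2) by blast
    moreover have "(N \<inter> (space M - B) \<inter> space M) - B = N \<inter> (space M - B)" by blast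
    ultimately show ?thesis by (simp add: null_def)
  qed
  ultimately have "supported M P (modulus M \<mu>)"
    unfolding supported_def using B(1) by (intro bexI[of _ "space M - B"]) auto
  then show "\<mu> \<in> sca"
    using V_subset_ca[OF mu] V_ba_c[OF mu] by (simp add: sca_c_def ca_c_def)
qed

lemma sca_subset_V:
  assumes F: "\<And>\<rho>. convex_risk_measure M P \<rho> \<Longrightarrow> property_F2 M P \<rho> \<longleftrightarrow> property_F4 M P V \<rho>"
  shows "sca \<subseteq> V"
proof -
  have prob: "measure Q \<in> V" if Q: "Q \<in> sca_prob M P" for Q
  proof -
    have "property_F2 M P (\<lambda>X. integral\<^sup>L Q (rep X))"
      unfolding property_F2_def by (rule F3_imp_fatou[OF expectation_F3[OF Q]])
    then have "property_F4 M P V (\<lambda>X. integral\<^sup>L Q (rep X))"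
      using F[OF expectation_risk_measure[OF Q]] by blast
    then show ?thesis by (rule expectation_F4_imp_mem[OF Q V_subset])
  qed
  have nonneg: "\<nu> \<in> V" if nu: "\<nu> \<in> sca" "\<And>A. A \<in> sets M \<Longrightarrow> 0 \<le> \<nu> A" for \<nu>
  proof (cases "\<nu> (space M) = 0")
    case True
    have "\<nu> = (\<lambda>_. 0)" by (rule sca_nonneg_zero[OF nu(1) _ True]) (rule nu(2))
    then show ?thesis using V_zero by simp
  next
    case False
    then have pos: "\<nu> (space M) > 0" using nu(2)[OF sets.top] by simp
    obtain Q where Q: "Q \<in> sca_prob M P" "measure Q = (\<lambda>A. \<nu> A / \<nu> (space M))"
      using ex_sca_prob[OF nu pos] by blast
    have "(\<lambda>A. \<nu> (space M) * (\<nu> A / \<nu> (space M))) \<in> V"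
      using V_scale[OF prob[OF Q(1)]] unfolding Q(2) .
    then show ?thesis using pos by simp
  qed
  show ?thesis
  proof
    fix \<mu> assume "\<mu> \<in> sca"
    from sca_Jordan[OF this] obtain \<nu>1 \<nu>2 where nu: "\<nu>1 \<in> sca" "\<nu>2 \<in> sca"
      "\<forall>A\<in>sets M. 0 \<le> \<nu>1 A \<and> 0 \<le> \<nu>2 A" "\<mu> = (\<lambda>A. \<nu>1 A - \<nu>2 A)" by blast
    have "\<nu>1 \<in> V" "\<nu>2 \<in> V" using nu(1-3) by (auto intro: nonneg)
    then show "\<mu> \<in> V" using V_lincomb[of \<nu>1 \<nu>2 1 "-1"] nu(4) by simp
  qed
qed

lemma sca_dual_if_F2_iff_F4:
  assumes "\<And>\<rho>. convex_risk_measure M P \<rho> \<Longrightarrow> property_F2 M P \<rho> \<longleftrightarrow> property_F4 M P V \<rho>"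
  shows "dual_is_L_infty M P sca"
  using V_dual V_subset_sca sca_subset_V[OF assms] by (metis subset_antisym)

end

section \<open>A minimax theorem and order closed level sets\<close>

definition convex_functionals :: "('v \<Rightarrow> real) set \<Rightarrow> bool" where
  "convex_functionals K \<longleftrightarrow> (\<forall>\<phi>\<in>K. \<forall>\<psi>\<in>K. \<forall>t\<in>{0..1}. (\<lambda>v. t * \<phi> v + (1 - t) * \<psi> v) \<in> K)"

text \<open>The pairs (\<phi> u, \<phi> v) form a compact convex set in the plane that misses the
  closed quadrant with corner (c, c). A separating line has a nonnegative normal because the
  quadrant is unbounded in both coordinate directions, and normalizing it yields the weights t and 1
  - t.\<close>

lemma two_point_minimax:
  fixes K :: "('v \<Rightarrow> real) set"
  assumes K: "compact K" "convex_functionals K" and lt: "\<And>\<phi>. \<phi> \<in> K \<Longrightarrow> \<phi> u < c \<or> \<phi> v < c"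
  shows "\<exists>t\<in>{0..1}. \<forall>\<phi>\<in>K. t * \<phi> u + (1 - t) * \<phi> v < c"
proof (cases "K = {}")
  case True then show ?thesis by (intro bexI[of _ 0]) auto
next
  case False
  define T where "T = (\<lambda>\<phi>. (\<phi> u, \<phi> v)) ` K"
  define D where "D = {c..} \<times> {c..}"
  have "convex T"
    unfolding convex_alt
  proof (intro ballI allI impI)
    fix x y s assume "x \<in> T" "y \<in> T" and s: "0 \<le> s \<and> s \<le> (1::real)"
    then obtain \<phi> \<psi> where p: "\<phi> \<in> K" "\<psi> \<in> K" "x = (\<phi> u, \<phi> v)" "y = (\<psi> u, \<psi> v)" by (auto simp: T_def)
    have "(\<lambda>v. s * \<psi> v + (1 - s) * \<phi> v) \<in> K" using K(2) p(1,2) s by (auto simp: convex_functionals_def)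
    from imageI[OF this, of "\<lambda>\<phi>. (\<phi> u, \<phi> v)"] show "(1 - s) *\<^sub>R x + s *\<^sub>R y \<in> T"
      by (simp add: T_def p add.commute)
  qed
  moreover have "compact T" unfolding T_def by (intro compact_continuous_image continuous_intros K(1))
  moreover have "T \<noteq> {}" using False by (simp add: T_def)
  moreover have "convex D" "closed D" unfolding D_def by (intro convex_Times closed_Times; simp)+
  moreover have "T \<inter> D = {}" using lt by (fastforce simp: T_def D_def)
  ultimately obtain a b where ab: "\<forall>x\<in>T. inner a x < b" "\<forall>x\<in>D. inner a x > b"
    using separating_hyperplane_compact_closed[of T D] by blast
  obtain a1 a2 where a: "a = (a1, a2)" by (cases a)
  have D: "b < a1 * x + a2 * y" if "x \<ge> c" "y \<ge> c" for x y
    using ab(2) that by (auto simp: D_def a)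
  have T: "a1 * \<phi> u + a2 * \<phi> v < b" if "\<phi> \<in> K" for \<phi>
    using ab(1) that by (auto simp: T_def a)
  have cc: "b < a1 * c + a2 * c" by (rule D) auto
  have "a1 \<ge> 0"
  proof (rule ccontr)
    assume neg: "\<not> a1 \<ge> 0"
    \<comment> \<open>With a1 < 0, moving the corner by s in the first coordinate lowers the
      functional to exactly b, although it exceeds b on the whole quadrant. The same choice is made
      for a2.\<close>
    define s where "s = (a1 * c + a2 * c - b) / (- a1)"
    have "s \<ge> 0" unfolding s_def using cc neg by (intro divide_nonneg_nonneg) linarith+
    then have "b < a1 * (c + s) + a2 * c" by (intro D) auto
    moreover have "a1 * s = b - (a1 * c + a2 * c)" using neg by (simp add: s_def)
    ultimately show False by (simp add: distrib_left)
  qed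
  moreover have "a2 \<ge> 0"
  proof (rule ccontr)
    assume neg: "\<not> a2 \<ge> 0"
    define s where "s = (a1 * c + a2 * c - b) / (- a2)"
    have "s \<ge> 0" unfolding s_def using cc neg by (intro divide_nonneg_nonneg) linarith+
    then have "b < a1 * c + a2 * (c + s)" by (intro D) auto
    moreover have "a2 * s = b - (a1 * c + a2 * c)" using neg by (simp add: s_def)
    ultimately show False by (simp add: distrib_left)
  qed
  moreover have "a1 + a2 \<noteq> 0"
  proof
    assume "a1 + a2 = 0"
    then have "a1 = 0" "a2 = 0" using calculation by linarith+
    then show False using cc T False by fastforce
  qed
  ultimately have pos: "a1 + a2 > 0" and nn: "a1 \<ge> 0" "a2 \<ge> 0" by linarith+
  define t where "t = a1 / (a1 + a2)"
  have t: "t \<in> {0..1}" using nn pos by (simp add: t_def)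
  have t': "1 - t = a2 / (a1 + a2)" using pos by (simp add: t_def field_simps)
  have "t * \<phi> u + (1 - t) * \<phi> v < c" if "\<phi> \<in> K" for \<phi>
  proof -
    have "t * \<phi> u + (1 - t) * \<phi> v = (a1 * \<phi> u + a2 * \<phi> v) / (a1 + a2)"
      unfolding t' by (simp add: t_def add_divide_distrib)
    moreover have "a1 * \<phi> u + a2 * \<phi> v < c * (a1 + a2)" using T[OF that] cc by (simp add: algebra_simps)
    ultimately show ?thesis using pos by (simp add: pos_divide_less_eq)
  qed
  then show ?thesis using t by blast
qed

text \<open>The part of K on which u fails is again compact and convex, and the induction hypothesis
  finds v for it; the two-point case then mixes u with v. \<open>K0\<close> stays fixed while K
  shrinks, so that the mixing assumption is untouched by the induction.\<close>

lemma finite_minimax: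
  fixes K0 :: "('v \<Rightarrow> real) set"
  assumes mix: "\<And>u v t. u \<in> U \<Longrightarrow> v \<in> U \<Longrightarrow> t \<in> {0..1} \<Longrightarrow> \<exists>w\<in>U. \<forall>\<phi>\<in>K0. \<phi> w = t * \<phi> u + (1 - t) * \<phi> v"
    and F: "finite F" "F \<noteq> {}" "F \<subseteq> U"
    and K: "K \<subseteq> K0" "compact K" "convex_functionals K" "\<And>\<phi>. \<phi> \<in> K \<Longrightarrow> \<exists>u\<in>F. \<phi> u < c"
  shows "\<exists>u\<in>U. \<forall>\<phi>\<in>K. \<phi> u < c"
  using F K
proof (induction F arbitrary: K rule: finite_ne_induct)
  case (singleton u)
  then show ?case by blast
next
  case (insert u F)
  define K' where "K' = K \<inter> {\<phi>. \<phi> u \<in> {c..}}"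
  have "\<exists>v\<in>U. \<forall>\<phi>\<in>K'. \<phi> v < c"
  proof (rule insert.IH)
    show "compact K'" unfolding K'_def by (intro compact_Int_closed closed_eval insert.prems(3)) simp
    show "convex_functionals K'"
      unfolding convex_functionals_def
    proof (intro ballI)
      fix \<phi> \<psi> and t :: real assume p: "\<phi> \<in> K'" "\<psi> \<in> K'" and t: "t \<in> {0..1}"
      then have "t * c + (1 - t) * c \<le> t * \<phi> u + (1 - t) * \<psi> u"
        by (intro add_mono mult_left_mono) (auto simp: K'_def)
      moreover have "(\<lambda>v. t * \<phi> v + (1 - t) * \<psi> v) \<in> K"
        using insert.prems(4) p t unfolding convex_functionals_def K'_def by blast
      ultimately show "(\<lambda>v. t * \<phi> v + (1 - t) * \<psi> v) \<in> K'" by (simp add: K'_def algebra_simps)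
    qed
    show "\<exists>v\<in>F. \<phi> v < c" if "\<phi> \<in> K'" for \<phi>
      using insert.prems(5)[of \<phi>] that by (auto simp: K'_def)
  qed (use insert.prems in \<open>auto simp: K'_def\<close>)
  then obtain v where v: "v \<in> U" "\<forall>\<phi>\<in>K'. \<phi> v < c" by blast
  have "\<phi> u < c \<or> \<phi> v < c" if "\<phi> \<in> K" for \<phi> :: "'v \<Rightarrow> real"
    using v(2) that by (force simp: K'_def)
  then have "\<exists>t\<in>{0..1}. \<forall>\<phi>\<in>K. t * \<phi> u + (1 - t) * \<phi> v < c"
    by (intro two_point_minimax[OF insert.prems(3,4)])
  then obtain t where t: "t \<in> {0..1}" "\<forall>\<phi>\<in>K. t * \<phi> u + (1 - t) * \<phi> v < c" by blast
  have "u \<in> U" using insert.prems(1) by blast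
  from mix[OF this v(1) t(1)] obtain w where w: "w \<in> U" "\<forall>\<phi>\<in>K0. \<phi> w = t * \<phi> u + (1 - t) * \<phi> v" by blast
  have "\<phi> w < c" if "\<phi> \<in> K" for \<phi>
    using w(2) t(2) insert.prems(2) that by (metis subsetD)
  then show ?case using w(1) by blast
qed

text \<open>Compactness leaves finitely many points of U to be mixed. The set U has to be convex
  only as seen by the functionals in K, which suits set functions paired with random
  variables.\<close>

lemma compact_minimax:
  fixes K :: "('v \<Rightarrow> real) set"
  assumes K: "compact K" "convex_functionals K" "K \<noteq> {}"
    and mix: "\<And>u v t. u \<in> U \<Longrightarrow> v \<in> U \<Longrightarrow> t \<in> {0..1} \<Longrightarrow> \<exists>w\<in>U. \<forall>\<phi>\<in>K. \<phi> w = t * \<phi> u + (1 - t) * \<phi> v"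
    and ex: "\<And>\<phi>. \<phi> \<in> K \<Longrightarrow> \<exists>u\<in>U. \<phi> u < c"
  shows "\<exists>u\<in>U. \<forall>\<phi>\<in>K. \<phi> u < c"
proof -
  have "open {\<phi> :: 'v \<Rightarrow> real. \<phi> u < c}" for u by (intro open_Collect_less continuous_intros)
  moreover have "K \<subseteq> (\<Union>u\<in>U. {\<phi>. \<phi> u < c})" using ex by blast
  ultimately obtain F where F: "F \<subseteq> U" "finite F" "K \<subseteq> (\<Union>u\<in>F. {\<phi>. \<phi> u < c})"
    using compactE_image[OF K(1), of U "\<lambda>u. {\<phi>. \<phi> u < c}"] by metis
  have "F \<noteq> {}" using F(3) K(3) by blast
  show ?thesis
  proof (rule finite_minimax[where K0=K and F=F, OF mix])
    show "\<exists>u\<in>F. \<phi> u < c" if "\<phi> \<in> K" for \<phi> using F(3) that by blast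
  qed (use F K \<open>F \<noteq> {}\<close> in auto)
qed

section \<open>Cuts of random variables and supports of supported probabilities\<close>

context qs_space
begin

text \<open>Off S the value is the least one possible for functions bounded by n. Cutting such a
  function therefore lowers it, and the lowering vanishes in order as S runs through the
  supports.\<close>

definition cut :: "real \<Rightarrow> 'a set \<Rightarrow> ('a \<Rightarrow> real) \<Rightarrow> 'a \<Rightarrow> real" where
  "cut n S f = (\<lambda>\<omega>. if \<omega> \<in> S then f \<omega> else - n)"

lemma cut_bounded_rv:
  assumes S: "S \<in> sets M" and f: "f \<in> bounded_rv M" shows "cut n S f \<in> bounded_rv M"
proof -
  have "cut n S f = (\<lambda>\<omega>. indicator S \<omega> * f \<omega> + (- n) * (1 - indicator S \<omega>))"
    by (auto simp: cut_def indicator_def)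
  then show ?thesis
    by (simp only:) (intro bounded_rv_add bounded_rv_mult bounded_rv_diff bounded_rv_indicator S f bounded_rv_const)
qed

definition prob_support :: "'a measure \<Rightarrow> 'a set \<Rightarrow> bool" where
  "prob_support Q S \<longleftrightarrow> S \<in> sets M \<and> measure Q (space M - S) = 0 \<and>
     (\<forall>N\<in>sets M. measure Q (N \<inter> S) = 0 \<longrightarrow> null (N \<inter> S))"

lemma ex_prob_support: "Q \<in> sca_prob M P \<Longrightarrow> \<exists>S. prob_support Q S"
  using sca_prob_support unfolding prob_support_def by blast

text \<open>The null events of (Q + R)/2 are the common null events of Q and R. Hence the supports
  are directed by inclusion.\<close>

lemma prob_support_Un:
  assumes Q: "Q \<in> sca_prob M P" "R \<in> sca_prob M P" and ST: "prob_support Q S" "prob_support R T"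
  shows "\<exists>Q'\<in>sca_prob M P. prob_support Q' (S \<union> T)"
proof -
  note Qp = sca_probD[OF Q(1)] and Rp = sca_probD[OF Q(2)]
  interpret Q: prob_space Q by (rule Qp(1))
  interpret R: prob_space R by (rule Rp(1))
  define \<nu> where "\<nu> = (\<lambda>A. 1 / 2 * measure Q A + 1 / 2 * measure R A)"
  have nu: "\<nu> \<in> sca" unfolding \<nu>_def by (rule sca_lincomb[OF Qp(5) Rp(5)])
  have one: "\<nu> (space M) = 1" using Q.prob_space R.prob_space Qp(3) Rp(3) by (simp add: \<nu>_def)
  obtain Q' where Q': "Q' \<in> sca_prob M P" "measure Q' = \<nu>"
    using ex_sca_prob[OF nu, unfolded one] by (auto simp: \<nu>_def)
  have zero: "\<nu> A = 0 \<longleftrightarrow> measure Q A = 0 \<and> measure R A = 0" for A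
    by (simp add: \<nu>_def add_nonneg_eq_0_iff)
  have S: "S \<in> sets M" "measure Q (space M - S) = 0" "\<forall>N\<in>sets M. measure Q (N \<inter> S) = 0 \<longrightarrow> null (N \<inter> S)"
    and T: "T \<in> sets M" "measure R (space M - T) = 0" "\<forall>N\<in>sets M. measure R (N \<inter> T) = 0 \<longrightarrow> null (N \<inter> T)"
    using ST by (auto simp: prob_support_def)
  have "prob_support Q' (S \<union> T)"
    unfolding prob_support_def Q'(2) zero
  proof (intro conjI ballI impI)
    show "S \<union> T \<in> sets M" using S(1) T(1) by auto
    have "measure Q (space M - (S \<union> T)) \<le> measure Q (space M - S)"
      using S(1) T(1) Qp(2) by (intro Q.finite_measure_mono) auto
    then show "measure Q (space M - (S \<union> T)) = 0" using S(2) by (simp add: measure_le_0_iff)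
    have "measure R (space M - (S \<union> T)) \<le> measure R (space M - T)"
      using S(1) T(1) Rp(2) by (intro R.finite_measure_mono) auto
    then show "measure R (space M - (S \<union> T)) = 0" using T(2) by (simp add: measure_le_0_iff)
    fix N assume N: "N \<in> sets M" "measure Q (N \<inter> (S \<union> T)) = 0 \<and> measure R (N \<inter> (S \<union> T)) = 0"
    have "measure Q (N \<inter> S) \<le> measure Q (N \<inter> (S \<union> T))"
      using N(1) S(1) T(1) Qp(2) by (intro Q.finite_measure_mono) auto
    then have "null (N \<inter> S)" using N S(3) by (simp add: measure_le_0_iff)
    moreover have "measure R (N \<inter> T) \<le> measure R (N \<inter> (S \<union> T))"
      using N(1) S(1) T(1) Rp(2) by (intro R.finite_measure_mono) auto
    then have "null (N \<inter> T)" using N T(3) by (simp add: measure_le_0_iff)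
    ultimately have "null ((N \<inter> S) \<union> (N \<inter> T))" by (rule null_Un)
    then show "null (N \<inter> (S \<union> T))" by (simp add: Int_Un_distrib)
  qed
  then show ?thesis using Q'(1) by blast
qed

end

section \<open>Sublevel sets of a risk measure with (F2)\<close>

locale qs_risk = qs_space M P for M :: "'a measure" and P :: "'a measure set" +
  fixes \<rho> :: "('a \<Rightarrow> real) set \<Rightarrow> real"
  assumes risk: "convex_risk_measure M P \<rho>" and F2: "property_F2 M P \<rho>"
begin

definition r :: "('a \<Rightarrow> real) \<Rightarrow> real" where "r f = \<rho> (cls f)"

lemma r_mono:
  assumes "f \<in> bounded_rv M" "g \<in> bounded_rv M" "QS (\<lambda>\<omega>. f \<omega> \<le> g \<omega>)" shows "r f \<le> r g"
  using risk cls_Linf[OF assms(1)] cls_Linf[OF assms(2)] assms(3)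
    L_le_cls[OF bounded_rv_measurable[OF assms(1)] bounded_rv_measurable[OF assms(2)]]
  unfolding convex_risk_measure_def r_def by blast

lemma r_add_const:
  assumes "f \<in> bounded_rv M" shows "r (\<lambda>\<omega>. f \<omega> + m) = r f + m"
proof -
  have "\<rho> (L_add M P (cls f) (L_scale M P m (L_ind M P (space M)))) = \<rho> (cls f) + m"
    using risk cls_Linf[OF assms] unfolding convex_risk_measure_def by blast
  then show ?thesis
    unfolding scale_one_cls r_def using bounded_rv_measurable[OF assms] by (simp add: L_add_cls)
qed

lemma r_convex:
  assumes f: "f \<in> bounded_rv M" and g: "g \<in> bounded_rv M" and t: "t \<in> {0..1}"
  shows "r (\<lambda>\<omega>. t * f \<omega> + (1 - t) * g \<omega>) \<le> t * r f + (1 - t) * r g"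
proof -
  note fm = bounded_rv_measurable[OF f] and gm = bounded_rv_measurable[OF g]
  have "\<rho> (L_add M P (L_scale M P t (cls f)) (L_scale M P (1 - t) (cls g))) \<le> t * \<rho> (cls f) + (1 - t) * \<rho> (cls g)"
    using risk cls_Linf[OF f] cls_Linf[OF g] t unfolding convex_risk_measure_def by blast
  moreover have "L_add M P (L_scale M P t (cls f)) (L_scale M P (1 - t) (cls g)) = cls (\<lambda>\<omega>. t * f \<omega> + (1 - t) * g \<omega>)"
    using fm gm by (simp add: L_add_cls L_scale_cls)
  ultimately show ?thesis by (simp add: r_def)
qed

text \<open>(F2) restated as closedness of sublevel sets under order limits of representatives. The
  index type is free because the lemma is used with natural numbers and with events as
  indices.\<close>

lemma r_order_closed:
  fixes I :: "'i set"
  assumes dir: "directed I le" and x: "\<And>i. i \<in> I \<Longrightarrow> x i \<in> bounded_rv M" and x': "x' \<in> bounded_rv M"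
    and y: "\<And>i. i \<in> I \<Longrightarrow> y i \<in> bounded_rv M" "\<And>i j. i \<in> I \<Longrightarrow> j \<in> I \<Longrightarrow> le i j \<Longrightarrow> QS (\<lambda>\<omega>. y j \<omega> \<le> y i \<omega>)"
    and inf0: "\<And>w. w \<in> bounded_rv M \<Longrightarrow> (\<And>i. i \<in> I \<Longrightarrow> QS (\<lambda>\<omega>. w \<omega> \<le> y i \<omega>)) \<Longrightarrow> QS (\<lambda>\<omega>. w \<omega> \<le> 0)"
    and xy: "\<And>i. i \<in> I \<Longrightarrow> QS (\<lambda>\<omega>. \<bar>x i \<omega> - x' \<omega>\<bar> \<le> y i \<omega>)"
    and le: "\<And>i. i \<in> I \<Longrightarrow> r (x i) \<le> a"
  shows "r x' \<le> a"
proof -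
  note ym = bounded_rv_measurable[OF y(1)] and xm = bounded_rv_measurable[OF x] and x'm = bounded_rv_measurable[OF x']
  have "order_converges M P I le (\<lambda>i. cls (x i)) (cls x')"
    unfolding order_converges_def
  proof (intro exI[of _ "\<lambda>i. cls (y i)"] conjI ballI impI)
    fix i assume i: "i \<in> I"
    show "cls (y i) \<in> Linf" by (rule cls_Linf[OF y(1)[OF i]])
    have "QS (\<lambda>\<omega>. 0 \<le> y i \<omega>)" by (rule QS_mp[OF xy[OF i]]) linarith
    then show "L_le M P (L_zero M P) (cls (y i))" unfolding L_zero_cls using L_le_cls[OF _ ym[OF i]] by simp
    have "(\<lambda>\<omega>. \<bar>x i \<omega> - x' \<omega>\<bar>) \<in> borel_measurable M" using xm[OF i] x'm by measurable
    then show "L_le M P (L_abs M P (L_diff M P (cls (x i)) (cls x'))) (cls (y i))"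
      using L_le_cls[OF _ ym[OF i]] xy[OF i] xm[OF i] x'm by (simp add: L_diff_cls L_abs_cls)
    fix j assume j: "j \<in> I" "le i j"
    show "L_le M P (cls (y j)) (cls (y i))" using L_le_cls[OF ym[OF j(1)] ym[OF i]] y(2)[OF i j] by simp
  next
    fix Z assume Z: "Z \<in> Linf" "\<forall>i\<in>I. L_le M P Z (cls (y i))"
    from Z(1) obtain w where w: "w \<in> bounded_rv M" "Z = cls w" by (rule LinfE)
    have "QS (\<lambda>\<omega>. w \<omega> \<le> 0)"
    proof (rule inf0[OF w(1)])
      fix i assume i: "i \<in> I"
      show "QS (\<lambda>\<omega>. w \<omega> \<le> y i \<omega>)" using Z(2) i L_le_cls[OF bounded_rv_measurable[OF w(1)] ym[OF i]] w(2) by simp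
    qed
    then show "L_le M P Z (L_zero M P)" unfolding L_zero_cls w(2) using L_le_cls[OF bounded_rv_measurable[OF w(1)]] by simp
  qed
  then have "ereal (\<rho> (cls x')) \<le> net_liminf I le (\<lambda>i. \<rho> (cls (x i)))"
    by (intro property_F2_all_nets[OF P_nonempty P_prob F2, where ?'i='i, unfolded fatou_for_nets_over_def, rule_format] dir)
       (simp_all add: cls_Linf x x')
  also have "\<dots> \<le> ereal a"
    unfolding net_liminf_def
  proof (rule SUP_least)
    fix i assume i: "i \<in> I"
    have "le i i" using dir i by (simp add: directed_def)
    then have "(INF j\<in>{j\<in>I. le i j}. ereal (\<rho> (cls (x j)))) \<le> ereal (\<rho> (cls (x i)))"
      using i by (intro INF_lower) simp
    also have "\<dots> \<le> ereal a" using le[OF i] by (simp add: r_def)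
    finally show "(INF j\<in>{j\<in>I. le i j}. ereal (\<rho> (cls (x j)))) \<le> ereal a" .
  qed
  finally show ?thesis by (simp add: r_def)
qed

text \<open>Almost sure convergence becomes order convergence on the support. The tail infima
  \<open>Z k\<close> lie below \<open>W k\<close>, so monotonicity keeps their cuts in the sublevel
  set, and they increase to f on S quasi surely; off S all cuts agree.\<close>

lemma r_cut_AE_closed:
  assumes Q: "Q \<in> sca_prob M P" and S: "prob_support Q S"
    and W: "\<And>k::nat. W k \<in> bounded_rv M" "\<And>k \<omega>. \<omega> \<in> space M \<Longrightarrow> \<bar>W k \<omega>\<bar> \<le> n" "\<And>k. r (cut n S (W k)) \<le> a"
    and f: "f \<in> bounded_rv M" and lim: "AE \<omega> in Q. (\<lambda>k. W k \<omega>) \<longlonglongrightarrow> f \<omega>"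
  shows "r (cut n S f) \<le> a"
proof -
  have Sm: "S \<in> sets M" and Snull: "\<And>N. N \<in> sets M \<Longrightarrow> measure Q (N \<inter> S) = 0 \<Longrightarrow> null (N \<inter> S)"
    using S by (auto simp: prob_support_def)
  have good: "QS (\<lambda>\<omega>. \<omega> \<in> S \<longrightarrow> (\<lambda>k. W k \<omega>) \<longlonglongrightarrow> f \<omega>)"
    by (rule AE_QS_support[OF Q Snull Sm lim])
  define Z where "Z k = (\<lambda>\<omega>. INF j. W (k + j) \<omega>)" for k
  have bd: "bdd_below (range (\<lambda>j. W (k + j) \<omega>))" if "\<omega> \<in> space M" for k \<omega>
    using W(2)[OF that] by (intro bdd_belowI2[where m="- n"]) (simp add: abs_le_iff minus_le_iff)
  have ZW: "Z k \<omega> \<le> W (k + j) \<omega>" if "\<omega> \<in> space M" for k j \<omega>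
    unfolding Z_def by (rule cINF_lower[OF bd[OF that]]) simp
  have Zlow: "m \<le> Z k \<omega>" if "\<And>j. m \<le> W (k + j) \<omega>" for k \<omega> m
    unfolding Z_def by (rule cINF_greatest) (simp_all add: that)
  have Zb: "Z k \<in> bounded_rv M" for k
  proof (rule bounded_rvI[where c=n])
    show "Z k \<in> borel_measurable M" unfolding Z_def
      by (rule borel_measurable_cINF) (auto intro: bounded_rv_measurable W(1) bd)
    show "\<bar>Z k \<omega>\<bar> \<le> n" if w: "\<omega> \<in> space M" for \<omega>
    proof -
      have "- n \<le> W (k + j) \<omega>" for j using W(2)[OF w, of "k + j"] by (simp add: abs_le_iff minus_le_iff)
      then have "- n \<le> Z k \<omega>" by (rule Zlow)
      moreover have "Z k \<omega> \<le> n" using ZW[OF w, of k 0] W(2)[OF w, of k] by (simp add: abs_le_iff)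
      ultimately show ?thesis by (simp add: abs_le_iff)
    qed
  qed
  have Zmono: "Z k \<omega> \<le> Z l \<omega>" if "k \<le> l" "\<omega> \<in> space M" for k l \<omega>
  proof (rule Zlow)
    fix j
    have "l + j = k + (l - k + j)" using that(1) by simp
    then show "Z k \<omega> \<le> W (l + j) \<omega>" using ZW[OF that(2), of k "l - k + j"] by simp
  qed
  have Zle: "Z k \<omega> \<le> f \<omega>" if "\<omega> \<in> space M" "(\<lambda>k. W k \<omega>) \<longlonglongrightarrow> f \<omega>" for k \<omega>
  proof (rule LIMSEQ_le_const[OF that(2)])
    have "Z k \<omega> \<le> W m \<omega>" if "m \<ge> k" for m using ZW[OF \<open>\<omega> \<in> space M\<close>, of k "m - k"] that by simp
    then show "\<exists>N. \<forall>m\<ge>N. Z k \<omega> \<le> W m \<omega>" by blast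
  qed
  define y where "y k = (\<lambda>\<omega>. indicator S \<omega> * \<bar>f \<omega> - Z k \<omega>\<bar>)" for k
  show ?thesis
  proof (rule r_order_closed[of "UNIV :: nat set" "(\<le>)" "\<lambda>k. cut n S (Z k)" _ y])
    show "directed (UNIV :: nat set) (\<le>)"
      unfolding directed_def
    proof (intro conjI ballI impI)
      show "\<exists>k\<in>UNIV. i \<le> k \<and> j \<le> k" for i j :: nat by (intro bexI[of _ "max i j"]) auto
    qed auto
    show "y k \<in> bounded_rv M" for k
      unfolding y_def by (intro bounded_rv_mult bounded_rv_indicator bounded_rv_abs bounded_rv_diff Sm f Zb)
    show "cut n S (Z k) \<in> bounded_rv M" "cut n S f \<in> bounded_rv M" for k by (intro cut_bounded_rv Sm Zb f)+
    show "QS (\<lambda>\<omega>. y l \<omega> \<le> y k \<omega>)" if "k \<le> l" for k l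
    proof (rule QS_mp[OF good])
      fix \<omega> assume w: "\<omega> \<in> space M" "\<omega> \<in> S \<longrightarrow> (\<lambda>k. W k \<omega>) \<longlonglongrightarrow> f \<omega>"
      show "y l \<omega> \<le> y k \<omega>"
      proof (cases "\<omega> \<in> S")
        case True
        then show ?thesis using Zle[OF w(1)] w(2) Zmono[OF that w(1)] by (simp add: y_def)
      qed (simp add: y_def)
    qed
    show "QS (\<lambda>\<omega>. \<bar>cut n S (Z k) \<omega> - cut n S f \<omega>\<bar> \<le> y k \<omega>)" for k
      by (rule QS_always) (simp add: cut_def y_def abs_minus_commute)
    show "r (cut n S (Z k)) \<le> a" for k
    proof -
      have "r (cut n S (Z k)) \<le> r (cut n S (W k))"
      proof (rule r_mono[OF cut_bounded_rv[OF Sm Zb] cut_bounded_rv[OF Sm W(1)] QS_always])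
        show "cut n S (Z k) \<omega> \<le> cut n S (W k) \<omega>" if "\<omega> \<in> space M" for \<omega>
          using ZW[OF that, of k 0] by (simp add: cut_def)
      qed
      then show ?thesis using W(3)[of k] by linarith
    qed
    fix w assume "w \<in> bounded_rv M" and wy: "\<And>k. k \<in> UNIV \<Longrightarrow> QS (\<lambda>\<omega>. w \<omega> \<le> y k \<omega>)"
    have "QS (\<lambda>\<omega>. \<forall>k. w \<omega> \<le> y k \<omega>)" by (rule QS_all) (rule wy, simp)
    then show "QS (\<lambda>\<omega>. w \<omega> \<le> 0)"
    proof (rule QS_mp2[OF good])
      fix \<omega> assume w: "\<omega> \<in> space M" "\<omega> \<in> S \<longrightarrow> (\<lambda>k. W k \<omega>) \<longlonglongrightarrow> f \<omega>" "\<forall>k. w \<omega> \<le> y k \<omega>"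
      show "w \<omega> \<le> 0"
      proof (cases "\<omega> \<in> S")
        case True
        then have lim: "(\<lambda>k. W k \<omega>) \<longlonglongrightarrow> f \<omega>" using w(2) by blast
        show ?thesis
        proof (rule field_le_epsilon)
          fix e :: real assume "e > 0"
          then obtain k where k: "\<forall>m\<ge>k. norm (W m \<omega> - f \<omega>) < e" using LIMSEQ_D[OF lim] by blast
          have "f \<omega> - e \<le> Z k \<omega>"
          proof (rule Zlow)
            fix j
            have "norm (W (k + j) \<omega> - f \<omega>) < e" using k by simp
            then show "f \<omega> - e \<le> W (k + j) \<omega>" by (simp add: abs_less_iff)
          qed
          then have "y k \<omega> \<le> e" using Zle[OF w(1) lim, of k] True by (simp add: y_def)
          then show "w \<omega> \<le> 0 + e" using w(3) by (smt (verit))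
        qed
      next
        case False
        then show ?thesis using w(3)[rule_format, of 0] by (simp add: y_def)
      qed
    qed
  qed
qed

end

section \<open>Weak* closed level sets and the Krein--Smulian steps\<close>

locale qs_sca_risk = qs_predual M P "sca_c M P" + qs_risk M P \<rho>
  for M :: "'a measure" and P :: "'a measure set" and \<rho> :: "('a \<Rightarrow> real) set \<Rightarrow> real"
begin

text \<open>The indicator of a non-null event has positive norm, so the isometric duality provides a
  supported set function not vanishing on it, and then a supported probability. Thus supports
  exhaust the space quasi surely.\<close>

lemma ex_charging:
  assumes G: "G \<in> sets M" "\<not> null G" shows "\<exists>Q\<in>sca_prob M P. measure Q G > 0"
proof -
  note Gi = bounded_rv_indicator[OF G(1)]
  have "\<not> QS (\<lambda>\<omega>. indicator G \<omega> = (0::real))"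
  proof
    assume "QS (\<lambda>\<omega>. indicator G \<omega> = (0::real))"
    then obtain N where N: "null N" "\<forall>\<omega>\<in>space M - N. indicator G \<omega> = (0::real)" unfolding QS_iff by blast
    then have "G \<subseteq> N" using sets.sets_into_space[OF G(1)] by (fastforce simp: indicator_eq_0_iff)
    then show False using null_subset[OF N(1) _ G(1)] G(2) by blast
  qed
  from ex_separating[OF Gi this] obtain z where z: "z \<in> sca" "pr (cls (indicator G)) z \<noteq> 0" by blast
  then have "z G \<noteq> 0" using fa_integral_indicator[OF scaD(3)[OF z(1)] G(1)] by (simp add: pr_apply)
  then show ?thesis by (rule ex_sca_prob_charging[OF z(1) G(1)])
qed

text \<open>The cuts of f converge to f in order along the directed family of supports. The factor 2
  n bounds the gap between f and -n. A lower bound of the dominating net that is positive on a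
  non-null G is impossible, since some Q charges G and the net vanishes on the support of Q.\<close>

lemma r_le_if_cuts:
  assumes f: "f \<in> bounded_rv M" and n: "\<And>\<omega>. \<omega> \<in> space M \<Longrightarrow> \<bar>f \<omega>\<bar> \<le> n" "0 \<le> n"
    and le: "\<And>Q S. Q \<in> sca_prob M P \<Longrightarrow> prob_support Q S \<Longrightarrow> r (cut n S f) \<le> a"
  shows "r f \<le> a"
proof -
  define I where "I = {S. \<exists>Q\<in>sca_prob M P. prob_support Q S}"
  define y where "y S = (\<lambda>\<omega>. 2 * n * (1 - indicator S \<omega>) :: real)" for S :: "'a set"
  have Im: "S \<in> sets M" if "S \<in> I" for S using that by (auto simp: I_def prob_support_def)
  have "\<exists>Q. Q \<in> sca_prob M P" using ex_charging[OF sets.top not_null_space] by blast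
  then have I: "I \<noteq> {}" unfolding I_def using ex_prob_support by blast
  show ?thesis
  proof (rule r_order_closed[of I "(\<subseteq>)" "\<lambda>S. cut n S f" f y])
    have "\<exists>T'\<in>I. S \<subseteq> T' \<and> T \<subseteq> T'" if "S \<in> I" "T \<in> I" for S T
    proof -
      from that obtain Q R where "Q \<in> sca_prob M P" "prob_support Q S" "R \<in> sca_prob M P" "prob_support R T"
        unfolding I_def by blast
      then have "S \<union> T \<in> I" unfolding I_def using prob_support_Un by blast
      then show ?thesis by blast
    qed
    then show "directed I (\<subseteq>)" unfolding directed_def using I by blast
    show "cut n S f \<in> bounded_rv M" if "S \<in> I" for S by (rule cut_bounded_rv[OF Im[OF that] f])
    show "y S \<in> bounded_rv M" if "S \<in> I" for S
      unfolding y_def by (intro bounded_rv_cmult bounded_rv_diff bounded_rv_const bounded_rv_indicator Im[OF that])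
    show "QS (\<lambda>\<omega>. y T \<omega> \<le> y S \<omega>)" if "S \<subseteq> T" for S T
      by (rule QS_always) (use that n(2) in \<open>auto simp: y_def indicator_def\<close>)
    show "QS (\<lambda>\<omega>. \<bar>cut n S f \<omega> - f \<omega>\<bar> \<le> y S \<omega>)" for S
    proof (rule QS_always)
      fix \<omega> assume "\<omega> \<in> space M"
      then show "\<bar>cut n S f \<omega> - f \<omega>\<bar> \<le> y S \<omega>"
        using n(1)[of \<omega>] by (cases "\<omega> \<in> S") (auto simp: cut_def y_def abs_le_iff)
    qed
    show "r (cut n S f) \<le> a" if "S \<in> I" for S using that le by (auto simp: I_def)
    fix w assume w: "w \<in> bounded_rv M" "\<And>S. S \<in> I \<Longrightarrow> QS (\<lambda>\<omega>. w \<omega> \<le> y S \<omega>)"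
    note [measurable] = bounded_rv_measurable[OF w(1)]
    define G where "G = {\<omega>\<in>space M. \<not> w \<omega> \<le> 0}"
    have G: "G \<in> sets M" unfolding G_def by measurable
    have "null G"
    proof (rule ccontr)
      assume "\<not> null G"
      then obtain Q where Q: "Q \<in> sca_prob M P" "measure Q G > 0" using ex_charging[OF G] by blast
      obtain S where S: "prob_support Q S" using ex_prob_support[OF Q(1)] by blast
      then have "S \<in> I" using Q(1) by (auto simp: I_def)
      have Sm: "S \<in> sets M" "measure Q (space M - S) = 0" using S by (auto simp: prob_support_def)
      have "AE \<omega> in Q. w \<omega> \<le> y S \<omega>" by (rule QS_AE[OF Q(1) w(2)[OF \<open>S \<in> I\<close>]])
      with AE_support[OF Q(1) Sm] have "AE \<omega> in Q. \<omega> \<notin> G"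
        by eventually_elim (auto simp: G_def y_def)
      moreover have "G \<in> sets Q" using G sca_probD(2)[OF Q(1)] by simp
      ultimately have "emeasure Q G = 0"
        using AE_iff_measurable[of G Q "\<lambda>\<omega>. \<omega> \<notin> G"] sets.sets_into_space[of G Q] by auto
      then show False using Q(2) by (simp add: measure_def)
    qed
    then show "QS (\<lambda>\<omega>. w \<omega> \<le> 0)" by (rule QS_I) (auto simp: G_def)
  qed (rule f)
qed

text \<open>Each truncation of the level set is closed in \<open>L\<^sup>2\<close>, so an almost minimizer of the
  \<open>L\<^sup>2\<close>-distance to \<open>f\<close> yields a separating density.\<close>

lemma level_set_separation:
  assumes f: "f \<in> bounded_rv M" and n: "\<And>\<omega>. \<omega> \<in> space M \<Longrightarrow> \<bar>f \<omega>\<bar> \<le> n" "0 \<le> n"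
    and a: "r (\<lambda>_. 0) \<le> a" "a < r f"
  shows "\<exists>\<mu>\<in>sca. \<exists>d. (\<forall>g\<in>bounded_rv M. (\<forall>\<omega>\<in>space M. \<bar>g \<omega>\<bar> \<le> n) \<longrightarrow> r g \<le> a \<longrightarrow> fa_integral M \<mu> (cls g) \<le> d)
    \<and> d < fa_integral M \<mu> (cls f)"
proof -
  have "\<exists>Q S. Q \<in> sca_prob M P \<and> prob_support Q S \<and> a < r (cut n S f)"
  proof (rule ccontr)
    assume "\<not> ?thesis"
    then have "r f \<le> a" by (intro r_le_if_cuts[OF f n]) force+
    then show False using a(2) by simp
  qed
  then obtain Q S where Q: "Q \<in> sca_prob M P" and S: "prob_support Q S" and fS: "a < r (cut n S f)" by blast
  interpret Q: prob_space Q by (rule sca_probD(1)[OF Q])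
  note int = integrable_prob[OF Q]
  have Sm: "S \<in> sets M" using S by (simp add: prob_support_def)
  \<comment> \<open>Only the cut of g is constrained, so K contains the bounded part of the level
    set, and its level condition depends on the values on S alone, where Q-almost sure limits carry
    quasi-sure information.\<close>
  define K where "K = {g\<in>bounded_rv M. (\<forall>\<omega>\<in>space M. \<bar>g \<omega>\<bar> \<le> n) \<and> r (cut n S g) \<le> a}"
  have KI: "g \<in> K" if g: "g \<in> bounded_rv M" "\<forall>\<omega>\<in>space M. \<bar>g \<omega>\<bar> \<le> n" "r g \<le> a" for g
  proof -
    have "r (cut n S g) \<le> r g"
    proof (rule r_mono[OF cut_bounded_rv[OF Sm g(1)] g(1) QS_always])
      show "cut n S g \<omega> \<le> g \<omega>" if "\<omega> \<in> space M" for \<omega>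
        using g(2) that by (simp add: cut_def abs_le_iff minus_le_iff)
    qed
    then show ?thesis using g by (simp add: K_def)
  qed
  have Kb: "g \<in> bounded_rv M" "\<And>\<omega>. \<omega> \<in> space M \<Longrightarrow> \<bar>g \<omega>\<bar> \<le> n" "r (cut n S g) \<le> a" if "g \<in> K" for g
    using that by (auto simp: K_def)
  have Kconv: "(\<lambda>\<omega>. t * g \<omega> + (1 - t) * h \<omega>) \<in> K" if g: "g \<in> K" and h: "h \<in> K" and t: "t \<in> {0..1}" for g h t
  proof -
    have "\<bar>t * g \<omega> + (1 - t) * h \<omega>\<bar> \<le> n" if w: "\<omega> \<in> space M" for \<omega>
    proof -
      have "\<bar>t * g \<omega> + (1 - t) * h \<omega>\<bar> \<le> t * \<bar>g \<omega>\<bar> + (1 - t) * \<bar>h \<omega>\<bar>"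
        using t abs_triangle_ineq[of "t * g \<omega>" "(1 - t) * h \<omega>"] by (simp add: abs_mult)
      also have "\<dots> \<le> t * n + (1 - t) * n"
        using t Kb(2)[OF g w] Kb(2)[OF h w] by (intro add_mono mult_left_mono) auto
      finally show ?thesis by (simp add: algebra_simps)
    qed
    moreover have "r (cut n S (\<lambda>\<omega>. t * g \<omega> + (1 - t) * h \<omega>)) \<le> a"
    proof -
      have "cut n S (\<lambda>\<omega>. t * g \<omega> + (1 - t) * h \<omega>) = (\<lambda>\<omega>. t * cut n S g \<omega> + (1 - t) * cut n S h \<omega>)"
        by (auto simp: cut_def fun_eq_iff algebra_simps)
      then have "r (cut n S (\<lambda>\<omega>. t * g \<omega> + (1 - t) * h \<omega>)) \<le> t * r (cut n S g) + (1 - t) * r (cut n S h)"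
        using r_convex[OF cut_bounded_rv[OF Sm Kb(1)[OF g]] cut_bounded_rv[OF Sm Kb(1)[OF h]] t] by simp
      also have "\<dots> \<le> t * a + (1 - t) * a"
        using t Kb(3)[OF g] Kb(3)[OF h] by (intro add_mono mult_left_mono) auto
      finally show ?thesis by (simp add: algebra_simps)
    qed
    ultimately show ?thesis
      unfolding K_def using bounded_rv_add[OF bounded_rv_cmult[OF Kb(1)[OF g]] bounded_rv_cmult[OF Kb(1)[OF h]]] by blast
  qed
  define q where "q g = (\<integral>\<omega>. (g \<omega> - f \<omega>) * (g \<omega> - f \<omega>) \<partial>Q)" for g
  have qb: "(\<lambda>\<omega>. (g \<omega> - f \<omega>) * (h \<omega> - k \<omega>)) \<in> bounded_rv M" if "g \<in> bounded_rv M" "h \<in> bounded_rv M" "k \<in> bounded_rv M" for g h k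
    by (intro bounded_rv_mult bounded_rv_diff f that)
  have q0: "0 \<le> q g" for g unfolding q_def by (rule Bochner_Integration.integral_nonneg) simp
  define d where "d = Inf (q ` K)"
  have K0: "(\<lambda>_. 0) \<in> K" by (rule KI) (use n a in auto)
  have bdd: "bdd_below (q ` K)" by (rule bdd_belowI2[where m=0]) (rule q0)
  have d_le: "d \<le> q g" if "g \<in> K" for g unfolding d_def using bdd that by (intro cInf_lower) auto
  have d0: "0 \<le> d" unfolding d_def using K0 q0 by (intro cInf_greatest) auto
  have near: "\<exists>g\<in>K. q g < d + e" if "e > 0" for e
    using cInf_lessD[of "q ` K" "d + e"] K0 that unfolding d_def by auto
  \<comment> \<open>Otherwise functions of K approach f in L^2(Q), a subsequence converges to f
    almost surely, and closedness would put the cut of f into the level set.\<close>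
  have "d \<noteq> 0"
  proof
    assume d: "d = 0"
    have "\<forall>k. \<exists>g. g \<in> K \<and> q g < 1 / Suc k"
    proof
      fix k
      have "(0::real) < 1 / Suc k" by simp
      from near[OF this] show "\<exists>g. g \<in> K \<and> q g < 1 / Suc k" unfolding d by auto
    qed
    then obtain W where "\<forall>k. W k \<in> K \<and> q (W k) < 1 / Suc k" by (rule choice[THEN exE])
    then have W: "\<And>k. W k \<in> K" "\<And>k. q (W k) < 1 / Suc k" by simp_all
    note Wb = Kb(1)[OF W(1)]
    have "(\<lambda>k. q (W k)) \<longlonglongrightarrow> 0"
    proof (rule tendsto_sandwich[OF _ _ tendsto_const LIMSEQ_inverse_real_of_nat])
      show "\<forall>\<^sub>F k in sequentially. 0 \<le> q (W k)" using q0 by simp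
      show "\<forall>\<^sub>F k in sequentially. q (W k) \<le> inverse (real (Suc k))"
        using W(2) by (intro always_eventually allI less_imp_le) (simp add: inverse_eq_divide del: of_nat_Suc)
    qed
    then have "(\<lambda>k. \<integral>\<omega>. norm ((W k \<omega> - f \<omega>) * (W k \<omega> - f \<omega>)) \<partial>Q) \<longlonglongrightarrow> 0" by (simp add: q_def abs_mult_self_eq)
    from tendsto_L1_AE_subseq[OF int[OF qb[OF Wb Wb f]] this]
    obtain s where s: "strict_mono s" "AE \<omega> in Q. (\<lambda>k. (W (s k) \<omega> - f \<omega>) * (W (s k) \<omega> - f \<omega>)) \<longlonglongrightarrow> 0" by blast
    from s(2) have "AE \<omega> in Q. (\<lambda>k. W (s k) \<omega>) \<longlonglongrightarrow> f \<omega>"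
    proof eventually_elim
      case (elim \<omega>)
      have "(\<lambda>k. sqrt ((W (s k) \<omega> - f \<omega>) * (W (s k) \<omega> - f \<omega>))) \<longlonglongrightarrow> sqrt 0"
        by (rule tendsto_real_sqrt[OF elim])
      then have "(\<lambda>k. \<bar>W (s k) \<omega> - f \<omega>\<bar>) \<longlonglongrightarrow> 0" by simp
      then show ?case using tendsto_rabs_zero_iff LIM_zero_iff by blast
    qed
    from r_cut_AE_closed[OF Q S Wb Kb(2)[OF W(1)] Kb(3)[OF W(1)] f this]
    show False using fS by simp
  qed
  then have dpos: "d > 0" using d0 by simp
  \<comment> \<open>The 1 covers the error t^2 in the choice of h, and 4 n^2 bounds (k - h)^2 for
    functions bounded by n. The step t is then taken so small that t c \<le> d.\<close>
  define c where "c = 1 + 4 * (n * n)"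
  have c: "c > 0" by (simp add: c_def add_pos_nonneg)
  define t where "t = min 1 (d / c)"
  have t: "0 < t" "t \<le> 1" "t * c \<le> d"
    using dpos c by (auto simp: t_def min_def field_simps)
  obtain h where h: "h \<in> K" "q h < d + t * t" using near[of "t * t"] t by auto
  note hb = Kb(1)[OF h(1)]
  define g where "g = (\<lambda>\<omega>. f \<omega> - h \<omega>)"
  have gb: "g \<in> bounded_rv M" unfolding g_def by (rule bounded_rv_diff[OF f hb])
  obtain \<mu> where mu: "\<mu> \<in> sca" "\<forall>k\<in>bounded_rv M. fa_integral M \<mu> (cls k) = (\<integral>\<omega>. g \<omega> * k \<omega> \<partial>Q)"
    using ex_sca_density[OF Q gb] by blast
  \<comment> \<open>The margin d is split: members of K pair to at most d / 2 more than h, while f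
    pairs to at least d more than h.\<close>
  define e where "e = (\<integral>\<omega>. g \<omega> * h \<omega> \<partial>Q) + d / 2"
  have "fa_integral M \<mu> (cls k) \<le> e" if k: "k \<in> K" for k
  proof -
    note kb = Kb(1)[OF k]
    define u where "u = (\<integral>\<omega>. g \<omega> * (k \<omega> - h \<omega>) \<partial>Q)"
    define v where "v = (\<integral>\<omega>. (k \<omega> - h \<omega>) * (k \<omega> - h \<omega>) \<partial>Q)"
    have ub: "(\<lambda>\<omega>. g \<omega> * (k \<omega> - h \<omega>)) \<in> bounded_rv M" by (intro bounded_rv_mult bounded_rv_diff gb kb hb)
    have vb: "(\<lambda>\<omega>. (k \<omega> - h \<omega>) * (k \<omega> - h \<omega>)) \<in> bounded_rv M" by (intro bounded_rv_mult bounded_rv_diff kb hb)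
    have "v \<le> (\<integral>\<omega>. 4 * (n * n) \<partial>Q)"
      unfolding v_def
    proof (rule integral_mono[OF int[OF vb]])
      fix \<omega> assume "\<omega> \<in> space Q"
      then have w: "\<omega> \<in> space M" using sca_probD(3)[OF Q] by simp
      have "\<bar>k \<omega> - h \<omega>\<bar> \<le> 2 * n" using Kb(2)[OF k w] Kb(2)[OF h(1) w] by linarith
      then have "\<bar>k \<omega> - h \<omega>\<bar> * \<bar>k \<omega> - h \<omega>\<bar> \<le> (2 * n) * (2 * n)" by (intro mult_mono) (use n(2) in auto)
      then show "(k \<omega> - h \<omega>) * (k \<omega> - h \<omega>) \<le> 4 * (n * n)" by (simp add: abs_mult_self_eq)
    qed simp
    then have v: "v \<le> 4 * (n * n)" by (simp add: Q.prob_space)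
    have "t \<in> {0..1}" using t by simp
    \<comment> \<open>The variational inequality of a projection, for an almost minimizer h: the
      point h + t (k - h) of K has squared distance at least d from f, and expanding the square
      gives d \<le> q h - 2 t u + t^2 v. Dividing by t leaves 2 u \<le> t c.\<close>
    from d_le[OF Kconv[OF k h(1) this]]
    have "d \<le> (\<integral>\<omega>. (h \<omega> - f \<omega>) * (h \<omega> - f \<omega>) + ((- 2 * t) * (g \<omega> * (k \<omega> - h \<omega>)) + (t * t) * ((k \<omega> - h \<omega>) * (k \<omega> - h \<omega>))) \<partial>Q)"
      unfolding q_def g_def by (simp add: algebra_simps)
    also have "\<dots> = q h + ((- 2 * t) * u + (t * t) * v)"
      unfolding q_def u_def v_def using int[OF qb[OF hb hb f]] int[OF ub] int[OF vb] by simp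
    finally have "2 * t * u \<le> t * t + (t * t) * v" using h(2) by simp
    also have "\<dots> \<le> t * t + (t * t) * (4 * (n * n))" using v by (intro add_left_mono mult_left_mono) auto
    finally have "t * (2 * u) \<le> t * (t * c)" by (simp add: c_def algebra_simps)
    then have "2 * u \<le> t * c" using t(1) by simp
    then have "u \<le> d / 2" using t(3) by simp
    moreover have "u = (\<integral>\<omega>. g \<omega> * k \<omega> \<partial>Q) - (\<integral>\<omega>. g \<omega> * h \<omega> \<partial>Q)"
      unfolding u_def using int[OF bounded_rv_mult[OF gb kb]] int[OF bounded_rv_mult[OF gb hb]] by (simp add: right_diff_distrib)
    ultimately show ?thesis using mu(2) kb by (simp add: e_def)
  qed
  moreover have "e < fa_integral M \<mu> (cls f)"
  proof -
    have "q h = (\<integral>\<omega>. g \<omega> * f \<omega> - g \<omega> * h \<omega> \<partial>Q)" unfolding q_def g_def by (simp add: algebra_simps)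
    also have "\<dots> = (\<integral>\<omega>. g \<omega> * f \<omega> \<partial>Q) - (\<integral>\<omega>. g \<omega> * h \<omega> \<partial>Q)"
      using int[OF bounded_rv_mult[OF gb f]] int[OF bounded_rv_mult[OF gb hb]] by simp
    finally have "d \<le> (\<integral>\<omega>. g \<omega> * f \<omega> \<partial>Q) - (\<integral>\<omega>. g \<omega> * h \<omega> \<partial>Q)" using d_le[OF h(1)] by simp
    then show ?thesis using mu(2) f dpos by (simp add: e_def)
  qed
  ultimately show ?thesis using mu(1) KI by blast
qed

text \<open>The level r 0 is chosen so that the constant 0 belongs to every \<open>level n\<close>;
  scaling functions down towards 0 then stays inside the level set.\<close>

definition level :: "real \<Rightarrow> (('a set \<Rightarrow> real) \<Rightarrow> real) set" where
  "level n = {pr (cls f) | f. f \<in> bounded_rv M \<and> (\<forall>\<omega>\<in>space M. \<bar>f \<omega>\<bar> \<le> n) \<and> r f \<le> r (\<lambda>_. 0)}"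

text \<open>By \<open>level_set_separation\<close>, every point of the ball outside
  \<open>level n\<close> is cut off by a closed half space given by an element of
  \<open>sca\<close>. Hence \<open>level n\<close> is a closed part of a compact ball.\<close>

lemma level_compact:
  assumes n: "0 \<le> n" shows "compact (level n)"
proof -
  define H where "H = {(\<mu>, d). \<mu> \<in> sca \<and> (\<forall>g\<in>bounded_rv M. (\<forall>\<omega>\<in>space M. \<bar>g \<omega>\<bar> \<le> n) \<longrightarrow> r g \<le> r (\<lambda>_. 0) \<longrightarrow> fa_integral M \<mu> (cls g) \<le> d)}"
  have "level n = dual_ball n \<inter> (\<Inter>p\<in>H. {\<phi>. \<phi> (fst p) \<in> {..snd p}})"
  proof (intro equalityI subsetI)
    fix \<phi> assume "\<phi> \<in> level n"
    then obtain f where f: "f \<in> bounded_rv M" "\<forall>\<omega>\<in>space M. \<bar>f \<omega>\<bar> \<le> n" "r f \<le> r (\<lambda>_. 0)" "\<phi> = pr (cls f)"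
      by (auto simp: level_def)
    have "Lnorm (cls f) \<le> n" unfolding Lnorm_le_iff[OF f(1) n] by (rule QS_always) (use f(2) in blast)
    then have "\<phi> \<in> dual_ball n" unfolding dual_ball_def f(4) using cls_Linf[OF f(1)] by blast
    moreover have "\<phi> (fst p) \<le> snd p" if "p \<in> H" for p
      using that f by (auto simp: H_def pr_apply)
    ultimately show "\<phi> \<in> dual_ball n \<inter> (\<Inter>p\<in>H. {\<phi>. \<phi> (fst p) \<in> {..snd p}})" by auto
  next
    fix \<phi> assume phi: "\<phi> \<in> dual_ball n \<inter> (\<Inter>p\<in>H. {\<phi>. \<phi> (fst p) \<in> {..snd p}})"
    then obtain X where X: "X \<in> Linf" "Lnorm X \<le> n" "\<phi> = pr X" by (auto simp: dual_ball_def)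
    from Linf_boundedE[OF X(1,2)] obtain f where f: "f \<in> bounded_rv M" "X = cls f" "\<forall>\<omega>. \<bar>f \<omega>\<bar> \<le> n" by metis
    have "r f \<le> r (\<lambda>_. 0)"
    proof (rule ccontr)
      assume "\<not> r f \<le> r (\<lambda>_. 0)"
      then have "r (\<lambda>_. 0) < r f" by simp
      from level_set_separation[OF f(1) f(3)[rule_format] n order_refl this]
      obtain \<mu> d where mu: "\<mu> \<in> sca" "(\<mu>, d) \<in> H" "d < fa_integral M \<mu> (cls f)" unfolding H_def by blast
      then have "\<phi> \<mu> \<le> d" using phi by force
      then show False using mu X(3) f(2) by (simp add: pr_apply)
    qed
    then show "\<phi> \<in> level n" using f X(3) by (auto simp: level_def)
  qed
  moreover have "closed (\<Inter>p\<in>H. {\<phi> :: ('a set \<Rightarrow> real) \<Rightarrow> real. \<phi> (fst p) \<in> {..snd p}})"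
    by (intro closed_INT ballI closed_eval) simp
  ultimately show ?thesis using compact_Int_closed[OF dual_ball_compact[OF n]] by simp
qed

lemma pr_mix:
  assumes f: "f \<in> bounded_rv M" and g: "g \<in> bounded_rv M"
  shows "(\<lambda>\<mu>. t * pr (cls f) \<mu> + (1 - t) * pr (cls g) \<mu>) = pr (cls (\<lambda>\<omega>. t * f \<omega> + (1 - t) * g \<omega>))"
proof
  fix \<mu>
  show "t * pr (cls f) \<mu> + (1 - t) * pr (cls g) \<mu> = pr (cls (\<lambda>\<omega>. t * f \<omega> + (1 - t) * g \<omega>)) \<mu>"
  proof (cases "\<mu> \<in> sca")
    case True then show ?thesis using pr_lincomb[OF f g True] by simp
  next
    \<comment> \<open>Outside \<open>sca\<close> both pairings equal the fixed number
      \<open>undefined\<close>, which a convex combination reproduces.\<close>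
    case False then show ?thesis by (simp add: pairing_def algebra_simps)
  qed
qed

lemma level_convex: "convex_functionals (level n)"
  unfolding convex_functionals_def
proof (intro ballI)
  fix \<phi> \<psi> and t :: real assume "\<phi> \<in> level n" "\<psi> \<in> level n" and t: "t \<in> {0..1}"
  then obtain f g where f: "f \<in> bounded_rv M" "\<forall>\<omega>\<in>space M. \<bar>f \<omega>\<bar> \<le> n" "r f \<le> r (\<lambda>_. 0)" "\<phi> = pr (cls f)"
    and g: "g \<in> bounded_rv M" "\<forall>\<omega>\<in>space M. \<bar>g \<omega>\<bar> \<le> n" "r g \<le> r (\<lambda>_. 0)" "\<psi> = pr (cls g)"
    unfolding level_def by blast
  have "\<bar>t * f \<omega> + (1 - t) * g \<omega>\<bar> \<le> n" if w: "\<omega> \<in> space M" for \<omega>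
  proof -
    have "\<bar>t * f \<omega> + (1 - t) * g \<omega>\<bar> \<le> t * \<bar>f \<omega>\<bar> + (1 - t) * \<bar>g \<omega>\<bar>"
      using t abs_triangle_ineq[of "t * f \<omega>" "(1 - t) * g \<omega>"] by (simp add: abs_mult)
    also have "\<dots> \<le> t * n + (1 - t) * n"
      using t f(2) g(2) w by (intro add_mono mult_left_mono) auto
    finally show ?thesis by (simp add: algebra_simps)
  qed
  moreover have "r (\<lambda>\<omega>. t * f \<omega> + (1 - t) * g \<omega>) \<le> r (\<lambda>_. 0)"
  proof -
    have "r (\<lambda>\<omega>. t * f \<omega> + (1 - t) * g \<omega>) \<le> t * r f + (1 - t) * r g" by (rule r_convex[OF f(1) g(1) t])
    also have "\<dots> \<le> t * r (\<lambda>_. 0) + (1 - t) * r (\<lambda>_. 0)"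
      using t f(3) g(3) by (intro add_mono mult_left_mono) auto
    finally show ?thesis by (simp add: algebra_simps)
  qed
  moreover have "(\<lambda>\<omega>. t * f \<omega> + (1 - t) * g \<omega>) \<in> bounded_rv M" by (intro bounded_rv_add bounded_rv_cmult f g)
  ultimately show "(\<lambda>\<mu>. t * \<phi> \<mu> + (1 - t) * \<psi> \<mu>) \<in> level n"
    unfolding f(4) g(4) pr_mix[OF f(1) g(1)] level_def by blast
qed

lemma pr_zero:
  assumes "\<mu> \<in> sca" shows "pr (cls (\<lambda>_. 0)) \<mu> = 0"
  using pr_bound[of "\<lambda>_. 0" \<mu>] assms Lnorm_le_iff[of "\<lambda>_. 0" 0] Lnorm_nonneg[of "\<lambda>_. 0"] QS_always by simp

lemma level_zero:
  assumes "0 \<le> n" shows "pr (cls (\<lambda>_. 0)) \<in> level n"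
  unfolding level_def using assms by (intro CollectI exI[of _ "\<lambda>_. 0"]) simp

lemma pr_add_scale:
  assumes f: "f \<in> bounded_rv M" and mu: "\<mu> \<in> sca" and nu: "\<nu> \<in> sca"
  shows "pr (cls f) (\<lambda>A. a * \<mu> A + b * \<nu> A) = a * pr (cls f) \<mu> + b * pr (cls f) \<nu>"
  using fa_integral_lincomb_measure[OF scaD(3)[OF mu] scaD(3)[OF nu] f] mu nu sca_lincomb[OF mu nu]
  by (simp add: pr_apply)

lemma ball_mix:
  assumes x: "x \<in> sca" and u: "u \<in> sca" "TV M (\<lambda>A. u A - x A) \<le> c" and v: "v \<in> sca" "TV M (\<lambda>A. v A - x A) \<le> c"
    and t: "t \<in> {0..1}"
  shows "TV M (\<lambda>A. (t * u A + (1 - t) * v A) - x A) \<le> c"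
proof -
  have ba: "(\<lambda>A. u A - x A) \<in> ba M" "(\<lambda>A. v A - x A) \<in> ba M"
    using ba_lincomb(1)[OF scaD(2)[OF u(1)] scaD(2)[OF x], of 1 "-1"]
      ba_lincomb(1)[OF scaD(2)[OF v(1)] scaD(2)[OF x], of 1 "-1"] by simp_all
  have "(\<lambda>A. (t * u A + (1 - t) * v A) - x A) = (\<lambda>A. t * (u A - x A) + (1 - t) * (v A - x A))"
    by (auto simp: fun_eq_iff algebra_simps)
  then have "TV M (\<lambda>A. (t * u A + (1 - t) * v A) - x A) \<le> \<bar>t\<bar> * TV M (\<lambda>A. u A - x A) + \<bar>1 - t\<bar> * TV M (\<lambda>A. v A - x A)"
    using TV_lincomb[OF ba] by simp
  also have "\<dots> \<le> t * c + (1 - t) * c" using t u(2) v(2) by (intro add_mono mult_mono) (auto intro: TV_nonneg ba)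
  finally show ?thesis by (simp add: algebra_simps)
qed

text \<open>Monotonicity and cash-additivity make r 1-Lipschitz, so every f in the level set has
  distance at least e from f0, whatever n is. A norming element in the unit ball then gives a gap
  above e / 2 for each f separately, and the minimax lemma gives one element for all. Its norm bound
  1 is independent of n.\<close>

lemma Krein_Smulian_start:
  assumes f0: "f0 \<in> bounded_rv M" and e: "e > 0" "r (\<lambda>_. 0) + e \<le> r f0" and n: "0 \<le> n"
  shows "\<exists>x\<in>sca. TV M x \<le> 1 \<and> (\<forall>\<phi>\<in>level n. \<phi> x < pr (cls f0) x - e / 2)"
proof -
  define K where "K = (\<lambda>\<phi> \<mu>. \<phi> \<mu> - pr (cls f0) \<mu>) ` level n"
  \<comment> \<open>The unit ball is written with the difference to the zero set function so that
    \<open>ball_mix\<close> applies.\<close>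
  have "\<exists>u\<in>{x\<in>sca. TV M (\<lambda>A. x A - (\<lambda>_. 0) A) \<le> 1}. \<forall>\<phi>\<in>K. \<phi> u < - (e / 2)"
  proof (rule compact_minimax)
    have "continuous_on (level n) (\<lambda>\<phi> \<mu>. \<phi> \<mu> - pr (cls f0) \<mu>)"
      by (intro continuous_on_coordinatewise_then_product continuous_intros)
    then show "compact K" unfolding K_def by (rule compact_continuous_image[OF _ level_compact[OF n]])
    show "convex_functionals K"
      unfolding convex_functionals_def
    proof (intro ballI)
      fix \<phi>' \<psi>' and t :: real assume "\<phi>' \<in> K" "\<psi>' \<in> K" and t: "t \<in> {0..1}"
      then obtain \<phi> \<psi> where p: "\<phi> \<in> level n" "\<psi> \<in> level n" "\<phi>' = (\<lambda>\<mu>. \<phi> \<mu> - pr (cls f0) \<mu>)" "\<psi>' = (\<lambda>\<mu>. \<psi> \<mu> - pr (cls f0) \<mu>)"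
        unfolding K_def by blast
      have lev: "(\<lambda>\<mu>. t * \<phi> \<mu> + (1 - t) * \<psi> \<mu>) \<in> level n"
        using level_convex p(1,2) t unfolding convex_functionals_def by blast
      have "(\<lambda>v. t * \<phi>' v + (1 - t) * \<psi>' v) = (\<lambda>\<mu>. (t * \<phi> \<mu> + (1 - t) * \<psi> \<mu>) - pr (cls f0) \<mu>)"
        unfolding p(3,4) by (rule ext) (simp add: algebra_simps)
      then show "(\<lambda>v. t * \<phi>' v + (1 - t) * \<psi>' v) \<in> K"
        unfolding K_def using imageI[OF lev, of "\<lambda>\<phi> \<mu>. \<phi> \<mu> - pr (cls f0) \<mu>"] by simp
    qed
    show "K \<noteq> {}" using level_zero[OF n] by (auto simp: K_def)
    show "\<exists>w\<in>{x\<in>sca. TV M (\<lambda>A. x A - (\<lambda>_. 0) A) \<le> 1}. \<forall>\<phi>\<in>K. \<phi> w = t * \<phi> u + (1 - t) * \<phi> v"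
      if uv: "u \<in> {x\<in>sca. TV M (\<lambda>A. x A - (\<lambda>_. 0) A) \<le> 1}" "v \<in> {x\<in>sca. TV M (\<lambda>A. x A - (\<lambda>_. 0) A) \<le> 1}" and t: "t \<in> {0..1}" for u v t
    proof (intro bexI ballI)
      have u: "u \<in> sca" "TV M (\<lambda>A. u A - (\<lambda>_. 0) A) \<le> 1" and v: "v \<in> sca" "TV M (\<lambda>A. v A - (\<lambda>_. 0) A) \<le> 1"
        using uv by auto
      show "(\<lambda>A. t * u A + (1 - t) * v A) \<in> {x\<in>sca. TV M (\<lambda>A. x A - (\<lambda>_. 0) A) \<le> 1}"
        using sca_lincomb[OF u(1) v(1)] ball_mix[OF sca_zero u v t] by simp
      fix \<phi> assume "\<phi> \<in> K"
      then obtain f where f: "f \<in> bounded_rv M" "\<phi> = (\<lambda>\<mu>. pr (cls f) \<mu> - pr (cls f0) \<mu>)" unfolding K_def level_def by blast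
      show "\<phi> (\<lambda>A. t * u A + (1 - t) * v A) = t * \<phi> u + (1 - t) * \<phi> v"
        unfolding f(2) pr_add_scale[OF f(1) u(1) v(1)] pr_add_scale[OF f0 u(1) v(1)] by (simp add: algebra_simps)
    qed
    show "\<exists>u\<in>{x\<in>sca. TV M (\<lambda>A. x A - (\<lambda>_. 0) A) \<le> 1}. \<phi> u < - (e / 2)" if phi: "\<phi> \<in> K" for \<phi>
    proof -
      obtain f where f: "f \<in> bounded_rv M" "r f \<le> r (\<lambda>_. 0)" "\<phi> = (\<lambda>\<mu>. pr (cls f) \<mu> - pr (cls f0) \<mu>)"
        using phi unfolding K_def level_def by blast
      note db = bounded_rv_diff[OF f0 f(1)]
      have "e \<le> Lnorm (cls (\<lambda>\<omega>. f0 \<omega> - f \<omega>))"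
      proof -
        define m where "m = Lnorm (cls (\<lambda>\<omega>. f0 \<omega> - f \<omega>))"
        have "QS (\<lambda>\<omega>. \<bar>f0 \<omega> - f \<omega>\<bar> \<le> m)" using Lnorm_le_iff[OF db Lnorm_nonneg[OF db]] by (simp add: m_def)
        then have "QS (\<lambda>\<omega>. f0 \<omega> \<le> f \<omega> + m)" by (rule QS_mp) linarith
        then have "r f0 \<le> r (\<lambda>\<omega>. f \<omega> + m)" by (rule r_mono[OF f0 bounded_rv_add[OF f(1) bounded_rv_const]])
        then have "r f0 \<le> r f + m" by (simp add: r_add_const[OF f(1)])
        then show ?thesis using f(2) e(2) by (simp add: m_def)
      qed
      then have "e / 2 < Lnorm (cls (\<lambda>\<omega>. f0 \<omega> - f \<omega>))" using e(1) by simp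
      from norming[OF cls_Linf[OF db] this] obtain z where z: "z \<in> sca" "TV M z \<le> 1" "e / 2 < pr (cls (\<lambda>\<omega>. f0 \<omega> - f \<omega>)) z" by blast
      then show ?thesis using pr_diff[OF f0 f(1) z(1)] f(3) by (intro bexI[of _ z]) auto
    qed
  qed
  then obtain x where x: "x \<in> sca" "TV M x \<le> 1" "\<forall>\<phi>\<in>K. \<phi> x < - (e / 2)" by auto
  have "\<phi> x < pr (cls f0) x - e / 2" if "\<phi> \<in> level n" for \<phi>
  proof -
    have "(\<lambda>\<mu>. \<phi> \<mu> - pr (cls f0) \<mu>) \<in> K" using that by (simp add: K_def)
    from bspec[OF x(3) this] have "\<phi> x - pr (cls f0) x < - (e / 2)" .
    then show ?thesis by linarith
  qed
  then show ?thesis using x by blast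
qed

text \<open>A functional whose norm exceeds \<open>n\<close> is handled by moving \<open>x\<close> against a norming element, which
  costs only \<open>2 c / n\<close> in total variation.\<close>

lemma Krein_Smulian_step:
  assumes x: "x \<in> sca" and n: "0 < n" and c: "0 < c" "c < c'" and le: "\<And>\<phi>. \<phi> \<in> level n \<Longrightarrow> \<phi> x \<le> c"
  shows "\<exists>x'\<in>sca. TV M (\<lambda>A. x' A - x A) \<le> 2 * c / n \<and> (\<forall>\<phi>\<in>level (2 * n). \<phi> x' < c')"
proof -
  define U where "U = {x'\<in>sca. TV M (\<lambda>A. x' A - x A) \<le> 2 * c / n}"
  have n2: "0 \<le> 2 * n" using n by simp
  have "\<exists>u\<in>U. \<forall>\<phi>\<in>level (2 * n). \<phi> u < c'"
  proof (rule compact_minimax[OF level_compact[OF n2] level_convex])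
    show "level (2 * n) \<noteq> {}" using level_zero[OF n2] by blast
    show "\<exists>w\<in>U. \<forall>\<phi>\<in>level (2 * n). \<phi> w = t * \<phi> u + (1 - t) * \<phi> v" if uv: "u \<in> U" "v \<in> U" and t: "t \<in> {0..1}" for u v t
    proof (intro bexI ballI)
      have u: "u \<in> sca" "TV M (\<lambda>A. u A - x A) \<le> 2 * c / n" and v: "v \<in> sca" "TV M (\<lambda>A. v A - x A) \<le> 2 * c / n"
        using uv by (auto simp: U_def)
      show "(\<lambda>A. t * u A + (1 - t) * v A) \<in> U"
        unfolding U_def using sca_lincomb[OF u(1) v(1)] ball_mix[OF x u v t] by simp
      fix \<phi> assume "\<phi> \<in> level (2 * n)"
      then obtain f where f: "f \<in> bounded_rv M" "\<phi> = pr (cls f)" unfolding level_def by blast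
      show "\<phi> (\<lambda>A. t * u A + (1 - t) * v A) = t * \<phi> u + (1 - t) * \<phi> v"
        unfolding f(2) by (rule pr_add_scale[OF f(1) u(1) v(1)])
    qed
    fix \<phi> assume "\<phi> \<in> level (2 * n)"
    then obtain f where f: "f \<in> bounded_rv M" "\<forall>\<omega>\<in>space M. \<bar>f \<omega>\<bar> \<le> 2 * n" "r f \<le> r (\<lambda>_. 0)" "\<phi> = pr (cls f)"
      unfolding level_def by blast
    define L where "L = Lnorm (cls f)"
    have L: "Lnorm (cls f) \<le> L" by (simp add: L_def)
    from Linf_boundedE[OF cls_Linf[OF f(1)] L] obtain g where g: "g \<in> bounded_rv M" "cls f = cls g" "\<forall>\<omega>. \<bar>g \<omega>\<bar> \<le> L" "0 \<le> L" by metis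
    have rg: "r g \<le> r (\<lambda>_. 0)" using f(3) g(2) by (simp add: r_def)
    show "\<exists>u\<in>U. \<phi> u < c'"
    proof (cases "L \<le> n")
      case True
      have "\<bar>g \<omega>\<bar> \<le> n" for \<omega> using g(3) True by (meson order_trans)
      then have "\<phi> \<in> level n" unfolding level_def f(4) g(2) using g(1) rg by blast
      \<comment> \<open>The old element x itself serves here; the gap between c and c' turns its
        weak bound into the strict one that the open cover in the minimax lemma requires.\<close>
      then have "\<phi> x < c'" using le c(2) by fastforce
      moreover have "x \<in> U" using x c n by (simp add: U_def TV_zero)
      ultimately show ?thesis by blast
    next
      case False
      then have Lpos: "L > 0" using n by linarith
      then have "L / 2 < Lnorm (cls f)" by (simp add: L_def)
      from norming[OF cls_Linf[OF f(1)] this] obtain z where z: "z \<in> sca" "TV M z \<le> 1" "L / 2 < pr (cls f) z" by blast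
      \<comment> \<open>Scaling by s = n / L shrinks the norm to n and stays in the level set,
        because 0 belongs to it. The bound c on \<open>level n\<close> thus becomes c L / n for the
        original function.\<close>
      define s where "s = n / L"
      have s: "s \<in> {0..1}" "0 < s" using False n Lpos by (auto simp: s_def)
      define h where "h = (\<lambda>\<omega>. s * g \<omega> + (1 - s) * (\<lambda>_. 0) \<omega>)"
      have hb: "h \<in> bounded_rv M" unfolding h_def by (intro bounded_rv_add bounded_rv_cmult g(1)) simp
      have "r h \<le> s * r g + (1 - s) * r (\<lambda>_. 0)" unfolding h_def by (rule r_convex[OF g(1) bounded_rv_const s(1)])
      also have "\<dots> \<le> s * r (\<lambda>_. 0) + (1 - s) * r (\<lambda>_. 0)" using rg s by simp
      finally have rh: "r h \<le> r (\<lambda>_. 0)" by (simp add: algebra_simps)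
      have "\<bar>h \<omega>\<bar> \<le> n" for \<omega>
      proof -
        have "\<bar>h \<omega>\<bar> = s * \<bar>g \<omega>\<bar>" using s by (simp add: h_def abs_mult)
        also have "\<dots> \<le> s * L" using g(3) s by (intro mult_left_mono) auto
        finally show ?thesis using Lpos by (simp add: s_def)
      qed
      then have "pr (cls h) \<in> level n" unfolding level_def using hb rh by blast
      then have "pr (cls h) x \<le> c" by (rule le)
      moreover have "pr (cls h) x = s * pr (cls g) x"
        unfolding h_def using pr_lincomb[OF g(1) bounded_rv_const x, of s "1 - s" 0] pr_zero[OF x] by simp
      ultimately have "s * pr (cls f) x \<le> c" using g(2) by simp
      then have fx: "pr (cls f) x \<le> c * L / n" using n Lpos by (simp add: s_def field_simps)
      \<comment> \<open>As z pairs with f to more than L / 2, a shift by 2 c / n lowers the pairing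
        by at least c L / n, the whole bound \<open>fx\<close>; the result is at most 0.\<close>
      define x' where "x' = (\<lambda>A. 1 * x A + (- (2 * c / n)) * z A)"
      have x': "x' \<in> sca" unfolding x'_def by (rule sca_lincomb[OF x z(1)])
      have eq: "(\<lambda>A. x' A - x A) = (\<lambda>A. (- (2 * c / n)) * z A)" by (simp add: x'_def)
      have "TV M (\<lambda>A. x' A - x A) \<le> \<bar>- (2 * c / n)\<bar> * TV M z"
        unfolding eq by (rule TV_scale[OF scaD(2)[OF z(1)]])
      also have "\<dots> \<le> \<bar>- (2 * c / n)\<bar> * 1" using z(2) by (intro mult_left_mono) auto
      also have "\<dots> = 2 * c / n" using c n by simp
      finally have "x' \<in> U" using x' by (simp add: U_def)
      moreover have "pr (cls f) x' < c'"
      proof -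
        have "pr (cls f) x' = pr (cls f) x - (2 * c / n) * pr (cls f) z"
          unfolding x'_def pr_add_scale[OF f(1) x z(1)] by simp
        also have "\<dots> \<le> c * L / n - (2 * c / n) * (L / 2)"
          using fx z(3) c n by (intro diff_mono mult_left_mono) auto
        also have "\<dots> = 0" by simp
        finally show ?thesis using c by linarith
      qed
      ultimately show ?thesis using f(4) by blast
    qed
  qed
  then show ?thesis by (auto simp: U_def)
qed

section \<open>Dual representation\<close>

text \<open>The radii \<open>N k\<close> double, so the corrections, at most 2 C /
  \<open>N k\<close> as C bounds every threshold \<open>c k\<close>, are summable and the elements
  converge in total variation. The initial margin is e / 2; the growth of the thresholds and the
  total drift at f0 cost at most e / 8 each, so a positive margin remains.\<close>

lemma Krein_Smulian_separation:
  assumes f0: "f0 \<in> bounded_rv M" and e: "e > 0" "r (\<lambda>_. 0) + e \<le> r f0"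
  shows "\<exists>y\<in>sca. \<exists>d. (\<forall>f\<in>bounded_rv M. r f \<le> r (\<lambda>_. 0) \<longrightarrow> pr (cls f) y \<le> d) \<and> d < pr (cls f0) y"
proof -
  define R where "R = Lnorm (cls f0)"
  have R: "0 \<le> R" unfolding R_def by (rule Lnorm_nonneg[OF f0])
  define C where "C = R + e"
  have C: "C > 0" using R e(1) by (simp add: C_def)
  \<comment> \<open>With this n0 the total drift \<open>\<epsilon> 0\<close> is e / (8 (R + 1)),
    which changes the pairing with f0, of norm R, by at most e / 8.\<close>
  define n0 where "n0 = 32 * (R + 1) * C / e"
  have n0: "n0 > 0" using R C e(1) by (simp add: n0_def)
  obtain x0 where x0: "x0 \<in> sca" "TV M x0 \<le> 1" "\<forall>\<phi>\<in>level n0. \<phi> x0 < pr (cls f0) x0 - e / 2"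
    using Krein_Smulian_start[OF f0 e less_imp_le[OF n0]] by blast
  define b where "b = pr (cls f0) x0 - e / 2"
  \<comment> \<open>The constant 0 lies in the level set and pairs to 0. Positive thresholds are
    required by the correction step.\<close>
  have b: "0 < b" using x0(3) level_zero[OF less_imp_le[OF n0]] pr_zero[OF x0(1)] by (fastforce simp: b_def)
  have "\<bar>pr (cls f0) x0\<bar> \<le> R * TV M x0" unfolding R_def by (rule pr_bound[OF f0 x0(1)])
  also have "\<dots> \<le> R * 1" using x0(2) R by (rule mult_left_mono)
  finally have bR: "b \<le> R" using e(1) by (simp add: b_def abs_le_iff)
  define c where "c k = b + e / 8 * (1 - (1 / 2) ^ k)" for k :: nat
  have c_pos: "0 < c k" for k
  proof -
    have "(1 / 2 :: real) ^ k \<le> 1" by (rule power_le_one) auto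
    then show ?thesis using b e(1) by (simp add: c_def add_pos_nonneg)
  qed
  have c_le: "c k \<le> b + e / 8" for k using e(1) by (simp add: c_def)
  have c_less: "c k < c (Suc k)" for k using e(1) by (simp add: c_def)
  have cC: "c k \<le> C" for k using c_le[of k] bR e(1) unfolding C_def by linarith
  define N where "N k = n0 * 2 ^ k" for k :: nat
  have N: "0 < N k" for k using n0 by (simp add: N_def)
  have N_Suc: "N (Suc k) = 2 * N k" for k by (simp add: N_def)
  have "\<exists>x. \<forall>k. (x k \<in> sca \<and> (\<forall>\<phi>\<in>level (N k). \<phi> (x k) \<le> c k) \<and> (k = 0 \<longrightarrow> x k = x0)) \<and> TV M (\<lambda>A. x (Suc k) A - x k A) \<le> 2 * C / N k"
  proof (rule dependent_nat_choice)
    have "\<forall>\<phi>\<in>level (N 0). \<phi> x0 \<le> c 0" using x0(3) by (auto simp: N_def c_def b_def intro: less_imp_le)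
    then show "\<exists>x. x \<in> sca \<and> (\<forall>\<phi>\<in>level (N 0). \<phi> x \<le> c 0) \<and> ((0::nat) = 0 \<longrightarrow> x = x0)" using x0(1) by blast
    fix x k assume x: "x \<in> sca \<and> (\<forall>\<phi>\<in>level (N k). \<phi> x \<le> c k) \<and> (k = 0 \<longrightarrow> x = x0)"
    from x have "\<exists>x'\<in>sca. TV M (\<lambda>A. x' A - x A) \<le> 2 * c k / N k \<and> (\<forall>\<phi>\<in>level (2 * N k). \<phi> x' < c (Suc k))"
      by (intro Krein_Smulian_step N c_pos c_less) auto
    then obtain x' where x': "x' \<in> sca" "TV M (\<lambda>A. x' A - x A) \<le> 2 * c k / N k" "\<forall>\<phi>\<in>level (N (Suc k)). \<phi> x' < c (Suc k)"
      unfolding N_Suc by blast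
    have "2 * c k / N k \<le> 2 * C / N k" using cC[of k] N[of k] by (intro divide_right_mono) auto
    then have "TV M (\<lambda>A. x' A - x A) \<le> 2 * C / N k" using x'(2) by linarith
    then show "\<exists>y. (y \<in> sca \<and> (\<forall>\<phi>\<in>level (N (Suc k)). \<phi> y \<le> c (Suc k)) \<and> (Suc k = 0 \<longrightarrow> y = x0)) \<and> TV M (\<lambda>A. y A - x A) \<le> 2 * C / N k"
      using x'(1,3) by (intro exI[of _ x']) (auto intro: less_imp_le)
  qed
  then obtain x where xx: "\<forall>k. (x k \<in> sca \<and> (\<forall>\<phi>\<in>level (N k). \<phi> (x k) \<le> c k) \<and> (k = 0 \<longrightarrow> x k = x0)) \<and> TV M (\<lambda>A. x (Suc k) A - x k A) \<le> 2 * C / N k" ..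
  then have x: "\<And>k. x k \<in> sca" "\<And>k. \<forall>\<phi>\<in>level (N k). \<phi> (x k) \<le> c k" "x 0 = x0"
    "\<And>k. TV M (\<lambda>A. x (Suc k) A - x k A) \<le> 2 * C / N k" by simp_all
  note xba = scaD(2)[OF x(1)]
  \<comment> \<open>The tail of the geometric series: the corrections 2 C / \<open>N j\<close> with
    j \<ge> k sum to 4 C / \<open>N k\<close>.\<close>
  define \<epsilon> where "\<epsilon> k = 4 * C / N k" for k
  have eps_Suc: "2 * C / N k + \<epsilon> (Suc k) = \<epsilon> k" for k using N[of k] by (simp add: \<epsilon>_def N_Suc field_simps)
  have eps_pos: "0 \<le> \<epsilon> k" for k using C N[of k] by (simp add: \<epsilon>_def)
  have dba: "(\<lambda>A. x j A - x k A) \<in> ba M" for j k using ba_lincomb(1)[OF xba xba, of 1 j "-1" k] by simp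
  have tele: "TV M (\<lambda>A. x (k + m) A - x k A) \<le> \<epsilon> k - \<epsilon> (k + m)" for k m
  proof (induction m)
    case 0
    show ?case by (simp add: TV_zero)
  next
    case (Suc m)
    have "TV M (\<lambda>A. (x (Suc (k + m)) A - x (k + m) A) + (x (k + m) A - x k A)) \<le>
      TV M (\<lambda>A. x (Suc (k + m)) A - x (k + m) A) + TV M (\<lambda>A. x (k + m) A - x k A)"
      by (rule TV_add[OF dba dba])
    then have "TV M (\<lambda>A. x (Suc (k + m)) A - x k A) \<le> 2 * C / N (k + m) + (\<epsilon> k - \<epsilon> (k + m))"
      using x(4)[of "k + m"] Suc by simp
    then show ?case using eps_Suc[of "k + m"] by simp
  qed
  have "\<exists>y\<in>sca. \<forall>k. TV M (\<lambda>A. y A - x k A) \<le> \<epsilon> k"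
  proof (rule sca_complete[OF x(1)])
    show "TV M (\<lambda>A. x j A - x k A) \<le> \<epsilon> k" if "k \<le> j" for j k
      using tele[of k "j - k"] that eps_pos[of j] by simp
    have "(\<lambda>k. 4 * C / n0 * (1 / 2) ^ k) \<longlonglongrightarrow> 4 * C / n0 * 0"
      by (intro tendsto_mult tendsto_const LIMSEQ_power_zero) simp
    moreover have "\<epsilon> = (\<lambda>k. 4 * C / n0 * (1 / 2) ^ k)"
      by (simp add: fun_eq_iff \<epsilon>_def N_def power_one_over)
    ultimately show "\<epsilon> \<longlonglongrightarrow> 0" by simp
  qed
  then obtain y where y: "y \<in> sca" "\<And>k. TV M (\<lambda>A. y A - x k A) \<le> \<epsilon> k" by blast
  have yx: "\<bar>pr (cls f) y - pr (cls f) (x k)\<bar> \<le> Lnorm (cls f) * \<epsilon> k" if f: "f \<in> bounded_rv M" for f k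
  proof -
    have d: "(\<lambda>A. 1 * y A + (- 1) * x k A) \<in> sca" by (rule sca_lincomb[OF y(1) x(1)])
    have "pr (cls f) y - pr (cls f) (x k) = pr (cls f) (\<lambda>A. 1 * y A + (- 1) * x k A)"
      unfolding pr_add_scale[OF f y(1) x(1)] by simp
    then have "\<bar>pr (cls f) y - pr (cls f) (x k)\<bar> \<le> Lnorm (cls f) * TV M (\<lambda>A. y A - x k A)"
      using pr_bound[OF f d] by simp
    also have "\<dots> \<le> Lnorm (cls f) * \<epsilon> k" by (rule mult_left_mono[OF y(2) Lnorm_nonneg[OF f]])
    finally show ?thesis .
  qed
  have "pr (cls f) y \<le> b + e / 8" if f: "f \<in> bounded_rv M" "r f \<le> r (\<lambda>_. 0)" for f
  proof -
    define L where "L = Lnorm (cls f)"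
    have LL: "Lnorm (cls f) \<le> L" by (simp add: L_def)
    from Linf_boundedE[OF cls_Linf[OF f(1)] LL] obtain g where g: "g \<in> bounded_rv M" "cls f = cls g" "\<forall>\<omega>. \<bar>g \<omega>\<bar> \<le> L" "0 \<le> L" by metis
    have rg: "r g \<le> r (\<lambda>_. 0)" using f(2) g(2) by (simp add: r_def)
    \<comment> \<open>A given f of the level set belongs to \<open>level (N k)\<close> as soon as
      \<open>N k\<close> exceeds its norm L. From then on its pairing with \<open>x k\<close> is
      controlled, and passing to y costs L \<epsilon> k, which tends to 0.\<close>
    obtain k0 where k0: "L / n0 < real k0" using reals_Archimedean2 by blast
    have ineq: "pr (cls f) y \<le> b + e / 8 + L * (4 * C / N k)" if k: "k \<ge> k0" for k
    proof -
      have "real k \<le> 2 ^ k" by (simp add: less_imp_le of_nat_less_two_power)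
      then have "L / n0 \<le> 2 ^ k" using k0 k by linarith
      then have "L \<le> N k" using n0 by (simp add: N_def field_simps)
      then have "\<bar>g \<omega>\<bar> \<le> N k" for \<omega> using g(3) by (meson order_trans)
      then have "pr (cls f) \<in> level (N k)" unfolding level_def g(2) using g(1) rg by blast
      then have "pr (cls f) (x k) \<le> b + e / 8" using x(2)[of k] c_le[of k] by fastforce
      then show ?thesis using yx[OF f(1), of k] unfolding \<epsilon>_def L_def[symmetric] by linarith
    qed
    have "(\<lambda>k. b + e / 8 + L * (4 * C / n0 * (1 / 2) ^ k)) \<longlonglongrightarrow> b + e / 8 + L * (4 * C / n0 * 0)"
      by (intro tendsto_add tendsto_mult tendsto_const LIMSEQ_power_zero) simp
    moreover have "4 * C / N k = 4 * C / n0 * (1 / 2) ^ k" for k by (simp add: N_def power_one_over)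
    ultimately have "(\<lambda>k. b + e / 8 + L * (4 * C / N k)) \<longlonglongrightarrow> b + e / 8" by simp
    then show ?thesis by (rule LIMSEQ_le_const) (use ineq in blast)
  qed
  moreover have "b + e / 8 < pr (cls f0) y"
  proof -
    have "R * \<epsilon> 0 \<le> e / 8"
    proof -
      have "4 * C / (32 * q * C / e) = e / (8 * q)" if "q > 0" for q
        using that C e(1) by (simp add: field_simps)
      from this[of "R + 1"] have "\<epsilon> 0 = e / (8 * (R + 1))" using R by (simp add: \<epsilon>_def N_def n0_def)
      then have "R * \<epsilon> 0 = R / (R + 1) * (e / 8)" by simp
      also have "\<dots> \<le> 1 * (e / 8)" using R e(1) by (intro mult_right_mono) auto
      finally show ?thesis by simp
    qed
    then show ?thesis using yx[OF f0, of 0] e(1) unfolding x(3) R_def[symmetric] b_def by linarith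
  qed
  ultimately show ?thesis using y(1) by blast
qed

text \<open>The separating functional is nonnegative because the level set is a lower set.\<close>

lemma prob_separation:
  assumes f0: "f0 \<in> bounded_rv M" and e: "e > 0" "r (\<lambda>_. 0) + e \<le> r f0"
  shows "\<exists>Q\<in>sca_prob M P. \<exists>d. (\<forall>f\<in>bounded_rv M. r f \<le> r (\<lambda>_. 0) \<longrightarrow> integral\<^sup>L Q f \<le> d) \<and> d < integral\<^sup>L Q f0"
proof -
  obtain y d where y: "y \<in> sca" "\<forall>f\<in>bounded_rv M. r f \<le> r (\<lambda>_. 0) \<longrightarrow> pr (cls f) y \<le> d" "d < pr (cls f0) y"
    using Krein_Smulian_separation[OF assms] by blast
  have d0: "0 \<le> d" using y(2)[rule_format, OF bounded_rv_const order_refl] pr_zero[OF y(1)] by simp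
  have nonneg: "0 \<le> y G" if G: "G \<in> sets M" for G
  proof (rule ccontr)
    assume neg: "\<not> 0 \<le> y G"
    \<comment> \<open>The function that equals -t on G and 0 elsewhere lies in the level set; with
      this t it would pair with y to d + 1.\<close>
    define t where "t = (d + 1) / (- y G)"
    have "0 \<le> t" unfolding t_def using neg d0 by (intro divide_nonneg_nonneg) linarith+
    moreover have "t * (- y G) = d + 1" using neg by (simp add: t_def)
    ultimately have t: "0 \<le> t" "t * (- y G) = d + 1" .
    have b: "(\<lambda>\<omega>. (- t) * indicator G \<omega>) \<in> bounded_rv M" by (intro bounded_rv_cmult bounded_rv_indicator G)
    have "r (\<lambda>\<omega>. (- t) * indicator G \<omega>) \<le> r (\<lambda>_. 0)"
      by (intro r_mono b bounded_rv_const QS_always) (use t(1) in \<open>simp add: indicator_def\<close>)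
    then have "pr (cls (\<lambda>\<omega>. (- t) * indicator G \<omega>)) y \<le> d" using y(2) b by blast
    moreover have "pr (cls (\<lambda>\<omega>. (- t) * indicator G \<omega>)) y = (- t) * y G"
      using pr_lincomb[OF bounded_rv_indicator[OF G] bounded_rv_indicator[OF G] y(1), of "- t" 0]
        fa_integral_indicator[OF scaD(3)[OF y(1)] G] y(1) by (simp add: pr_apply)
    ultimately show False using t(2) by simp
  qed
  have pos: "0 < y (space M)"
  proof (rule ccontr)
    assume "\<not> 0 < y (space M)"
    then have "y (space M) = 0" using nonneg[OF sets.top] by simp
    then have z: "y = (\<lambda>_. 0)" using sca_nonneg_zero[OF y(1) nonneg] by blast
    have "\<bar>pr (cls f0) y\<bar> \<le> Lnorm (cls f0) * TV M y" by (rule pr_bound[OF f0 y(1)])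
    then have "pr (cls f0) y = 0" unfolding z by (simp add: TV_zero)
    then show False using y(3) d0 by simp
  qed
  obtain Q where Q: "Q \<in> sca_prob M P" "measure Q = (\<lambda>A. y A / y (space M))"
    using ex_sca_prob[OF y(1) nonneg pos] by blast
  have I: "integral\<^sup>L Q f = pr (cls f) y / y (space M)" if f: "f \<in> bounded_rv M" for f
    using fa_integral_prob[OF Q(1) f] fa_integral_lincomb_measure[OF scaD(3)[OF y(1)] scaD(3)[OF y(1)] f, of "1 / y (space M)" 0] y(1)
    unfolding Q(2) by (simp add: pr_apply)
  show ?thesis
  proof (intro bexI[OF _ Q(1)] exI[of _ "d / y (space M)"] conjI ballI impI)
    show "integral\<^sup>L Q f \<le> d / y (space M)" if "f \<in> bounded_rv M" "r f \<le> r (\<lambda>_. 0)" for f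
      unfolding I[OF that(1)] using y(2) that pos by (intro divide_right_mono) auto
    show "d / y (space M) < integral\<^sup>L Q f0"
      unfolding I[OF f0] using y(3) pos by (rule divide_strict_right_mono)
  qed
qed

text \<open>Cash-additivity places f at level r 0 + e and every g at level r 0 by adding constants.
  Separation of the shifted f from the level set then compares f with all g at once, since a
  probability integrates constants to themselves.\<close>

lemma almost_optimal_prob:
  assumes f: "f \<in> bounded_rv M" and e: "e > 0"
  shows "\<exists>Q\<in>sca_prob M P. \<forall>g\<in>bounded_rv M. integral\<^sup>L Q g - r g \<le> integral\<^sup>L Q f - r f + e"
proof -
  define m where "m = r (\<lambda>_. 0) + e - r f"
  have b: "(\<lambda>\<omega>. f \<omega> + m) \<in> bounded_rv M" by (intro bounded_rv_add f bounded_rv_const)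
  have "r (\<lambda>_. 0) + e \<le> r (\<lambda>\<omega>. f \<omega> + m)" unfolding r_add_const[OF f] by (simp add: m_def)
  from prob_separation[OF b e this] obtain Q d where Q: "Q \<in> sca_prob M P"
    "\<forall>f\<in>bounded_rv M. r f \<le> r (\<lambda>_. 0) \<longrightarrow> integral\<^sup>L Q f \<le> d" "d < integral\<^sup>L Q (\<lambda>\<omega>. f \<omega> + m)" by blast
  interpret Q: prob_space Q by (rule sca_probD(1)[OF Q(1)])
  have shift: "integral\<^sup>L Q (\<lambda>\<omega>. g \<omega> + c) = integral\<^sup>L Q g + c" if "g \<in> bounded_rv M" for g c
    using integrable_prob[OF Q(1) that] by (simp add: Q.prob_space)
  show ?thesis
  proof (intro bexI[OF _ Q(1)] ballI)
    fix g assume g: "g \<in> bounded_rv M"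
    have gb: "(\<lambda>\<omega>. g \<omega> + (r (\<lambda>_. 0) - r g)) \<in> bounded_rv M" by (intro bounded_rv_add g bounded_rv_const)
    have "r (\<lambda>\<omega>. g \<omega> + (r (\<lambda>_. 0) - r g)) \<le> r (\<lambda>_. 0)" unfolding r_add_const[OF g] by simp
    then have "integral\<^sup>L Q g + (r (\<lambda>_. 0) - r g) \<le> d" using Q(2) gb shift[OF g] by metis
    then show "integral\<^sup>L Q g - r g \<le> integral\<^sup>L Q f - r f + e"
      using Q(3) unfolding shift[OF f] m_def by linarith
  qed
qed

text \<open>Here \<beta> is the convex conjugate of r, bounded below by the term for g = 0. One
  inequality is built into it; for the other, some Q exists whose supremum \<beta> Q is attained at
  f up to e.\<close>

lemma F2_imp_F3: "property_F3 M P \<rho>"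
proof -
  define \<beta> where "\<beta> Q = (SUP g\<in>bounded_rv M. ereal (integral\<^sup>L Q g - r g))" for Q
  have beta_ge: "ereal (integral\<^sup>L Q g - r g) \<le> \<beta> Q" if "g \<in> bounded_rv M" for Q g
    unfolding \<beta>_def using that by (rule SUP_upper)
  have opt: "\<exists>Q\<in>sca_prob M P. \<beta> Q \<le> ereal (integral\<^sup>L Q f - r f + e)" if f: "f \<in> bounded_rv M" and e: "e > 0" for f e
  proof -
    obtain Q where "Q \<in> sca_prob M P" "\<forall>g\<in>bounded_rv M. integral\<^sup>L Q g - r g \<le> integral\<^sup>L Q f - r f + e"
      using almost_optimal_prob[OF f e] by blast
    then show ?thesis unfolding \<beta>_def by (intro bexI[of _ Q] SUP_least) simp_all
  qed
  show ?thesis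
    unfolding property_F3_def
  proof (intro exI[of _ \<beta>] conjI ballI)
    show "\<exists>b. \<forall>Q\<in>sca_prob M P. ereal b \<le> \<beta> Q"
      using beta_ge[OF bounded_rv_const[of 0]] by (intro exI[of _ "- r (\<lambda>_. 0)"]) simp
    obtain Q where "Q \<in> sca_prob M P" "\<beta> Q \<le> ereal (integral\<^sup>L Q (\<lambda>_. 0) - r (\<lambda>_. 0) + 1)"
      using opt[of "\<lambda>_. 0" 1] by auto
    then show "\<exists>Q\<in>sca_prob M P. \<beta> Q \<noteq> \<infinity>" by (intro bexI[of _ Q]) auto
    fix X assume "X \<in> Linf"
    then obtain f where f: "f \<in> bounded_rv M" "X = cls f" by (rule LinfE)
    have rX: "\<rho> X = r f" by (simp add: r_def f(2))
    show "ereal (\<rho> X) = (SUP Q\<in>sca_prob M P. ereal (integral\<^sup>L Q (rep X)) - \<beta> Q)" (is "_ = ?S")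
    proof (rule antisym)
      show "ereal (\<rho> X) \<le> ?S"
      proof (rule ereal_le_epsilon2)
        fix e :: real assume e: "e > 0"
        obtain Q where Q: "Q \<in> sca_prob M P" "\<beta> Q \<le> ereal (integral\<^sup>L Q f - r f + e)" using opt[OF f(1) e] by blast
        have "ereal (r f - e) \<le> ereal (integral\<^sup>L Q f) - \<beta> Q"
          using Q(2) beta_ge[OF f(1), of Q] by (cases "\<beta> Q") auto
        also have "\<dots> \<le> ?S" using integral_rep[OF Q(1) f(1)] unfolding f(2)[symmetric] by (intro SUP_upper2[OF Q(1)]) simp
        finally have "ereal (r f - e) + ereal e \<le> ?S + ereal e" by (rule add_right_mono)
        then show "ereal (\<rho> X) \<le> ?S + ereal e" by (simp add: rX)
      qed
      show "?S \<le> ereal (\<rho> X)"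
      proof (rule SUP_least)
        fix Q assume Q: "Q \<in> sca_prob M P"
        have "integral\<^sup>L Q (rep X) = integral\<^sup>L Q f" using integral_rep[OF Q f(1)] f(2) by simp
        then show "ereal (integral\<^sup>L Q (rep X)) - \<beta> Q \<le> ereal (\<rho> X)"
          using beta_ge[OF f(1), of Q] by (cases "\<beta> Q") (auto simp: rX)
      qed
    qed
  qed
qed

end

theorem theorem5p12:
  fixes M :: "'a measure" and P :: "'a measure set" and V :: "('a set \<Rightarrow> real) set"
  assumes P_prob: "P \<subseteq> prob_measures M" and P_nonempty: "P \<noteq> {}"
    and V_subset: "V \<subseteq> ba_c M P" and V_subspace: "linear_subspace V"
    and V_dual: "dual_is_L_infty M P V"
  shows "((\<forall>\<rho>. convex_risk_measure M P \<rho> \<longrightarrow> (property_F2 M P \<rho> \<longleftrightarrow> property_F4 M P V \<rho>))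
            \<longrightarrow> dual_is_L_infty M P (sca_c M P)) \<and>
         (dual_is_L_infty M P (sca_c M P)
            \<longrightarrow> (\<forall>\<rho>. convex_risk_measure M P \<rho> \<longrightarrow> (property_F2 M P \<rho> \<longleftrightarrow> property_F3 M P \<rho>)))"
proof -
  interpret V: qs_predual M P V
    using assms by unfold_locales
  show ?thesis
  proof (intro conjI impI allI)
    assume "\<forall>\<rho>. convex_risk_measure M P \<rho> \<longrightarrow> (property_F2 M P \<rho> \<longleftrightarrow> property_F4 M P V \<rho>)"
    then show "dual_is_L_infty M P (sca_c M P)" by (intro V.sca_dual_if_F2_iff_F4) blast
  next
    fix \<rho> assume dual: "dual_is_L_infty M P (sca_c M P)" and risk: "convex_risk_measure M P \<rho>"
    show "property_F2 M P \<rho> \<longleftrightarrow> property_F3 M P \<rho>"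
    proof
      assume F2: "property_F2 M P \<rho>"
      interpret qs_sca_risk M P \<rho>
      proof unfold_locales
        show "sca_c M P \<subseteq> ba_c M P" using V.scaD(3) by blast
        show "linear_subspace (sca_c M P)" by (rule V.sca_subspace)
      qed (fact dual risk F2)+
      show "property_F3 M P \<rho>" by (rule F2_imp_F3)
    next
      assume "property_F3 M P \<rho>"
      then show "property_F2 M P \<rho>" unfolding property_F2_def by (rule V.F3_imp_fatou)
    qed
  qed
qed

end
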